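(* Let $u_0\in H^1(\mathbb{R}^d)$ and $\xi\in C_c^\infty(\mathbb{R}^d;\mathbb{R}^d)$. Let $\{\boldsymbol{t}_t\}_{t\in\mathbb{R}}$ be the flow of $\xi$, i.e. $\partial_t\boldsymbol{t}_t=\xi\circ\boldsymbol{t}_t$ and $\boldsymbol{t}_0=\mathrm{id}_{\mathbb{R}^d}$, and let $u_t=(\boldsymbol{t}_t)_\sharp u_0$ be the push-forward of $u_0$ under $\boldsymbol{t}_t$. Then $$\frac{d}{dt}\bigg|_{t=0}\int_{\mathbb{R}^d}\frac12|\nabla u_t|^2\,dx=\int_{\mathbb{R}^d}-\nabla u_0\cdot\nabla\xi\,\nabla u_0-\frac12|\nabla u_0|^2\,\nabla\cdot\xi-u_0\nabla u_0\cdot\nabla(\nabla\cdot\xi)\,dx.$$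
   Context: The push-forward is that of densities: $\int u_t\zeta\,dx=\int u_0(x)\,\zeta(\boldsymbol{t}_t(x))\,dx$ for all $\zeta\in C_c^0(\mathbb{R}^d)$, equivalently $u_0=\det(\nabla\boldsymbol{t}_t)\,u_t\circ\boldsymbol{t}_t$. *)

theory Defs
  imports "HOL-Analysis.Analysis"
begin

text \<open>On a finite-dimensional domain, requiring every directional derivative of a differentiable
  map to be of class \<open>C\<^sup>k\<close> is the same as requiring this of its Frechet derivative.\<close>

primrec C_k :: "nat \<Rightarrow> ('a::euclidean_space \<Rightarrow> 'b::real_normed_vector) \<Rightarrow> bool" where
  "C_k 0 f \<longleftrightarrow> continuous_on UNIV f"
| "C_k (Suc k) f \<longleftrightarrow>
     (\<forall>x. f differentiable (at x)) \<and> (\<forall>v. C_k k (\<lambda>x. frechet_derivative f (at x) v))"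

definition compactly_supported :: "('a::euclidean_space \<Rightarrow> 'b::real_normed_vector) \<Rightarrow> bool" where
  "compactly_supported f \<longleftrightarrow> compact (closure {x. f x \<noteq> 0})"

definition Cc0 :: "('a::euclidean_space \<Rightarrow> 'b::real_normed_vector) set" where
  "Cc0 = {f. continuous_on UNIV f \<and> compactly_supported f}"

definition Cc_infinity :: "('a::euclidean_space \<Rightarrow> 'b::real_normed_vector) set" where
  "Cc_infinity = {f. (\<forall>k. C_k k f) \<and> compactly_supported f}"

definition grad :: "(real^'n \<Rightarrow> real) \<Rightarrow> real^'n \<Rightarrow> real^'n" where
  "grad f x = (\<chi> i. frechet_derivative f (at x) (axis i 1))"

definition divergence :: "(real^'n \<Rightarrow> real^'n) \<Rightarrow> real^'n \<Rightarrow> real" where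
  "divergence \<xi> x = trace (jacobian \<xi> (at x))"

definition locally_integrable :: "('a::euclidean_space \<Rightarrow> 'b::euclidean_space) \<Rightarrow> bool" where
  "locally_integrable f \<longleftrightarrow> (\<forall>K. compact K \<longrightarrow> set_integrable lebesgue K f)"

definition L2 :: "('a::euclidean_space \<Rightarrow> 'b::euclidean_space) set" where
  "L2 = {f. f \<in> borel_measurable lebesgue \<and> integrable lebesgue (\<lambda>x. (norm (f x))\<^sup>2)}"

definition has_weak_grad :: "(real^'n \<Rightarrow> real) \<Rightarrow> (real^'n \<Rightarrow> real^'n) \<Rightarrow> bool" where
  "has_weak_grad u g \<longleftrightarrow> locally_integrable u \<and> locally_integrable g \<and>
     (\<forall>\<phi>\<in>Cc_infinity. (LINT x|lebesgue. u x *\<^sub>R grad \<phi> x) = - (LINT x|lebesgue. \<phi> x *\<^sub>R g x))"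

text \<open>Elements of \<open>L2\<close> and \<open>H1\<close> are representatives rather than classes modulo null sets. A weak
  gradient is unique almost everywhere, so the choice made in \<open>weak_grad\<close> does not affect
  integrals. It is meaningful only for functions that have a weak gradient.\<close>

definition weak_grad :: "(real^'n \<Rightarrow> real) \<Rightarrow> real^'n \<Rightarrow> real^'n" where
  "weak_grad u = (SOME g. has_weak_grad u g)"

definition H1 :: "(real^'n \<Rightarrow> real) set" where
  "H1 = {u \<in> L2. \<exists>g\<in>L2. has_weak_grad u g}"

definition is_flow :: "('a::real_normed_vector \<Rightarrow> 'a) \<Rightarrow> (real \<Rightarrow> 'a \<Rightarrow> 'a) \<Rightarrow> bool" where
  "is_flow \<xi> T \<longleftrightarrow> (\<forall>x. T 0 x = x) \<and>
     (\<forall>t x. ((\<lambda>s. T s x) has_vector_derivative \<xi> (T t x)) (at t))"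

text \<open>Push-forward of densities, not of functions: the measure with density \<open>v\<close> is the image
  under \<open>S\<close> of the (signed) measure with density \<open>u\<close>. This determines \<open>v\<close> almost everywhere.\<close>

definition is_push_forward :: "('a::euclidean_space \<Rightarrow> 'a) \<Rightarrow> ('a \<Rightarrow> real) \<Rightarrow> ('a \<Rightarrow> real) \<Rightarrow> bool" where
  "is_push_forward S u v \<longleftrightarrow> locally_integrable v \<and>
     (\<forall>\<zeta>\<in>Cc0. (LINT x|lebesgue. v x * \<zeta> x) = (LINT x|lebesgue. u x * \<zeta> (S x)))"

end

theory Submission
  imports Defs
begin

text \<open>Along the flow, the derivative \<open>DT\<^sub>t\<close> solves the variational equation, and its inverse \<open>A\<^sub>t\<close> and
  the density \<open>J\<^sub>t = exp (\<integral>\<^sub>0\<^sup>t div \<xi> \<circ> T\<^sub>s ds)\<close> solve linear differential equations; all of them are smooth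
  in \<open>x\<close>. Testing the weak gradient of \<open>u\<^sub>0\<close> with the columns of \<open>A\<^sub>t\<close> times \<open>\<phi> \<circ> T\<^sub>t\<close> shows that the
  weak gradient of \<open>u\<^sub>t\<close> is the push-forward of \<open>h\<^sub>t = A\<^sub>t\<^sup>T \<nabla>u\<^sub>0 + u\<^sub>0 B\<^sub>t\<close>, where \<open>B\<^sub>t\<close> collects the
  divergences of these columns. Hence \<open>\<integral> 1/2 |\<nabla>u\<^sub>t|\<^sup>2 = \<integral> 1/2 |h\<^sub>t|\<^sup>2 / J\<^sub>t\<close>, in which only smooth
  coefficients depend on \<open>t\<close>, and since \<open>\<partial>\<^sub>t h\<^sub>t = - (D\<xi> \<circ> T\<^sub>t)\<^sup>T h\<^sub>t - u\<^sub>0 (\<nabla> div \<xi>) \<circ> T\<^sub>t\<close>, the right-hand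
  side can be differentiated under the integral sign.

  Determinants are never used: \<open>\<integral> (f \<circ> T\<^sub>t) J\<^sub>t = \<integral> f\<close> holds because \<open>\<rho>\<^sub>t = (f \<circ> T\<^sub>t) J\<^sub>t\<close> satisfies
  \<open>\<partial>\<^sub>t \<rho>\<^sub>t = div (\<rho>\<^sub>t \<xi>)\<close>.\<close>

section \<open>Families of $C^k$ maps\<close>

text \<open>The obstacle: at a fixed point of space, the time derivative of the gradient of
  \<open>u\<^sub>t\<close> formally involves second derivatives of \<open>u\<^sub>0\<close>, which a
  function in \<open>H1\<close> need not have. After pulling back by \<open>T\<^sub>t\<close>, the
  values of \<open>u\<^sub>0\<close> and of its weak gradient at \<open>x\<close> are constants in
  time, and only coefficients governed by linear equations move. Smoothness of every order in
  \<open>x\<close> is needed because a weak gradient may be tested only against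
  \<open>Cc_infinity\<close>, and the test functions used here have entries of
  \<open>A\<^sub>t\<close> as factors. Since \<open>\<xi>\<close> has compact support,
  \<open>D\<xi>\<close> is bounded. All equations are therefore globally Lipschitz, and Gronwall's
  inequality serves for uniqueness, for dependence on parameters and for domination alike. Finally,
  \<open>weak_grad\<close> is a choice and \<open>is_push_forward\<close> fixes
  \<open>u\<^sub>t\<close> only almost everywhere; the fact that test functions separate locally
  integrable functions removes both ambiguities.\<close>

text \<open>Only the \<open>x\<close>-derivatives up to order \<open>k\<close> are required to exist; they must be jointly
  continuous in \<open>(t, x)\<close>. No differentiability in \<open>t\<close> is asked for.\<close>

primrec C_kt :: "nat \<Rightarrow> (real \<Rightarrow> 'a::euclidean_space \<Rightarrow> 'b::real_normed_vector) \<Rightarrow> bool" where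
  "C_kt 0 f \<longleftrightarrow> continuous_on UNIV (\<lambda>(t, x). f t x)"
| "C_kt (Suc k) f \<longleftrightarrow> continuous_on UNIV (\<lambda>(t, x). f t x) \<and>
     (\<forall>t x. f t differentiable (at x)) \<and> (\<forall>v. C_kt k (\<lambda>t x. frechet_derivative (f t) (at x) v))"

lemma C_kt_continuous: "C_kt k f \<Longrightarrow> continuous_on UNIV (\<lambda>(t, x). f t x)"
  by (cases k) auto

lemma C_kt_Suc_imp: "C_kt (Suc k) f \<Longrightarrow> C_kt k f"
proof (induction k arbitrary: f)
  case (Suc k)
  then have "C_kt k (\<lambda>t x. frechet_derivative (f t) (at x) v)" for v
    by (intro Suc.IH) simp
  with Suc.prems show ?case by simp
qed simp

text \<open>Takes the derivative as explicit data \<open>f'\<close>, so that later proofs can work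
  with closed forms instead of \<open>frechet_derivative\<close>.\<close>

lemma C_kt_SucI:
  assumes "continuous_on UNIV (\<lambda>(t, x). f t x)"
    and "\<And>t x. (f t has_derivative f' t x) (at x)"
    and "\<And>v. C_kt k (\<lambda>t x. f' t x v)"
  shows "C_kt (Suc k) f"
proof -
  have "frechet_derivative (f t) (at x) = f' t x" for t x
    using frechet_derivative_at[OF assms(2)] by metis
  with assms show ?thesis
    by (auto simp: differentiable_def)
qed

lemma C_kt_has_derivative:
  assumes "C_kt (Suc k) f"
  shows "(f t has_derivative frechet_derivative (f t) (at x)) (at x)"
  using assms by (auto simp: frechet_derivative_works)

lemma C_kt_frechet: "C_kt (Suc k) f \<Longrightarrow> C_kt k (\<lambda>t x. frechet_derivative (f t) (at x) v)"
  by simp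

lemma continuous_on_slice:
  assumes "continuous_on UNIV (\<lambda>(t, x). f t x)"
  shows "continuous_on UNIV (f t)" "continuous_on UNIV (\<lambda>t. f t x)"
proof -
  have *: "continuous_on UNIV (\<lambda>x. Pair t x)" "continuous_on UNIV (\<lambda>t. Pair t x)"
    by (intro continuous_on_Pair continuous_on_const continuous_on_id)+
  show "continuous_on UNIV (f t)" "continuous_on UNIV (\<lambda>t. f t x)"
    using continuous_on_compose2[OF assms *(1)] continuous_on_compose2[OF assms *(2)] by simp_all
qed

text \<open>Maps without time dependence are treated as constant families, so that a single set of
  closure rules serves both notions.\<close>

lemma C_k_iff_C_kt: "C_k k f \<longleftrightarrow> C_kt k (\<lambda>_. f)"
proof (induction k arbitrary: f)
  case 0
  have "continuous_on UNIV (\<lambda>(t::real, x). f x)" if "continuous_on UNIV f"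
    unfolding split_beta
    by (rule continuous_on_compose2[OF that continuous_on_snd[OF continuous_on_id]]) simp
  then show ?case using continuous_on_slice(1)[of "\<lambda>_. f"] by auto
next
  case (Suc k)
  have "continuous_on UNIV (\<lambda>(t::real, x). f x)" if "\<forall>x. f differentiable (at x)"
  proof -
    have "continuous_on UNIV f"
      using that by (auto intro!: differentiable_imp_continuous_on simp: differentiable_on_def)
    then show ?thesis
      unfolding split_beta by (rule continuous_on_compose2) (auto intro!: continuous_intros)
  qed
  then show ?case
    unfolding C_k.simps C_kt.simps Suc.IH by blast
qed

lemma C_kt_imp_C_k: "C_kt k f \<Longrightarrow> C_k k (f t)"
proof (induction k arbitrary: f)
  case 0
  then show ?case using continuous_on_slice(1) by simp
next
  case (Suc k)
  have "C_k k (\<lambda>x. frechet_derivative (f t) (at x) v)" for v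
    using Suc.prems by (intro Suc.IH[of "\<lambda>t x. frechet_derivative (f t) (at x) v"]) simp
  with Suc.prems show ?case by simp
qed

lemma C_kt_const: "C_kt k (\<lambda>t x. c)"
proof (induction k arbitrary: c)
  case (Suc j)
  show ?case
    by (rule C_kt_SucI[where f'="\<lambda>_ _ _. 0"]) (simp_all add: Suc.IH split_beta)
qed (simp add: split_beta)

lemma C_kt_bounded_linear_arg:
  assumes "bounded_linear L"
  shows "C_kt k (\<lambda>t x. L x)"
proof -
  have cont: "continuous_on UNIV (\<lambda>(t::real, x). L x)"
    unfolding split_beta by (intro bounded_linear.continuous_on[OF assms] continuous_on_snd continuous_on_id)
  show ?thesis
  proof (cases k)
    case 0
    with cont show ?thesis by simp
  next
    case (Suc j)
    show ?thesis
      unfolding Suc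
      by (rule C_kt_SucI[where f'="\<lambda>_ _. L"])
        (auto simp: cont C_kt_const bounded_linear_imp_has_derivative[OF assms])
  qed
qed

lemma C_kt_ident: "C_kt k (\<lambda>t x. x)"
  by (rule C_kt_bounded_linear_arg) simp

lemma C_kt_add: "C_kt k f \<Longrightarrow> C_kt k g \<Longrightarrow> C_kt k (\<lambda>t x. f t x + g t x)"
proof (induction k arbitrary: f g)
  case 0
  then show ?case unfolding C_kt.simps split_beta by (rule continuous_on_add)
next
  case (Suc k)
  show ?case
  proof (rule C_kt_SucI)
    show "continuous_on UNIV (\<lambda>(t, x). f t x + g t x)"
      using C_kt_continuous[OF Suc.prems(1)] C_kt_continuous[OF Suc.prems(2)]
      unfolding split_beta by (rule continuous_on_add)
    show "((\<lambda>x. f t x + g t x) has_derivative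
        (\<lambda>v. frechet_derivative (f t) (at x) v + frechet_derivative (g t) (at x) v)) (at x)" for t x
      by (intro derivative_intros C_kt_has_derivative[OF Suc.prems(1)] C_kt_has_derivative[OF Suc.prems(2)])
    show "C_kt k (\<lambda>t x. frechet_derivative (f t) (at x) v + frechet_derivative (g t) (at x) v)" for v
      using Suc.prems by (intro Suc.IH) auto
  qed
qed

lemma C_kt_sum: "finite S \<Longrightarrow> (\<And>i. i \<in> S \<Longrightarrow> C_kt k (f i)) \<Longrightarrow> C_kt k (\<lambda>t x. \<Sum>i\<in>S. f i t x)"
  by (induction rule: finite_induct) (auto intro!: C_kt_add C_kt_const)

text \<open>The product rule produces two terms built with the same \<open>P\<close>, so the
  induction closes. This one rule covers products, scalings, inner products and all matrix
  products.\<close>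

lemma C_kt_bilinear:
  assumes B: "bounded_bilinear P"
  shows "C_kt k f \<Longrightarrow> C_kt k g \<Longrightarrow> C_kt k (\<lambda>t x. P (f t x) (g t x))"
proof (induction k arbitrary: f g)
  case 0
  then show ?case unfolding C_kt.simps split_beta by (rule bounded_bilinear.continuous_on[OF B])
next
  case (Suc k)
  show ?case
  proof (rule C_kt_SucI)
    show "continuous_on UNIV (\<lambda>(t, x). P (f t x) (g t x))"
      using C_kt_continuous[OF Suc.prems(1)] C_kt_continuous[OF Suc.prems(2)]
      unfolding split_beta by (rule bounded_bilinear.continuous_on[OF B])
    show "((\<lambda>x. P (f t x) (g t x)) has_derivative
        (\<lambda>v. P (f t x) (frechet_derivative (g t) (at x) v) + P (frechet_derivative (f t) (at x) v) (g t x))) (at x)" for t x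
      by (intro bounded_bilinear.FDERIV[OF B] C_kt_has_derivative[OF Suc.prems(1)] C_kt_has_derivative[OF Suc.prems(2)])
    show "C_kt k (\<lambda>t x. P (f t x) (frechet_derivative (g t) (at x) v) + P (frechet_derivative (f t) (at x) v) (g t x))" for v
      by (intro C_kt_add Suc.IH C_kt_Suc_imp[OF Suc.prems(1)] C_kt_Suc_imp[OF Suc.prems(2)]
          C_kt_frechet[OF Suc.prems(1)] C_kt_frechet[OF Suc.prems(2)])
  qed
qed

lemma C_kt_bounded_linear:
  assumes "bounded_linear L" "C_kt k f"
  shows "C_kt k (\<lambda>t x. L (f t x))"
proof -
  \<comment> \<open>A linear map is the bilinear map \<open>r *\<^sub>R L y\<close> with first
    argument frozen at 1, which reduces the claim to the previous rule.\<close>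
  have "bounded_bilinear (\<lambda>(r::real) y. r *\<^sub>R L y)"
    using bounded_bilinear.comp[OF bounded_bilinear_scaleR bounded_linear_ident assms(1)] by simp
  from C_kt_bilinear[OF this C_kt_const[of _ 1] assms(2)] show ?thesis by simp
qed

lemma continuous_on_compose_kt:
  assumes "continuous_on UNIV (\<lambda>(t, y). g t y)" "continuous_on UNIV (\<lambda>(t, x). f t x)"
  shows "continuous_on UNIV (\<lambda>(t, x). g t (f t x))"
proof -
  have "continuous_on UNIV (\<lambda>p. (\<lambda>(t, y). g t y) (fst p, (\<lambda>(t, x). f t x) p))"
    by (rule continuous_on_compose2[OF assms(1)]) (auto intro!: continuous_intros assms(2))
  then show ?thesis by (simp add: split_beta)
qed

lemma linear_expand_Basis:
  fixes v :: "'a::euclidean_space"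
  assumes "linear L"
  shows "L v = (\<Sum>b\<in>Basis. (v \<bullet> b) *\<^sub>R L b)"
proof -
  have "L v = L (\<Sum>b\<in>Basis. (v \<bullet> b) *\<^sub>R b)" by (simp add: euclidean_representation)
  also have "\<dots> = (\<Sum>b\<in>Basis. (v \<bullet> b) *\<^sub>R L b)"
    by (simp add: linear_sum[OF assms] linear_cmul[OF assms])
  finally show ?thesis .
qed

lemma C_kt_compose:
  fixes f :: "real \<Rightarrow> 'a::euclidean_space \<Rightarrow> 'b::euclidean_space"
    and g :: "real \<Rightarrow> 'b \<Rightarrow> 'c::real_normed_vector"
  shows "C_kt k g \<Longrightarrow> C_kt k f \<Longrightarrow> C_kt k (\<lambda>t x. g t (f t x))"
proof (induction k arbitrary: f g)
  case 0
  then show ?case by (auto intro: continuous_on_compose_kt)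
next
  case (Suc k)
  let ?f' = "\<lambda>t x. frechet_derivative (f t) (at x)"
  let ?g' = "\<lambda>t y. frechet_derivative (g t) (at y)"
  show ?case
  proof (rule C_kt_SucI)
    show "continuous_on UNIV (\<lambda>(t, x). g t (f t x))"
      using C_kt_continuous[OF Suc.prems(1)] C_kt_continuous[OF Suc.prems(2)]
      by (rule continuous_on_compose_kt)
    show "((\<lambda>x. g t (f t x)) has_derivative (\<lambda>v. ?g' t (f t x) (?f' t x v))) (at x)" for t x
      using diff_chain_at[OF C_kt_has_derivative[OF Suc.prems(2)] C_kt_has_derivative[OF Suc.prems(1)]]
      by (simp add: o_def)
    \<comment> \<open>The direction \<open>?f' t x v\<close> varies with \<open>x\<close>, whereas
      \<open>C_kt\<close> controls derivatives in fixed directions only. Expanding over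
      \<open>Basis\<close> leaves fixed directions with smooth scalar coefficients.\<close>
    have *: "?g' t (f t x) (?f' t x v) = (\<Sum>b\<in>Basis. (?f' t x v \<bullet> b) *\<^sub>R ?g' t (f t x) b)" for t x v
      by (rule linear_expand_Basis) (rule has_derivative_linear[OF C_kt_has_derivative[OF Suc.prems(1)]])
    show "C_kt k (\<lambda>t x. ?g' t (f t x) (?f' t x v))" for v
      unfolding *
      by (intro C_kt_sum C_kt_bilinear[OF bounded_bilinear_scaleR] finite_Basis
          C_kt_bounded_linear[OF bounded_linear_inner_left]
          C_kt_frechet[OF Suc.prems(2)] Suc.IH C_kt_frechet[OF Suc.prems(1)] C_kt_Suc_imp[OF Suc.prems(2)])
  qed
qed

text \<open>The entries may lie in any normed space, so that applying the rule twice handles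
  matrices.\<close>

lemma C_kt_componentwise:
  fixes f :: "real \<Rightarrow> 'a::euclidean_space \<Rightarrow> 'b::real_normed_vector^'n"
  assumes "\<And>i. C_kt k (\<lambda>t x. f t x $ i)"
  shows "C_kt k f"
proof -
  have bl: "bounded_linear (axis i :: 'b \<Rightarrow> 'b^'n)" for i
  proof (rule bounded_linear_intro[where K=1])
    fix x y :: 'b and r :: real
    show "axis i (x + y) = axis i x + (axis i y :: 'b^'n)"
      by (simp add: vec_eq_iff axis_def)
    show "axis i (r *\<^sub>R x) = r *\<^sub>R (axis i x :: 'b^'n)"
      by (simp add: vec_eq_iff axis_def)
    have "norm (axis i x :: 'b^'n) = sqrt (\<Sum>j\<in>UNIV. (if j = i then (norm x)\<^sup>2 else 0))"
      unfolding norm_vec_def L2_set_def axis_def by (rule arg_cong[where f=sqrt], rule sum.cong) auto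
    then show "norm (axis i x :: 'b^'n) \<le> norm x * 1" by simp
  qed
  have "(\<Sum>i\<in>UNIV. axis i (f t x $ i)) = f t x" for t x
    by (simp add: vec_eq_iff axis_def)
  moreover have "C_kt k (\<lambda>t x. \<Sum>i\<in>UNIV. axis i (f t x $ i))"
    by (intro C_kt_sum C_kt_bounded_linear[OF bl] assms) auto
  ultimately show ?thesis by simp
qed

lemma C_kt_diff: "C_kt k f \<Longrightarrow> C_kt k g \<Longrightarrow> C_kt k (\<lambda>t x. f t x - g t x)"
  using C_kt_add[of k f "\<lambda>t x. (-1 :: real) *\<^sub>R g t x"]
    C_kt_bilinear[OF bounded_bilinear_scaleR C_kt_const[of k "-1 :: real"], of g] by simp

section \<open>Linear differential equations with parameters\<close>

lemma has_vector_derivative_reflect: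
  assumes "(f has_vector_derivative f') (at (- t))"
  shows "((\<lambda>s. f (- s)) has_vector_derivative - f') (at t)"
proof -
  have "(uminus has_vector_derivative (-1 :: real)) (at t)"
    by (auto intro!: derivative_eq_intros simp: has_real_derivative_iff_has_vector_derivative[symmetric])
  from vector_diff_chain_at[OF this assms] show ?thesis
    by (simp add: o_def)
qed

text \<open>The squared norm is used because the norm itself is not differentiable at 0. The mixed
  term is absorbed by \<open>2 * norm (r s) * \<epsilon> \<le> (norm (r s))\<^sup>2 +
  \<epsilon>\<^sup>2\<close>, which is the origin of the \<open>+ 1\<close> in the rate
  \<open>2 * K + 1\<close>.\<close>

lemma gronwall_forward:
  fixes r :: "real \<Rightarrow> 'b::real_inner"
  assumes der: "\<And>s. 0 \<le> s \<Longrightarrow> s \<le> t \<Longrightarrow> (r has_vector_derivative r' s) (at s)"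
    and bd: "\<And>s. 0 \<le> s \<Longrightarrow> s \<le> t \<Longrightarrow> norm (r' s) \<le> K * norm (r s) + \<epsilon>"
    and K: "0 \<le> K" and t: "0 \<le> t"
  shows "(norm (r t))\<^sup>2 \<le> exp ((2 * K + 1) * t) * ((norm (r 0))\<^sup>2 + \<epsilon>\<^sup>2 * t)"
proof -
  define c where "c = 2 * K + 1"
  \<comment> \<open>The exponential is an integrating factor for the rate \<open>c\<close>.
    Subtracting \<open>\<epsilon>\<^sup>2 * s\<close> pays for the remaining forcing, because that
    factor is at most 1 for \<open>s \<ge> 0\<close>.\<close>
  define m where "m = (\<lambda>s. exp (- c * s) * (r s \<bullet> r s) - \<epsilon>\<^sup>2 * s)"
  have "m 0 \<ge> m t"
  proof (rule DERIV_nonpos_imp_nonincreasing[OF t])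
    fix s assume s: "0 \<le> s" "s \<le> t"
    define N' where "N' = 2 * (r s \<bullet> r' s)"
    have "((\<lambda>s. r s \<bullet> r s) has_vector_derivative r s \<bullet> r' s + r' s \<bullet> r s) (at s)"
      by (rule bounded_bilinear.has_vector_derivative[OF bounded_bilinear_inner der[OF s] der[OF s]])
    then have "((\<lambda>s. r s \<bullet> r s) has_real_derivative N') (at s)"
      by (simp add: has_real_derivative_iff_has_vector_derivative N'_def inner_commute)
    then have D: "(m has_real_derivative exp (- c * s) * (N' - c * (r s \<bullet> r s)) - \<epsilon>\<^sup>2) (at s)"
      unfolding m_def by (auto intro!: derivative_eq_intros simp: algebra_simps)
    have "N' \<le> 2 * (norm (r s) * norm (r' s))"
      unfolding N'_def using norm_cauchy_schwarz[of "r s" "r' s"] by simp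
    also have "\<dots> \<le> 2 * (norm (r s) * (K * norm (r s) + \<epsilon>))"
      using bd[OF s] by (intro mult_left_mono) auto
    also have "\<dots> \<le> c * (norm (r s))\<^sup>2 + \<epsilon>\<^sup>2"
      using zero_le_power2[of "norm (r s) - \<epsilon>"] unfolding c_def
      by (simp add: power2_eq_square algebra_simps)
    finally have "N' - c * (r s \<bullet> r s) \<le> \<epsilon>\<^sup>2"
      by (simp add: power2_norm_eq_inner)
    then have "exp (- c * s) * (N' - c * (r s \<bullet> r s)) \<le> exp (- c * s) * \<epsilon>\<^sup>2"
      by (rule mult_left_mono) simp
    also have "\<dots> \<le> 1 * \<epsilon>\<^sup>2"
      using K s by (intro mult_right_mono) (auto simp: c_def mult_nonpos_nonneg)
    finally show "\<exists>y. (m has_real_derivative y) (at s) \<and> y \<le> 0"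
      using D by force
  qed
  then have "exp (- c * t) * (norm (r t))\<^sup>2 \<le> (norm (r 0))\<^sup>2 + \<epsilon>\<^sup>2 * t"
    by (simp add: m_def power2_norm_eq_inner)
  then have "exp (c * t) * (exp (- c * t) * (norm (r t))\<^sup>2) \<le> exp (c * t) * ((norm (r 0))\<^sup>2 + \<epsilon>\<^sup>2 * t)"
    by (rule mult_left_mono) simp
  moreover have "exp (c * t) * (exp (- c * t) * (norm (r t))\<^sup>2) = (norm (r t))\<^sup>2"
    by (simp add: mult.assoc[symmetric] exp_add[symmetric])
  ultimately show ?thesis unfolding c_def by linarith
qed

text \<open>Negative times follow by reflection. The smallness arguments below need a bound that is
  linear in \<open>norm (r 0) + \<epsilon>\<close> with one constant for all
  \<open>\<bar>t\<bar> \<le> H\<close>; sharpness of the constant is irrelevant to them.\<close>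

lemma gronwall:
  fixes r :: "real \<Rightarrow> 'b::real_inner"
  assumes der: "\<And>s. \<bar>s\<bar> \<le> H \<Longrightarrow> (r has_vector_derivative r' s) (at s)"
    and bd: "\<And>s. \<bar>s\<bar> \<le> H \<Longrightarrow> norm (r' s) \<le> K * norm (r s) + \<epsilon>"
    and K: "0 \<le> K" and \<epsilon>: "0 \<le> \<epsilon>" and t: "\<bar>t\<bar> \<le> H"
  shows "norm (r t) \<le> exp ((2 * K + 1) * H) * (1 + H) * (norm (r 0) + \<epsilon>)"
proof -
  define E where "E = exp ((2 * K + 1) * H)"
  have H: "0 \<le> H" using t by simp
  have E: "1 \<le> E" using K H by (simp add: E_def)
  have "(norm (r t))\<^sup>2 \<le> exp ((2 * K + 1) * \<bar>t\<bar>) * ((norm (r 0))\<^sup>2 + \<epsilon>\<^sup>2 * \<bar>t\<bar>)"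
  proof (cases "0 \<le> t")
    case True
    then show ?thesis
      using gronwall_forward[of t r r' K \<epsilon>] der bd K t by simp
  next
    case False
    have "(norm (r (- (- t))))\<^sup>2 \<le> exp ((2 * K + 1) * (- t)) * ((norm (r (- 0)))\<^sup>2 + \<epsilon>\<^sup>2 * (- t))"
      by (rule gronwall_forward[where r="\<lambda>s. r (- s)" and r'="\<lambda>s. - r' (- s)"])
        (use False t K in \<open>auto intro!: has_vector_derivative_reflect der bd\<close>)
    with False show ?thesis by simp
  qed
  also have "\<dots> \<le> E * ((norm (r 0))\<^sup>2 + \<epsilon>\<^sup>2 * H)"
    unfolding E_def using t K by (intro mult_mono add_mono) (auto intro!: mult_left_mono)
  \<comment> \<open>\<open>E\<close> and \<open>1 + H\<close> are at least 1, so squaring them only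
    enlarges the bound. The result is a perfect square, and no root enters the constant.\<close>
  also have "\<dots> \<le> (E * (1 + H) * (norm (r 0) + \<epsilon>))\<^sup>2"
  proof -
    have "E \<le> E\<^sup>2" using E by (simp add: power2_eq_square)
    moreover have "(norm (r 0))\<^sup>2 + \<epsilon>\<^sup>2 * H \<le> (1 + H)\<^sup>2 * (norm (r 0) + \<epsilon>)\<^sup>2"
    proof -
      have "(norm (r 0))\<^sup>2 \<le> (norm (r 0) + \<epsilon>)\<^sup>2" "\<epsilon>\<^sup>2 \<le> (norm (r 0) + \<epsilon>)\<^sup>2"
        using \<epsilon> by (auto intro!: power_mono)
      then have "(norm (r 0))\<^sup>2 + \<epsilon>\<^sup>2 * H \<le> (norm (r 0) + \<epsilon>)\<^sup>2 + (norm (r 0) + \<epsilon>)\<^sup>2 * H"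
        using H by (intro add_mono mult_right_mono)
      also have "\<dots> = (1 + H) * (norm (r 0) + \<epsilon>)\<^sup>2" by (simp add: algebra_simps)
      also have "\<dots> \<le> (1 + H)\<^sup>2 * (norm (r 0) + \<epsilon>)\<^sup>2"
      proof (rule mult_right_mono)
        show "1 + H \<le> (1 + H)\<^sup>2" using H by (simp add: power2_eq_square algebra_simps)
      qed simp
      finally show ?thesis .
    qed
    ultimately have "E * ((norm (r 0))\<^sup>2 + \<epsilon>\<^sup>2 * H) \<le> E\<^sup>2 * ((1 + H)\<^sup>2 * (norm (r 0) + \<epsilon>)\<^sup>2)"
      using H by (intro mult_mono) auto
    then show ?thesis by (simp add: power_mult_distrib mult.assoc)
  qed
  finally show ?thesis
    unfolding E_def[symmetric] using E H \<epsilon> by (rule_tac power2_le_imp_le) auto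
qed

text \<open>The uniqueness principle behind the algebraic identities of the flow: the difference of
  the two sides solves a homogeneous linear equation and starts at 0.\<close>

lemma linear_ode_zero:
  fixes r :: "real \<Rightarrow> 'b::real_inner"
  assumes "\<And>s. (r has_vector_derivative r' s) (at s)"
    and "\<And>s. norm (r' s) \<le> K * norm (r s)" "0 \<le> K" "r 0 = 0"
  shows "r t = 0"
  using gronwall[of "\<bar>t\<bar>" r r' K 0 t] assms by simp

section \<open>Antiderivatives and global solutions\<close>

lemma antiderivative_UNIV:
  fixes f :: "real \<Rightarrow> 'b::banach"
  assumes "continuous_on UNIV f"
  shows "\<exists>g. g 0 = 0 \<and> (\<forall>t. (g has_vector_derivative f t) (at t))"
proof -
  \<comment> \<open>For \<open>t \<noteq> 0\<close> one of the two intervals is empty, so this is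
    the oriented integral from 0 to \<open>t\<close> for either sign.\<close>
  define g where "g = (\<lambda>t. integral {0..t} f - integral {t..0} f)"
  have cont: "continuous_on S f" for S
    using assms continuous_on_subset by blast
  have "(g has_vector_derivative f t) (at t)" for t
  proof -
    define n where "n = \<bar>t\<bar> + 1"
    \<comment> \<open>Around \<open>t\<close>, \<open>g\<close> differs by a constant from an
      indefinite integral starting at \<open>-n\<close>. This makes the change of formula at 0
      invisible to the derivative.\<close>
    have *: "g s = integral {-n..s} f - integral {-n..0} f" if "s \<in> {-n<..<n}" for s
    proof (cases "0 \<le> s")
      case True
      then show ?thesis
        using Henstock_Kurzweil_Integration.integral_combine[of "-n" 0 s f] that
          integrable_continuous_real[OF cont] unfolding g_def
        by (cases "s = 0") (auto simp: algebra_simps)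
    next
      case False
      then show ?thesis
        using Henstock_Kurzweil_Integration.integral_combine[of "-n" s 0 f] that
          integrable_continuous_real[OF cont] unfolding g_def by (auto simp: algebra_simps)
    qed
    have t: "t \<in> {-n..n}" "t \<in> interior {-n..n}" "t \<in> {-n<..<n}" by (auto simp: n_def)
    have "((\<lambda>s. integral {-n..s} f) has_vector_derivative f t) (at t within {-n..n})"
      by (rule integral_has_vector_derivative[OF cont t(1)])
    then have "((\<lambda>s. integral {-n..s} f) has_vector_derivative f t) (at t)"
      unfolding at_within_interior[OF t(2)] .
    from has_vector_derivative_diff[OF this has_vector_derivative_const[of "integral {-n..0} f"]]
    have D: "((\<lambda>s. integral {-n..s} f - integral {-n..0} f) has_vector_derivative f t) (at t)"
      by simp
    show ?thesis
      by (rule has_vector_derivative_transform_within_open[OF D, of "{-n<..<n}"]) (use t(3) * in auto)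
  qed
  then show ?thesis by (intro exI[of _ g]) (auto simp: g_def)
qed

text \<open>Integrating the weight \<open>exp (2 * K * s)\<close> gains a factor
  \<open>1 / (2 * K)\<close>. Against a Lipschitz constant \<open>K\<close>, this leaves the
  contraction factor 1/2.\<close>

lemma exp_growth_forward:
  fixes g :: "real \<Rightarrow> 'b::real_normed_vector"
  assumes "g 0 = 0" and K: "0 < K" "0 \<le> c" and t: "0 \<le> t"
    and der: "\<And>s. 0 \<le> s \<Longrightarrow> s \<le> t \<Longrightarrow> (g has_vector_derivative g' s) (at s)"
    and bd: "\<And>s. 0 \<le> s \<Longrightarrow> s \<le> t \<Longrightarrow> norm (g' s) \<le> 2 * K * c * exp (2 * K * s)"
  shows "norm (g t) \<le> c * exp (2 * K * t)"
proof (cases "t = 0")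
  case False
  define \<phi> where "\<phi> = (\<lambda>s. c * exp (2 * K * s))"
  have \<phi>: "(\<phi> has_vector_derivative 2 * K * c * exp (2 * K * s)) (at s)" for s
    unfolding \<phi>_def has_real_derivative_iff_has_vector_derivative[symmetric]
    by (auto intro!: derivative_eq_intros)
  have "norm (g t - g 0) \<le> \<phi> t - \<phi> 0"
  proof (rule differentiable_bound_general[where f'=g' and \<phi>'="\<lambda>s. 2 * K * c * exp (2 * K * s)"])
    show "continuous_on {0..t} g"
      by (rule continuous_on_vector_derivative[of _ _ g'], rule has_vector_derivative_at_within, rule der) auto
    show "continuous_on {0..t} \<phi>"
      unfolding \<phi>_def by (intro continuous_intros)
  qed (use t False der \<phi> bd in auto)
  also have "\<dots> \<le> \<phi> t" using K by (simp add: \<phi>_def)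
  finally show ?thesis using assms(1) by (simp add: \<phi>_def)
qed (use assms in auto)

lemma exp_growth:
  fixes g :: "real \<Rightarrow> 'b::real_normed_vector"
  assumes g0: "g 0 = 0" and K: "0 < K" "0 \<le> c" and t: "\<bar>t\<bar> \<le> H"
    and der: "\<And>s. \<bar>s\<bar> \<le> H \<Longrightarrow> (g has_vector_derivative g' s) (at s)"
    and bd: "\<And>s. \<bar>s\<bar> \<le> H \<Longrightarrow> norm (g' s) \<le> 2 * K * c * exp (2 * K * \<bar>s\<bar>)"
  shows "norm (g t) \<le> c * exp (2 * K * \<bar>t\<bar>)"
proof (cases "0 \<le> t")
  case True
  have "norm (g' s) \<le> 2 * K * c * exp (2 * K * s)" if "0 \<le> s" "s \<le> t" for s
    using bd[of s] that t by simp
  with True show ?thesis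
    using exp_growth_forward[of g K c t g'] assms by simp
next
  case False
  have "norm (g (- (- t))) \<le> c * exp (2 * K * (- t))"
  proof (rule exp_growth_forward[where g="\<lambda>s. g (- s)" and g'="\<lambda>s. - g' (- s)"])
    fix s assume s: "0 \<le> s" "s \<le> - t"
    show "((\<lambda>s. g (- s)) has_vector_derivative - g' (- s)) (at s)"
      by (rule has_vector_derivative_reflect) (use der s t in auto)
    show "norm (- g' (- s)) \<le> 2 * K * c * exp (2 * K * s)"
      using bd[of "- s"] s t by simp
  qed (use g0 K False in auto)
  with False show ?thesis by simp
qed

text \<open>Picard iterates contract by a factor 2 in the norm weighted with \<open>exp (- 2 K |t|)\<close>, which
  gives a global solution at once.\<close>

lemma picard_lindelof:
  fixes F :: "real \<Rightarrow> 'b::banach \<Rightarrow> 'b"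
  assumes cont: "continuous_on UNIV (\<lambda>(t, y). F t y)"
    and lip: "\<And>t y z. norm (F t y - F t z) \<le> K * norm (y - z)"
  shows "\<exists>y. y 0 = y0 \<and> (\<forall>t. (y has_vector_derivative F t (y t)) (at t))"
proof -
  \<comment> \<open>\<open>exp_growth\<close> needs a strictly positive constant, while
    \<open>K\<close> is arbitrary.\<close>
  define L where "L = max K 1"
  have L: "0 < L" "norm (F t y - F t z) \<le> L * norm (y - z)" for t y z
    using lip[of t y z] mult_right_mono[of K L "norm (y - z)"] by (auto simp: L_def)
  define Y where "Y = (\<lambda>f::real \<Rightarrow> 'b. SOME g. g 0 = 0 \<and> (\<forall>t. (g has_vector_derivative f t) (at t)))"
  have Y: "Y f 0 = 0" "(Y f has_vector_derivative f t) (at t)" if "continuous_on UNIV f" for f t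
    using someI_ex[OF antiderivative_UNIV[OF that]] by (auto simp: Y_def)
  define y where "y = (\<lambda>n. ((\<lambda>y t. y0 + Y (\<lambda>s. F s (y s)) t) ^^ n) (\<lambda>_. y0))"
  have y_Suc: "y (Suc n) t = y0 + Y (\<lambda>s. F s (y n s)) t" for n t
    by (simp add: y_def)
  have y_0: "y 0 t = y0" for t
    by (simp add: y_def)
  have F_cont: "continuous_on UNIV (\<lambda>s. F s (h s))" if "continuous_on UNIV h" for h
    using continuous_on_compose2[OF cont continuous_on_Pair[OF continuous_on_id that]] by simp
  have deriv_cont: "continuous_on UNIV h" if "\<And>t. (h has_vector_derivative h' t) (at t)" for h :: "real \<Rightarrow> 'b" and h'
    using that by (intro continuous_at_imp_continuous_on ballI has_vector_derivative_continuous)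
  have y_cont: "continuous_on UNIV (y n)" for n
  proof (induction n)
    case (Suc n)
    have D: "((\<lambda>t. y0 + Y (\<lambda>s. F s (y n s)) t) has_vector_derivative 0 + F t (y n t)) (at t)" for t
      by (rule has_vector_derivative_add[OF has_vector_derivative_const Y(2)[OF F_cont[OF Suc.IH]]])
    have eq: "y (Suc n) = (\<lambda>t. y0 + Y (\<lambda>s. F s (y n s)) t)"
      by (rule ext) (rule y_Suc)
    show ?case unfolding eq by (rule deriv_cont[OF D])
  qed (simp add: y_def)
  note YF = Y[OF F_cont[OF y_cont]]
  have conv: "\<exists>h. uniform_limit {-H..H} y h sequentially" if H: "0 \<le> H" for H
  proof -
    have "compact ((\<lambda>t. F t y0) ` {-H..H})"
      using F_cont[of "\<lambda>_. y0"] by (intro compact_continuous_image) (auto intro: continuous_on_subset)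
    from compact_imp_bounded[OF this] obtain M where "\<forall>z\<in>(\<lambda>t. F t y0) ` {-H..H}. norm z \<le> M"
      unfolding bounded_iff by blast
    then have M: "norm (F t y0) \<le> M" if "\<bar>t\<bar> \<le> H" for t
      using that by (auto simp: abs_le_iff)
    have M0: "0 \<le> M" using M[of 0] H norm_ge_zero[of "F 0 y0"] by linarith
    \<comment> \<open>Chosen so that \<open>2 * L * c = M\<close>: a bound by \<open>M\<close> then
      has the form that \<open>exp_growth\<close> requires for the first difference of
      iterates.\<close>
    define c where "c = M / (2 * L)"
    have c: "0 \<le> c" "2 * L * c = M" using M0 L(1) by (auto simp: c_def)
    have step: "norm (y (Suc n) t - y n t) \<le> (c / 2 ^ n) * exp (2 * L * \<bar>t\<bar>)" if "\<bar>t\<bar> \<le> H" for n t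
      using that
    proof (induction n arbitrary: t)
      case 0
      have "norm (Y (\<lambda>s. F s (y 0 s)) t) \<le> c * exp (2 * L * \<bar>t\<bar>)"
      proof (rule exp_growth[OF YF(1) L(1) c(1) 0 YF(2)])
        fix s assume "\<bar>s\<bar> \<le> H"
        then have "norm (F s (y 0 s)) \<le> M * 1" using M by (simp add: y_def)
        also have "\<dots> \<le> M * exp (2 * L * \<bar>s\<bar>)"
          using M0 L(1) by (intro mult_left_mono) auto
        finally show "norm (F s (y 0 s)) \<le> 2 * L * c * exp (2 * L * \<bar>s\<bar>)" unfolding c(2) .
      qed
      moreover have "y (Suc 0) t - y 0 t = Y (\<lambda>s. F s (y 0 s)) t"
        unfolding y_Suc y_0 by (rule add_diff_cancel_left')
      ultimately show ?case by (simp only: power_0 div_by_1)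
    next
      case (Suc n)
      have "norm (Y (\<lambda>s. F s (y (Suc n) s)) t - Y (\<lambda>s. F s (y n s)) t) \<le> (c / 2 ^ Suc n) * exp (2 * L * \<bar>t\<bar>)"
      proof (rule exp_growth[where g="\<lambda>t. Y (\<lambda>s. F s (y (Suc n) s)) t - Y (\<lambda>s. F s (y n s)) t" and H=H
            and g'="\<lambda>s. F s (y (Suc n) s) - F s (y n s)"])
        fix s assume s: "\<bar>s\<bar> \<le> H"
        have "norm (F s (y (Suc n) s) - F s (y n s)) \<le> L * norm (y (Suc n) s - y n s)"
          by (rule L)
        also have "\<dots> \<le> L * ((c / 2 ^ n) * exp (2 * L * \<bar>s\<bar>))"
          using Suc.IH[OF s] L(1) by (intro mult_left_mono) auto
        finally show "norm (F s (y (Suc n) s) - F s (y n s)) \<le> 2 * L * (c / 2 ^ Suc n) * exp (2 * L * \<bar>s\<bar>)"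
          by simp
      qed (use L(1) c(1) Suc.prems in \<open>auto intro!: has_vector_derivative_diff YF(2) simp: YF(1)\<close>)
      then show ?case by (simp add: y_Suc)
    qed
    define C where "C = c * exp (2 * L * H)"
    have "norm (y (Suc n) t - y n t) \<le> C * (1 / 2) ^ n" if "t \<in> {-H..H}" for n t
    proof -
      have "\<bar>t\<bar> \<le> H" using that by auto
      then have "norm (y (Suc n) t - y n t) \<le> (c / 2 ^ n) * exp (2 * L * H)"
        using step[of t n] c(1) L(1)
        by (smt (verit, best) divide_nonneg_nonneg exp_le_cancel_iff mult_left_mono zero_le_power)
      then show ?thesis by (simp add: C_def power_one_over field_simps)
    qed
    moreover have "summable (\<lambda>n. C * (1 / 2) ^ n)"
      by (intro summable_mult summable_geometric) simp
    ultimately have "uniform_limit {-H..H} (\<lambda>n t. \<Sum>i<n. y (Suc i) t - y i t)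
        (\<lambda>t. suminf (\<lambda>i. y (Suc i) t - y i t)) sequentially"
      by (intro Weierstrass_m_test) auto
    then have "uniform_limit {-H..H} (\<lambda>n t. y0 + (\<Sum>i<n. y (Suc i) t - y i t))
        (\<lambda>t. y0 + suminf (\<lambda>i. y (Suc i) t - y i t)) sequentially"
      by (intro uniform_limit_add uniform_limit_const)
    moreover have "y0 + (\<Sum>i<n. y (Suc i) t - y i t) = y n t" for n t
      by (subst sum_lessThan_telescope) (simp add: y_def)
    ultimately show ?thesis by auto
  qed
  \<comment> \<open>The pointwise limit does not refer to \<open>H\<close>, so the uniform limits on
    all intervals \<open>{-H..H}\<close> are restrictions of one function.\<close>
  define h where "h = (\<lambda>t. lim (\<lambda>n. y n t))"
  have unif: "uniform_limit {-H..H} y h sequentially" if H: "0 \<le> H" for H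
  proof -
    obtain h' where h': "uniform_limit {-H..H} y h' sequentially"
      using conv[OF H] by blast
    have "h t = h' t" if "t \<in> {-H..H}" for t
      unfolding h_def using tendsto_uniform_limitI[OF h' that] by (rule limI)
    then show ?thesis using h' uniform_limit_cong'[of "{-H..H}" y y h h'] by auto
  qed
  have h_cont: "continuous_on UNIV h"
  proof -
    have "continuous (at t) h" for t
    proof -
      have "continuous_on {-(\<bar>t\<bar>+1)..\<bar>t\<bar>+1} h"
        by (rule uniform_limit_theorem[OF _ unif])
          (auto intro!: always_eventually continuous_on_subset[OF y_cont])
      moreover have "t \<in> interior {-(\<bar>t\<bar>+1)..\<bar>t\<bar>+1}" by auto
      ultimately show ?thesis by (rule continuous_on_interior)
    qed
    then show ?thesis by (simp add: continuous_at_imp_continuous_on)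
  qed
  note YH = Y[OF F_cont[OF h_cont]]
  have fixpoint: "h t = y0 + Y (\<lambda>s. F s (h s)) t" for t
  proof -
    have ht: "(\<lambda>n. y n t) \<longlonglongrightarrow> h t"
      by (rule tendsto_uniform_limitI[OF unif[of "\<bar>t\<bar>"]]) auto
    have "(\<lambda>n. y (Suc n) t) \<longlonglongrightarrow> y0 + Y (\<lambda>s. F s (h s)) t"
    proof (rule LIMSEQ_I)
      fix e :: real assume e: "0 < e"
      \<comment> \<open>The factor 4 gives \<open>e' * exp (2 * L * \<bar>t\<bar>) = e / 4\<close>,
        strictly below \<open>e\<close>.\<close>
      define e' where "e' = e / (4 * exp (2 * L * \<bar>t\<bar>))"
      have e': "0 < e'" using e by (simp add: e'_def)
      obtain N where N': "\<forall>n\<ge>N. \<forall>s\<in>{-\<bar>t\<bar>..\<bar>t\<bar>}. dist (y n s) (h s) < e'"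
        using uniform_limitD[OF unif[of "\<bar>t\<bar>"] e'] unfolding eventually_sequentially by auto
      have N: "dist (y n s) (h s) < e'" if "N \<le> n" "\<bar>s\<bar> \<le> \<bar>t\<bar>" for n s
        using N' that by (simp add: abs_le_iff)
      have "norm (y (Suc n) t - (y0 + Y (\<lambda>s. F s (h s)) t)) < e" if n: "N \<le> n" for n
      proof -
        have "norm (Y (\<lambda>s. F s (y n s)) t - Y (\<lambda>s. F s (h s)) t) \<le> e' * exp (2 * L * \<bar>t\<bar>)"
        proof (rule exp_growth[where g="\<lambda>t. Y (\<lambda>s. F s (y n s)) t - Y (\<lambda>s. F s (h s)) t"
              and g'="\<lambda>s. F s (y n s) - F s (h s)" and H="\<bar>t\<bar>"])
          fix s assume s: "\<bar>s\<bar> \<le> \<bar>t\<bar>"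
          have "norm (F s (y n s) - F s (h s)) \<le> L * norm (y n s - h s)"
            by (rule L)
          also have "\<dots> \<le> L * (2 * e' * exp (2 * L * \<bar>s\<bar>))"
          proof (rule mult_left_mono)
            have "norm (y n s - h s) \<le> e'" using N[OF n s] by (simp add: dist_norm)
            also have "e' \<le> e' * (2 * exp (2 * L * \<bar>s\<bar>))"
              using e' L(1) by (smt (verit) abs_ge_zero mult_left_le mult_nonneg_nonneg one_le_exp_iff mult_le_cancel_left2)
            finally show "norm (y n s - h s) \<le> 2 * e' * exp (2 * L * \<bar>s\<bar>)" by (simp add: ac_simps)
          qed (use L(1) in simp)
          finally show "norm (F s (y n s) - F s (h s)) \<le> 2 * L * e' * exp (2 * L * \<bar>s\<bar>)"
            by (simp add: ac_simps)
        qed (use L(1) e' in \<open>auto intro!: has_vector_derivative_diff YF(2) YH(2) simp: YF(1) YH(1)\<close>)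
        also have "\<dots> < e" using e by (simp add: e'_def)
        finally show ?thesis by (simp add: y_Suc)
      qed
      then show "\<exists>no. \<forall>n\<ge>no. norm (y (Suc n) t - (y0 + Y (\<lambda>s. F s (h s)) t)) < e" by blast
    qed
    with LIMSEQ_Suc[OF ht] show ?thesis by (rule LIMSEQ_unique)
  qed
  have "(h has_vector_derivative F t (h t)) (at t)" for t
  proof -
    have "((\<lambda>t. y0 + Y (\<lambda>s. F s (h s)) t) has_vector_derivative 0 + F t (h t)) (at t)"
      by (rule has_vector_derivative_add[OF has_vector_derivative_const YH(2)])
    moreover have "(\<lambda>t. y0 + Y (\<lambda>s. F s (h s)) t) = h"
      by (rule ext) (rule fixpoint[symmetric])
    ultimately show ?thesis by (simp only: add_0_left)
  qed
  moreover have "h 0 = y0" using fixpoint[of 0] unfolding YH(1) by (simp only: add_0_right)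
  ultimately show ?thesis by blast
qed

section \<open>Differentiable dependence on parameters\<close>

lemma C_kt_time:
  assumes "continuous_on UNIV h"
  shows "C_kt k (\<lambda>t x. h t)"
proof -
  have cont: "continuous_on UNIV (\<lambda>(t, x). h t)"
    unfolding split_beta by (rule continuous_on_compose2[OF assms continuous_on_fst[OF continuous_on_id]]) simp
  show ?thesis
  proof (cases k)
    case (Suc j)
    show ?thesis
      unfolding Suc by (rule C_kt_SucI[where f'="\<lambda>_ _ _. 0", OF cont]) (simp_all add: C_kt_const)
  qed (use cont in simp)
qed

text \<open>The tube lemma: compactness of \<open>{-H..H}\<close> turns joint continuity into
  closeness uniform in time.\<close>

lemma eventually_uniformly_close:
  fixes g :: "real \<Rightarrow> 'a::euclidean_space \<Rightarrow> 'b::real_normed_vector"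
  assumes "continuous_on UNIV (\<lambda>(t, x). g t x)" "0 < e"
  shows "\<forall>\<^sub>F y in nhds x. \<forall>t. \<bar>t\<bar> \<le> H \<longrightarrow> norm (g t y - g t x) \<le> e"
proof -
  have "continuous_on UNIV (\<lambda>(y, t). g t y)"
    using continuous_on_compose2[OF assms(1) continuous_on_swap[of UNIV]]
    by (simp add: split_beta prod.swap_def)
  then have c: "continuous_on (UNIV \<times> {-H..H}) (\<lambda>(y, t). g t y)"
    by (rule continuous_on_subset) simp
  obtain X where X: "x \<in> X" "open X"
    "\<forall>y\<in>X \<inter> UNIV. \<forall>t\<in>{-H..H}. dist ((\<lambda>(y, t). g t y) (y, t)) ((\<lambda>(y, t). g t y) (x, t)) \<le> e"
    using continuous_on_prod_compactE[OF c compact_Icc UNIV_I assms(2)] by blast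
  show ?thesis
    unfolding eventually_nhds
    by (intro exI[of _ X] conjI ballI X) (use X(3) in \<open>auto simp: dist_norm abs_le_iff\<close>)
qed

text \<open>The converse of the tube argument, in the form in which solutions supply it: they are
  continuous in time as differentiable curves, and Gronwall's inequality bounds their differences
  uniformly in time.\<close>

lemma continuous_on_kt_I:
  fixes w :: "real \<Rightarrow> 'a::metric_space \<Rightarrow> 'b::real_normed_vector"
  assumes "\<And>x. continuous_on UNIV (\<lambda>t. w t x)"
    and "\<And>x H e. 0 < e \<Longrightarrow> \<forall>\<^sub>F y in nhds x. \<forall>t. \<bar>t\<bar> \<le> H \<longrightarrow> norm (w t y - w t x) \<le> e"
  shows "continuous_on UNIV (\<lambda>(t, x). w t x)"
proof -
  have "((\<lambda>p. w (fst p) (snd p)) \<longlongrightarrow> w t x) (at (t, x))" for t x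
  proof (rule Lim_transform)
    have "isCont (\<lambda>s. w s x) (fst (t, x))"
      using assms(1)[of x] by (simp add: continuous_on_eq_continuous_at)
    then show "((\<lambda>p. w (fst p) x) \<longlongrightarrow> w t x) (at (t, x))"
      using isCont_tendsto_compose[OF _ tendsto_fst[OF tendsto_ident_at]] by fastforce
    show "((\<lambda>p. w (fst p) (snd p) - w (fst p) x) \<longlongrightarrow> 0) (at (t, x))"
    proof (rule tendstoI)
      fix e :: real assume e: "0 < e"
      have 1: "\<forall>\<^sub>F p in at (t, x). dist (fst p) t < 1"
        using tendstoD[OF tendsto_fst[OF tendsto_ident_at], of 1 "(t, x)" UNIV] by simp
      have "\<forall>\<^sub>F y in nhds x. \<forall>s. \<bar>s\<bar> \<le> \<bar>t\<bar> + 1 \<longrightarrow> norm (w s y - w s x) \<le> e / 2"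
        by (rule assms(2)) (use e in simp)
      moreover have "filterlim snd (nhds x) (at (t, x))"
        using tendsto_snd[OF tendsto_ident_at, of "(t, x)" UNIV] by simp
      ultimately have 2: "\<forall>\<^sub>F p in at (t, x). \<forall>s. \<bar>s\<bar> \<le> \<bar>t\<bar> + 1 \<longrightarrow> norm (w s (snd p) - w s x) \<le> e / 2"
        by (rule eventually_compose_filterlim)
      from 1 2 show "\<forall>\<^sub>F p in at (t, x). dist (w (fst p) (snd p) - w (fst p) x) 0 < e"
      proof eventually_elim
        case (elim p)
        then have "norm (w (fst p) (snd p) - w (fst p) x) \<le> e / 2" by (auto simp: dist_real_def)
        with e show ?case by simp
      qed
    qed
  qed
  then show ?thesis
    by (simp add: continuous_on_eq_continuous_at isCont_def split_beta)
qed

text \<open>The mean value inequality applied to \<open>f t\<close> minus its linearisation at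
  \<open>x\<close>. The derivative of this difference is small near \<open>x\<close>, uniformly for
  \<open>\<bar>t\<bar> \<le> H\<close>, by the tube lemma in each basis direction.\<close>

lemma uniform_taylor:
  fixes f :: "real \<Rightarrow> 'a::euclidean_space \<Rightarrow> 'b::real_normed_vector"
  assumes f: "C_kt (Suc k) f" and e: "0 < e"
  shows "\<exists>d>0. \<forall>v t. norm v < d \<longrightarrow> \<bar>t\<bar> \<le> H \<longrightarrow>
    norm (f t (x + v) - f t x - frechet_derivative (f t) (at x) v) \<le> e * norm v"
proof -
  define f' where "f' = (\<lambda>t y. frechet_derivative (f t) (at y))"
  have f': "(f t has_derivative f' t y) (at y)" for t y
    unfolding f'_def by (rule C_kt_has_derivative[OF f])
  \<comment> \<open>The operator norm is estimated by the sum over the basis vectors, so each of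
    them may contribute only this share.\<close>
  define e' where "e' = e / real DIM('a)"
  have e': "0 < e'" using e by (simp add: e'_def)
  have "continuous_on UNIV (\<lambda>(t, y). f' t y b)" for b
    unfolding f'_def using C_kt_continuous[OF C_kt_frechet[OF f]] .
  then have "\<forall>b\<in>Basis. \<forall>\<^sub>F y in nhds x. \<forall>t. \<bar>t\<bar> \<le> H \<longrightarrow> norm (f' t y b - f' t x b) \<le> e'"
    using e' eventually_uniformly_close by blast
  from eventually_ball_finite[OF finite_Basis this]
  obtain d where d: "0 < d" and
    db: "\<And>y b t. dist y x < d \<Longrightarrow> b \<in> Basis \<Longrightarrow> \<bar>t\<bar> \<le> H \<Longrightarrow> norm (f' t y b - f' t x b) \<le> e'"
    unfolding eventually_nhds_metric by blast
  have "norm (f t (x + v) - f t x - f' t x v) \<le> e * norm v" if v: "norm v < d" and t: "\<bar>t\<bar> \<le> H" for v t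
  proof -
    define g where "g = (\<lambda>y. f t y - f' t x y)"
    have lin: "linear (f' t y)" for y using f' has_derivative_linear by blast
    have "norm (g (x + v) - g x) \<le> e * norm ((x + v) - x)"
    proof (rule differentiable_bound[where S="ball x d" and f'="\<lambda>y h. f' t y h - f' t x h"])
      fix y assume y: "y \<in> ball x d"
      show "(g has_derivative (\<lambda>h. f' t y h - f' t x h)) (at y within ball x d)"
        unfolding g_def
        by (intro has_derivative_diff has_derivative_at_withinI[OF f'] bounded_linear_imp_has_derivative
            has_derivative_bounded_linear[OF f'])
      show "onorm (\<lambda>h. f' t y h - f' t x h) \<le> e"
      proof (rule onorm_le)
        fix h :: 'a
        have "f' t y h - f' t x h = (\<Sum>b\<in>Basis. (h \<bullet> b) *\<^sub>R (f' t y b - f' t x b))"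
          unfolding linear_expand_Basis[OF lin, of y h] linear_expand_Basis[OF lin, of x h]
          by (simp add: sum_subtractf scaleR_diff_right)
        also have "norm \<dots> \<le> (\<Sum>b\<in>(Basis::'a set). norm h * e')"
        proof (rule sum_norm_le)
          fix b :: 'a assume b: "b \<in> Basis"
          show "norm ((h \<bullet> b) *\<^sub>R (f' t y b - f' t x b)) \<le> norm h * e'"
            unfolding norm_scaleR
            using db[OF _ b t, of y] y Basis_le_norm[OF b, of h]
            by (intro mult_mono) (auto simp: dist_commute)
        qed
        also have "\<dots> = e * norm h" by (simp add: e'_def)
        finally show "norm (f' t y h - f' t x h) \<le> e * norm h" .
      qed
    qed (use d v in \<open>auto simp: dist_norm\<close>)
    then show ?thesis by (simp add: g_def linear_add[OF lin] algebra_simps)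
  qed
  with d show ?thesis unfolding f'_def by blast
qed

text \<open>Taylor's estimate with tolerance 1 plus a bound on the derivative at \<open>x\<close>,
  whose values on basis vectors are bounded on the compact time interval.\<close>

lemma uniform_lipschitz:
  fixes f :: "real \<Rightarrow> 'a::euclidean_space \<Rightarrow> 'b::real_normed_vector"
  assumes f: "C_kt (Suc k) f"
  shows "\<exists>M d. 0 \<le> M \<and> 0 < d \<and> (\<forall>v t. norm v < d \<longrightarrow> \<bar>t\<bar> \<le> H \<longrightarrow> norm (f t (x + v) - f t x) \<le> M * norm v)"
proof -
  define f' where "f' = (\<lambda>t. frechet_derivative (f t) (at x))"
  have lin: "linear (f' t)" for t
    unfolding f'_def using C_kt_has_derivative[OF f] has_derivative_linear by blast
  have "\<exists>m\<ge>0. \<forall>t. \<bar>t\<bar> \<le> H \<longrightarrow> norm (f' t b) \<le> m" for b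
  proof -
    have "continuous_on UNIV (\<lambda>t. f' t b)"
      unfolding f'_def by (rule continuous_on_slice(2)[OF C_kt_continuous[OF C_kt_frechet[OF f]]])
    then have "compact ((\<lambda>t. f' t b) ` {-H..H})"
      by (intro compact_continuous_image) (auto intro: continuous_on_subset)
    from compact_imp_bounded[OF this] obtain m where "\<forall>z\<in>(\<lambda>t. f' t b) ` {-H..H}. norm z \<le> m"
      unfolding bounded_iff by blast
    then show ?thesis by (intro exI[of _ "max m 0"]) (auto simp: abs_le_iff le_max_iff_disj)
  qed
  then obtain m where m: "\<And>b. 0 \<le> m b" "\<And>b t. \<bar>t\<bar> \<le> H \<Longrightarrow> norm (f' t b) \<le> m b"
    by metis
  define M where "M = (\<Sum>b\<in>Basis. m b) + 1"
  obtain d where d: "0 < d" "\<And>v t. norm v < d \<Longrightarrow> \<bar>t\<bar> \<le> H \<Longrightarrow> norm (f t (x + v) - f t x - f' t v) \<le> 1 * norm v"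
    using uniform_taylor[OF f, of 1 H x] unfolding f'_def by auto
  have "norm (f t (x + v) - f t x) \<le> M * norm v" if v: "norm v < d" and t: "\<bar>t\<bar> \<le> H" for v t
  proof -
    have "norm (f' t v) \<le> (\<Sum>b\<in>Basis. norm v * m b)"
      unfolding linear_expand_Basis[OF lin, of t v]
    proof (rule sum_norm_le)
      fix b :: 'a assume b: "b \<in> Basis"
      show "norm ((v \<bullet> b) *\<^sub>R f' t b) \<le> norm v * m b"
        unfolding norm_scaleR using m(2)[OF t, of b] Basis_le_norm[OF b, of v] by (intro mult_mono) auto
    qed
    also have "\<dots> = (\<Sum>b\<in>Basis. m b) * norm v" by (simp add: sum_distrib_left[symmetric])
    finally have "norm (f' t v) + 1 * norm v \<le> M * norm v" by (simp add: M_def algebra_simps)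
    then show ?thesis
      using d(2)[OF v t] norm_triangle_ineq[of "f t (x + v) - f t x - f' t v" "f' t v"] by simp
  qed
  moreover have "0 \<le> M" unfolding M_def using m(1) by (intro add_nonneg_nonneg sum_nonneg) auto
  ultimately show ?thesis using d(1) by blast
qed

text \<open>The derivative in the parameter is constructed as the solution of the linearised equation;
  Gronwall's inequality then bounds the remainder.\<close>

lemma parametric_derivative:
  fixes w :: "real \<Rightarrow> 'a::euclidean_space \<Rightarrow> 'b::euclidean_space"
  assumes L_lin: "\<And>t. linear (L t)" and L_cont: "continuous_on UNIV (\<lambda>(t, y). L t y)"
    and L_bd: "\<And>t y. norm (L t y) \<le> K * norm y" and K: "0 \<le> K"
    and c_lin: "\<And>t. linear (c t)" and c_cont: "\<And>v. continuous_on UNIV (\<lambda>t. c t v)"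
    and z_lin: "linear z0"
    and ode: "\<And>t y. ((\<lambda>s. w s y) has_vector_derivative w' t y) (at t)"
    and approx: "\<And>H e. 0 < e \<Longrightarrow> \<exists>d>0. \<forall>v t. norm v < d \<longrightarrow> \<bar>t\<bar> \<le> H \<longrightarrow>
        norm (w' t (x + v) - w' t x - L t (w t (x + v) - w t x) - c t v) \<le> e * norm v"
    and init: "\<And>v. w 0 (x + v) - w 0 x = z0 v"
  shows "\<exists>D. (\<forall>v. D 0 v = z0 v) \<and>
    (\<forall>t v. ((\<lambda>s. D s v) has_vector_derivative L t (D t v) + c t v) (at t)) \<and>
    (\<forall>t. (w t has_derivative D t) (at x))"
proof -
  have "\<exists>z. z 0 = z0 v \<and> (\<forall>t. (z has_vector_derivative L t (z t) + c t v) (at t))" for v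
  proof (rule picard_lindelof[where F="\<lambda>t y. L t y + c t v" and K=K])
    show "continuous_on UNIV (\<lambda>(t, y). L t y + c t v)"
      using continuous_on_add[OF L_cont C_kt_continuous[OF C_kt_time[OF c_cont[of v], of 0]]]
      by (simp add: split_beta)
    show "norm (L t y + c t v - (L t z + c t v)) \<le> K * norm (y - z)" for t y z
      using L_bd[of t "y - z"] by (simp add: linear_diff[OF L_lin])
  qed
  then obtain D where D0: "\<And>v. D v 0 = z0 v"
    and D: "\<And>v t. (D v has_vector_derivative L t (D v t) + c t v) (at t)"
    by metis
  \<comment> \<open>Linearity is an instance of uniqueness: the defects of additivity and
    homogeneity solve the homogeneous equation and start at 0.\<close>
  have "linear (\<lambda>v. D v t)" for t
  proof (rule linearI)
    fix u v :: 'a and r :: real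
    have "D (u + v) t - D u t - D v t = 0"
    proof (rule linear_ode_zero[where r="\<lambda>t. D (u + v) t - D u t - D v t"
          and r'="\<lambda>t. L t (D (u + v) t - D u t - D v t)", OF _ L_bd K])
      fix s
      show "((\<lambda>t. D (u + v) t - D u t - D v t) has_vector_derivative L s (D (u + v) s - D u s - D v s)) (at s)"
        using has_vector_derivative_diff[OF has_vector_derivative_diff[OF D[of "u + v" s] D[of u s]] D[of v s]]
        by (simp add: linear_diff[OF L_lin] linear_add[OF L_lin] linear_add[OF c_lin] algebra_simps)
    qed (simp add: D0 linear_add[OF z_lin])
    then show "D (u + v) t = D u t + D v t" by (simp add: algebra_simps)
    have "D (r *\<^sub>R v) t - r *\<^sub>R D v t = 0"
    proof (rule linear_ode_zero[where r="\<lambda>t. D (r *\<^sub>R v) t - r *\<^sub>R D v t"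
          and r'="\<lambda>t. L t (D (r *\<^sub>R v) t - r *\<^sub>R D v t)", OF _ L_bd K])
      fix s
      show "((\<lambda>t. D (r *\<^sub>R v) t - r *\<^sub>R D v t) has_vector_derivative L s (D (r *\<^sub>R v) s - r *\<^sub>R D v s)) (at s)"
        using has_vector_derivative_diff[OF D[of "r *\<^sub>R v" s]
            bounded_linear.has_vector_derivative[OF bounded_linear_scaleR_right D[of v s], of r]]
        by (simp add: linear_diff[OF L_lin] linear_cmul[OF c_lin] linear_cmul[OF L_lin] scaleR_add_right algebra_simps)
    qed (simp add: D0 linear_cmul[OF z_lin])
    then show "D (r *\<^sub>R v) t = r *\<^sub>R D v t" by simp
  qed
  then have D_bl: "bounded_linear (\<lambda>v. D v t)" for t
    by (simp add: linear_conv_bounded_linear)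
  have "(w t has_derivative (\<lambda>v. D v t)) (at x)" for t
    unfolding has_derivative_at_alt
  proof (intro conjI D_bl allI impI)
    fix e :: real assume e: "0 < e"
    \<comment> \<open>Gronwall's constant for times up to \<open>\<bar>t\<bar>\<close>; requesting
      the remainder \<open>e / C\<close> makes it cancel.\<close>
    define C where "C = exp ((2 * K + 1) * \<bar>t\<bar>) * (1 + \<bar>t\<bar>)"
    have C: "0 < C" unfolding C_def by (intro mult_pos_pos) auto
    obtain d where d: "0 < d" and bd: "\<And>v s. norm v < d \<Longrightarrow> \<bar>s\<bar> \<le> \<bar>t\<bar> \<Longrightarrow>
        norm (w' s (x + v) - w' s x - L s (w s (x + v) - w s x) - c s v) \<le> e / C * norm v"
      using approx[of "e / C" "\<bar>t\<bar>"] e C by auto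
    have "norm (w t y - w t x - D (y - x) t) \<le> e * norm (y - x)" if y: "norm (y - x) < d" for y
    proof -
      define v where "v = y - x"
      have yv: "y = x + v" by (simp add: v_def)
      define r where "r = (\<lambda>s. w s (x + v) - w s x - D v s)"
      define r' where "r' = (\<lambda>s. w' s (x + v) - w' s x - (L s (D v s) + c s v))"
      have "norm (r t) \<le> exp ((2 * K + 1) * \<bar>t\<bar>) * (1 + \<bar>t\<bar>) * (norm (r 0) + e / C * norm v)"
      proof (rule gronwall[where r'=r' and K=K])
        fix s assume s: "\<bar>s\<bar> \<le> \<bar>t\<bar>"
        show "(r has_vector_derivative r' s) (at s)"
          unfolding r_def r'_def by (intro has_vector_derivative_diff ode D)
        have "r' s = (w' s (x + v) - w' s x - L s (w s (x + v) - w s x) - c s v) + L s (r s)"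
          by (simp add: r'_def r_def linear_diff[OF L_lin] linear_add[OF L_lin] algebra_simps)
        then have "norm (r' s) \<le> e / C * norm v + K * norm (r s)"
          using norm_triangle_mono[OF bd[OF _ s, of v] L_bd[of s "r s"]] y by (simp add: v_def)
        then show "norm (r' s) \<le> K * norm (r s) + e / C * norm v" by simp
      qed (use K e C in auto)
      also have "r 0 = 0" by (simp add: r_def D0 init)
      finally have "norm (r t) \<le> C * (e / C * norm v)" by (simp add: C_def)
      then show ?thesis using C by (simp add: r_def yv)
    qed
    with d show "\<exists>d>0. \<forall>y. norm (y - x) < d \<longrightarrow> norm (w t y - w t x - D (y - x) t) \<le> e * norm (y - x)"
      by blast
  qed
  with D0 D show ?thesis by (intro exI[of _ "\<lambda>t v. D v t"]) auto
qed

lemma bounded_bilinear_linear_right: "bounded_bilinear P \<Longrightarrow> linear (P a)"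
  by (simp add: bounded_bilinear.bounded_linear_right linear_conv_bounded_linear bounded_linear.linear)

text \<open>The difference of the solutions at \<open>y\<close> and \<open>x\<close> solves the same
  linear equation with a small forcing and starts at 0, because the initial value does not depend on
  \<open>x\<close>.\<close>

lemma linear_ode_continuous:
  fixes w :: "real \<Rightarrow> 'a::euclidean_space \<Rightarrow> 'b::euclidean_space"
  assumes P: "bounded_bilinear P" and K: "\<And>t x y. norm (P (a t x) y) \<le> K * norm y" "0 \<le> K"
    and a: "continuous_on UNIV (\<lambda>(t, x). a t x)" and b: "continuous_on UNIV (\<lambda>(t, x). b t x)"
    and ode: "\<And>t x. ((\<lambda>s. w s x) has_vector_derivative P (a t x) (w t x) + b t x) (at t)"
    and init: "\<And>x. w 0 x = w0"
  shows "continuous_on UNIV (\<lambda>(t, x). w t x)"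
proof (rule continuous_on_kt_I)
  show w_cont: "continuous_on UNIV (\<lambda>t. w t x)" for x
    by (intro continuous_at_imp_continuous_on ballI has_vector_derivative_continuous[OF ode])
  fix x and H e :: real assume e: "0 < e"
  show "\<forall>\<^sub>F y in nhds x. \<forall>t. \<bar>t\<bar> \<le> H \<longrightarrow> norm (w t y - w t x) \<le> e"
  proof (cases "0 \<le> H")
    case True
    define C where "C = exp ((2 * K + 1) * H) * (1 + H)"
    have C: "0 < C" unfolding C_def using True by (intro mult_pos_pos) auto
    \<comment> \<open>The solution is frozen at \<open>x\<close>, so that \<open>f\<close> is known
      to be jointly continuous before anything is known about \<open>w\<close> as a function of the
      parameter.\<close>
    define f where "f = (\<lambda>t y. P (a t y) (w t x) + b t y)"
    have "continuous_on UNIV (\<lambda>(t, y). f t y)"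
      unfolding f_def split_beta
      by (intro continuous_on_add bounded_bilinear.continuous_on[OF P] a[unfolded split_beta] b[unfolded split_beta]
          continuous_on_compose2[OF w_cont continuous_on_fst[OF continuous_on_id]]) simp
    then have "\<forall>\<^sub>F y in nhds x. \<forall>t. \<bar>t\<bar> \<le> H \<longrightarrow> norm (f t y - f t x) \<le> e / C"
      by (rule eventually_uniformly_close) (use e C in simp)
    then show ?thesis
    proof (rule eventually_mono, intro allI impI)
      fix y t assume f: "\<forall>t. \<bar>t\<bar> \<le> H \<longrightarrow> norm (f t y - f t x) \<le> e / C" and t: "\<bar>t\<bar> \<le> H"
      have "norm (w t y - w t x) \<le> exp ((2 * K + 1) * H) * (1 + H) * (norm (w 0 y - w 0 x) + e / C)"
      proof (rule gronwall[where r="\<lambda>t. w t y - w t x"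
            and r'="\<lambda>t. (P (a t y) (w t y) + b t y) - (P (a t x) (w t x) + b t x)"])
        fix s assume s: "\<bar>s\<bar> \<le> H"
        show "((\<lambda>t. w t y - w t x) has_vector_derivative
            (P (a s y) (w s y) + b s y) - (P (a s x) (w s x) + b s x)) (at s)"
          by (intro has_vector_derivative_diff ode)
        have "(P (a s y) (w s y) + b s y) - (P (a s x) (w s x) + b s x)
            = P (a s y) (w s y - w s x) + (f s y - f s x)"
          by (simp add: f_def bounded_bilinear.diff_right[OF P])
        then show "norm ((P (a s y) (w s y) + b s y) - (P (a s x) (w s x) + b s x)) \<le>
            K * norm (w s y - w s x) + e / C"
          using norm_triangle_mono[OF K(1)[of s y "w s y - w s x"] f[rule_format, OF s]] by simp
      qed (use K e C t in auto)
      then show "norm (w t y - w t x) \<le> e"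
        using C unfolding C_def[symmetric] by (simp add: init)
    qed
  qed auto
qed

text \<open>The equation for \<open>w'\<close> is the formal \<open>x\<close>-derivative of the
  equation for \<open>w\<close>. It has the same linear part, so regularity can be
  bootstrapped.\<close>

lemma linear_ode_derivative:
  fixes w :: "real \<Rightarrow> 'a::euclidean_space \<Rightarrow> 'b::euclidean_space"
  assumes P: "bounded_bilinear P" and K: "\<And>t x y. norm (P (a t x) y) \<le> K * norm y" "0 \<le> K"
    and a: "C_kt (Suc k) a" and b: "C_kt (Suc k) b"
    and ode: "\<And>t x. ((\<lambda>s. w s x) has_vector_derivative P (a t x) (w t x) + b t x) (at t)"
    and init: "\<And>x. w 0 x = w0"
  defines "a' \<equiv> \<lambda>t x. frechet_derivative (a t) (at x)"
    and "b' \<equiv> \<lambda>t x. frechet_derivative (b t) (at x)"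
    and "w' \<equiv> \<lambda>t x. frechet_derivative (w t) (at x)"
  shows "(w t has_derivative w' t x) (at x)"
    and "((\<lambda>s. w' s x v) has_vector_derivative P (a t x) (w' t x v) + (P (a' t x v) (w t x) + b' t x v)) (at t)"
    and "w' 0 x v = 0"
proof -
  have w_cont: "continuous_on UNIV (\<lambda>(t, x). w t x)"
    by (rule linear_ode_continuous[OF P K C_kt_continuous[OF a] C_kt_continuous[OF b] ode init])
  have a': "(a t has_derivative a' t x) (at x)" and b': "(b t has_derivative b' t x) (at x)" for t x
    unfolding a'_def b'_def by (rule C_kt_has_derivative[OF a] C_kt_has_derivative[OF b])+
  have a'_cont: "continuous_on UNIV (\<lambda>t. a' t x v)" and b'_cont: "continuous_on UNIV (\<lambda>t. b' t x v)" for x v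
    unfolding a'_def b'_def
    by (rule continuous_on_slice(2)[OF C_kt_continuous[OF C_kt_frechet[OF a]]]
        continuous_on_slice(2)[OF C_kt_continuous[OF C_kt_frechet[OF b]]])+
  have wx_cont: "continuous_on UNIV (\<lambda>t. w t x)" for x
    by (rule continuous_on_slice(2)[OF w_cont])
  have "\<exists>D. (\<forall>v. D 0 v = (\<lambda>v. 0) v) \<and>
    (\<forall>t v. ((\<lambda>s. D s v) has_vector_derivative P (a t x) (D t v) + (P (a' t x v) (w t x) + b' t x v)) (at t)) \<and>
    (\<forall>t. (w t has_derivative D t) (at x))" for x
  proof (rule parametric_derivative[where L="\<lambda>t. P (a t x)" and K=K
        and c="\<lambda>t v. P (a' t x v) (w t x) + b' t x v" and w'="\<lambda>t y. P (a t y) (w t y) + b t y"])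
    show "linear (P (a t x))" for t by (rule bounded_bilinear_linear_right[OF P])
    show "continuous_on UNIV (\<lambda>(t, y). P (a t x) y)"
      unfolding split_beta
      by (intro bounded_bilinear.continuous_on[OF P] continuous_on_snd continuous_on_id
          continuous_on_compose2[OF continuous_on_slice(2)[OF C_kt_continuous[OF a]] continuous_on_fst]) simp
    show "linear (\<lambda>v. P (a' t x v) (w t x) + b' t x v)" for t
      using has_derivative_linear[OF a'] has_derivative_linear[OF b']
      by (intro linearI) (simp_all add: linear_add linear_cmul bounded_bilinear.add_left[OF P]
          bounded_bilinear.scaleR_left[OF P] scaleR_add_right)
    show "continuous_on UNIV (\<lambda>t. P (a' t x v) (w t x) + b' t x v)" for v
      by (intro continuous_on_add bounded_bilinear.continuous_on[OF P] a'_cont b'_cont wx_cont)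
    show "linear (\<lambda>v::'a. 0::'b)" by (rule module_hom_zero)
    show "w 0 (x + v) - w 0 x = 0" for v by (simp add: init)
    fix H e :: real assume e: "0 < e"
    \<comment> \<open>With \<open>w\<close> frozen at \<open>x\<close>, the right-hand side is
      smooth enough for Taylor's estimate. What remains is \<open>P\<close> applied to the
      increments of \<open>a\<close> and \<open>w\<close>, which is of higher order: the first is
      Lipschitz in \<open>v\<close>, the second merely tends to 0.\<close>
    define f where "f = (\<lambda>t y. P (a t y) (w t x) + b t y)"
    have f: "C_kt (Suc k) f"
      unfolding f_def by (rule C_kt_add[OF C_kt_bilinear[OF P a C_kt_time[OF wx_cont]] b])
    have fD: "(f t has_derivative (\<lambda>v. P (a t x) 0 + P (a' t x v) (w t x) + b' t x v)) (at x)" for t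
      unfolding f_def
      by (intro has_derivative_add bounded_bilinear.FDERIV[OF P] a' b' has_derivative_const)
    have f': "frechet_derivative (f t) (at x) v = P (a' t x v) (w t x) + b' t x v" for t v
      using frechet_derivative_at[OF fD[of t], symmetric] by (simp add: bounded_bilinear.zero_right[OF P])
    obtain d1 where d1: "0 < d1" "\<And>v t. norm v < d1 \<Longrightarrow> \<bar>t\<bar> \<le> H \<Longrightarrow>
        norm (f t (x + v) - f t x - (P (a' t x v) (w t x) + b' t x v)) \<le> e / 2 * norm v"
      using uniform_taylor[OF f, of "e / 2" H x] e unfolding f' by auto
    obtain M d2 where M: "0 \<le> M" and d2: "0 < d2"
      "\<And>v t. norm v < d2 \<Longrightarrow> \<bar>t\<bar> \<le> H \<Longrightarrow> norm (a t (x + v) - a t x) \<le> M * norm v"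
      using uniform_lipschitz[OF a, of H x] by blast
    obtain B where B: "0 < B" "\<And>p q. norm (P p q) \<le> norm p * norm q * B"
      using bounded_bilinear.pos_bounded[OF P] by blast
    \<comment> \<open>Balances the constants \<open>B\<close> and \<open>M\<close> so that the
      product of increments costs at most \<open>e / 2 * norm v\<close>; \<open>M + 1\<close> avoids
      a division by zero.\<close>
    define e' where "e' = e / (2 * B * (M + 1))"
    have e': "0 < e'" using e B(1) M by (simp add: e'_def)
    obtain d3 where d3: "0 < d3" "\<And>y t. dist y x < d3 \<Longrightarrow> \<bar>t\<bar> \<le> H \<Longrightarrow> norm (w t y - w t x) \<le> e'"
      using eventually_uniformly_close[OF w_cont e', where x=x and H=H] unfolding eventually_nhds_metric by blast
    let ?err = "\<lambda>t v. P (a t (x + v)) (w t (x + v)) + b t (x + v) - (P (a t x) (w t x) + b t x)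
        - P (a t x) (w t (x + v) - w t x) - (P (a' t x v) (w t x) + b' t x v)"
    have "norm (?err t v) \<le> e * norm v" if v: "norm v < min d1 (min d2 d3)" and t: "\<bar>t\<bar> \<le> H" for v t
    proof -
      have "norm (P (a t (x + v) - a t x) (w t (x + v) - w t x))
          \<le> norm (a t (x + v) - a t x) * norm (w t (x + v) - w t x) * B" by (rule B)
      also have "\<dots> \<le> (M * norm v) * e' * B"
        using d2(2)[of v t] d3(2)[of "x + v" t] v t M B e'
        by (intro mult_right_mono mult_mono) (auto simp: dist_norm)
      also have "\<dots> = (e / 2 * (M / (M + 1))) * norm v" using B(1) by (simp add: e'_def)
      also have "\<dots> \<le> e / 2 * norm v"
      proof (rule mult_right_mono)
        have "e / 2 * (M / (M + 1)) \<le> e / 2 * 1" using e M by (intro mult_left_mono) auto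
        then show "e / 2 * (M / (M + 1)) \<le> e / 2" by simp
      qed simp
      finally have 1: "norm (P (a t (x + v) - a t x) (w t (x + v) - w t x)) \<le> e / 2 * norm v" .
      have eq: "?err t v = P (a t (x + v) - a t x) (w t (x + v) - w t x)
          + (f t (x + v) - f t x - (P (a' t x v) (w t x) + b' t x v))"
        by (simp add: f_def bounded_bilinear.diff_right[OF P] bounded_bilinear.diff_left[OF P])
      show ?thesis
        unfolding eq using norm_triangle_mono[OF 1 d1(2)[of v t]] v t by simp
    qed
    then show "\<exists>d>0. \<forall>v t. norm v < d \<longrightarrow> \<bar>t\<bar> \<le> H \<longrightarrow> norm (?err t v) \<le> e * norm v"
      using d1(1) d2(1) d3(1) by (intro exI[of _ "min d1 (min d2 d3)"]) auto
  qed (use K ode in auto)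
  then obtain D where D: "\<And>x v. D x 0 v = 0"
    "\<And>x t v. ((\<lambda>s. D x s v) has_vector_derivative P (a t x) (D x t v) + (P (a' t x v) (w t x) + b' t x v)) (at t)"
    "\<And>x t. (w t has_derivative D x t) (at x)"
    by metis
  have "w' t x = D x t" for t x
    unfolding w'_def using frechet_derivative_at[OF D(3)] by metis
  then show "(w t has_derivative w' t x) (at x)"
    "((\<lambda>s. w' s x v) has_vector_derivative P (a t x) (w' t x v) + (P (a' t x v) (w t x) + b' t x v)) (at t)"
    "w' 0 x v = 0"
    using D by simp_all
qed

text \<open>The directional derivatives of \<open>w\<close> solve the same equation with another inhomogeneity,
  which is why \<open>b\<close> is generalised in the induction.\<close>

lemma linear_ode_C_kt:
  fixes w :: "real \<Rightarrow> 'a::euclidean_space \<Rightarrow> 'b::euclidean_space"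
  assumes P: "bounded_bilinear P" and K: "\<And>t x y. norm (P (a t x) y) \<le> K * norm y" "0 \<le> K"
  shows "C_kt k a \<Longrightarrow> C_kt k b \<Longrightarrow>
    (\<And>t x. ((\<lambda>s. w s x) has_vector_derivative P (a t x) (w t x) + b t x) (at t)) \<Longrightarrow>
    (\<And>x. w 0 x = w0) \<Longrightarrow> C_kt k w"
proof (induction k arbitrary: b w w0)
  case 0
  from linear_ode_continuous[OF P K _ _ 0(3) 0(4)] 0(1,2) show ?case by simp
next
  case (Suc k)
  have w: "C_kt k w"
    by (rule Suc.IH[OF C_kt_Suc_imp[OF Suc.prems(1)] C_kt_Suc_imp[OF Suc.prems(2)] Suc.prems(3,4)])
  note D = linear_ode_derivative[OF P K Suc.prems]
  have "C_kt k (\<lambda>t x. frechet_derivative (w t) (at x) v)" for v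
    by (rule Suc.IH[OF C_kt_Suc_imp[OF Suc.prems(1)]
          C_kt_add[OF C_kt_bilinear[OF P C_kt_frechet[OF Suc.prems(1)] w] C_kt_frechet[OF Suc.prems(2)]] D(2,3)])
  then show ?case
    by (rule C_kt_SucI[OF C_kt_continuous[OF w] D(1)])
qed

section \<open>Symmetry of second derivatives\<close>

lemma DERIV_along_line:
  fixes f :: "'a::real_normed_vector \<Rightarrow> real"
  assumes "(f has_derivative f') (at (p + r *\<^sub>R u))"
  shows "((\<lambda>r. f (p + r *\<^sub>R u)) has_real_derivative f' u) (at r)"
proof -
  have "((\<lambda>r. p + r *\<^sub>R u) has_derivative (\<lambda>h. h *\<^sub>R u)) (at r)"
    by (auto intro!: derivative_eq_intros)
  from diff_chain_at[OF this assms] have "((\<lambda>r. f (p + r *\<^sub>R u)) has_derivative (\<lambda>h. f' (h *\<^sub>R u))) (at r)"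
    by (simp add: o_def)
  moreover have "f' (h *\<^sub>R u) = f' u * h" for h
    using linear_cmul[OF has_derivative_linear[OF assms]] by simp
  ultimately show ?thesis by (simp add: has_field_derivative_def)
qed

text \<open>The mean value theorem along \<open>u\<close>, applied to a difference in direction
  \<open>v\<close>, and then along \<open>v\<close>. The second difference is symmetric in
  \<open>u\<close> and \<open>v\<close>, which is what makes it useful.\<close>

lemma second_difference_mean_value:
  fixes f :: "'a::euclidean_space \<Rightarrow> real"
  assumes f: "C_k (Suc (Suc k)) f" and s: "0 < s"
  shows "\<exists>r q. 0 < r \<and> r < s \<and> 0 < q \<and> q < s \<and>
    f (x + s *\<^sub>R u + s *\<^sub>R v) - f (x + s *\<^sub>R u) - f (x + s *\<^sub>R v) + f x =
    s * s * frechet_derivative (\<lambda>x. frechet_derivative f (at x) u) (at (x + r *\<^sub>R u + q *\<^sub>R v)) v"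
proof -
  define fu where "fu = (\<lambda>x. frechet_derivative f (at x) u)"
  have f1: "(f has_derivative frechet_derivative f (at y)) (at y)"
    and f2: "(fu has_derivative frechet_derivative fu (at y)) (at y)" for y
    using f by (simp_all add: frechet_derivative_works fu_def)
  define \<phi> where "\<phi> = (\<lambda>r. f ((x + s *\<^sub>R v) + r *\<^sub>R u) - f (x + r *\<^sub>R u))"
  have "(\<phi> has_real_derivative fu ((x + s *\<^sub>R v) + r *\<^sub>R u) - fu (x + r *\<^sub>R u)) (at r)" for r
    unfolding \<phi>_def fu_def by (intro DERIV_diff DERIV_along_line f1)
  then obtain r where r: "0 < r" "r < s"
    "\<phi> s - \<phi> 0 = (s - 0) * (fu ((x + s *\<^sub>R v) + r *\<^sub>R u) - fu (x + r *\<^sub>R u))"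
    using MVT2[OF s, of \<phi> "\<lambda>r. fu ((x + s *\<^sub>R v) + r *\<^sub>R u) - fu (x + r *\<^sub>R u)"] by blast
  obtain q where q: "0 < q" "q < s"
    "fu ((x + r *\<^sub>R u) + s *\<^sub>R v) - fu ((x + r *\<^sub>R u) + 0 *\<^sub>R v)
      = (s - 0) * frechet_derivative fu (at ((x + r *\<^sub>R u) + q *\<^sub>R v)) v"
    using MVT2[OF s, of "\<lambda>q. fu ((x + r *\<^sub>R u) + q *\<^sub>R v)"
        "\<lambda>q. frechet_derivative fu (at ((x + r *\<^sub>R u) + q *\<^sub>R v)) v"] DERIV_along_line[OF f2] by blast
  have "f (x + s *\<^sub>R u + s *\<^sub>R v) - f (x + s *\<^sub>R u) - f (x + s *\<^sub>R v) + f x = \<phi> s - \<phi> 0"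
    by (simp add: \<phi>_def add.commute add.left_commute)
  also have "\<dots> = s * (s * frechet_derivative fu (at (x + r *\<^sub>R u + q *\<^sub>R v)) v)"
    using r(3) q(3) by (simp add: add.commute add.left_commute)
  finally show ?thesis
    using r q unfolding fu_def by (intro exI[of _ r] exI[of _ q]) (simp add: mult.assoc)
qed

text \<open>Evaluating one second difference in both orders equates the mixed derivatives at two
  different points near \<open>x\<close>; their continuity closes the gap.\<close>

lemma symmetric_second_derivative:
  fixes f :: "'a::euclidean_space \<Rightarrow> real"
  assumes f: "C_k (Suc (Suc k)) f"
  shows "frechet_derivative (\<lambda>x. frechet_derivative f (at x) u) (at x) v =
    frechet_derivative (\<lambda>x. frechet_derivative f (at x) v) (at x) u"
proof -
  define D where "D = (\<lambda>u v x. frechet_derivative (\<lambda>x. frechet_derivative f (at x) u) (at x) v)"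
  have "C_k 0 (D u v)" for u v
  proof -
    have "C_k k (D u v)" using f by (simp add: D_def)
    then show ?thesis
      using C_kt_continuous[of k "\<lambda>_. D u v"] continuous_on_slice(1) by (auto simp: C_k_iff_C_kt)
  qed
  then have cont: "isCont (D u v) x" for u v
    by (simp add: continuous_on_eq_continuous_at)
  have "\<bar>D u v x - D v u x\<bar> \<le> e" if e: "0 < e" for e
  proof -
    have "\<forall>\<^sub>F y in nhds x. dist (D u v y) (D u v x) < e / 2 \<and> dist (D v u y) (D v u x) < e / 2"
    proof (rule eventually_conj)
      show "\<forall>\<^sub>F y in nhds x. dist (D u v y) (D u v x) < e / 2" "\<forall>\<^sub>F y in nhds x. dist (D v u y) (D v u x) < e / 2"
        using cont[of u v] cont[of v u] e unfolding continuous_at tendsto_at_iff_tendsto_nhds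
        by (auto dest!: tendstoD[where e="e/2"])
    qed
    then obtain d where d: "0 < d" "\<And>y. dist y x < d \<Longrightarrow> dist (D u v y) (D u v x) < e / 2 \<and> dist (D v u y) (D v u x) < e / 2"
      unfolding eventually_nhds_metric by blast
    \<comment> \<open>Small enough for every intermediate point of either order to lie within
      \<open>d\<close> of \<open>x\<close>.\<close>
    define s where "s = d / (norm u + norm v + 1)"
    have pos: "0 < norm u + norm v + 1" using norm_ge_zero[of u] norm_ge_zero[of v] by linarith
    have s: "0 < s" using d(1) pos by (simp add: s_def)
    have near: "dist (x + r *\<^sub>R a + q *\<^sub>R b) x < d" if "0 < r" "r < s" "0 < q" "q < s" "{a, b} = {u, v}" for r q a b
    proof -
      have "dist (x + r *\<^sub>R a + q *\<^sub>R b) x \<le> norm (r *\<^sub>R a) + norm (q *\<^sub>R b)"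
        using norm_triangle_ineq[of "r *\<^sub>R a" "q *\<^sub>R b"] by (simp add: dist_norm add.assoc)
      also have "\<dots> \<le> s * norm a + s * norm b"
        using that by (intro add_mono) (auto intro!: mult_right_mono)
      also have "\<dots> = s * (norm u + norm v)"
        using that(5) by (auto simp: doubleton_eq_iff algebra_simps)
      also have "\<dots> < s * (norm u + norm v + 1)" using s by simp
      also have "\<dots> = d" using pos by (simp add: s_def)
      finally show ?thesis .
    qed
    obtain r q where rq: "0 < r" "r < s" "0 < q" "q < s"
      "f (x + s *\<^sub>R u + s *\<^sub>R v) - f (x + s *\<^sub>R u) - f (x + s *\<^sub>R v) + f x = s * s * D u v (x + r *\<^sub>R u + q *\<^sub>R v)"
      using second_difference_mean_value[OF f s, of x u v] unfolding D_def by blast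
    obtain r' q' where rq': "0 < r'" "r' < s" "0 < q'" "q' < s"
      "f (x + s *\<^sub>R v + s *\<^sub>R u) - f (x + s *\<^sub>R v) - f (x + s *\<^sub>R u) + f x = s * s * D v u (x + r' *\<^sub>R v + q' *\<^sub>R u)"
      using second_difference_mean_value[OF f s, of x v u] unfolding D_def by blast
    have "s * s * D u v (x + r *\<^sub>R u + q *\<^sub>R v) = s * s * D v u (x + r' *\<^sub>R v + q' *\<^sub>R u)"
      using rq(5) rq'(5) by (simp add: add.commute add.left_commute algebra_simps)
    then have "D u v (x + r *\<^sub>R u + q *\<^sub>R v) = D v u (x + r' *\<^sub>R v + q' *\<^sub>R u)" using s by simp
    moreover have "dist (D u v (x + r *\<^sub>R u + q *\<^sub>R v)) (D u v x) < e / 2"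
      using d(2)[OF near[OF rq(1-4)]] by simp
    moreover have "dist (D v u (x + r' *\<^sub>R v + q' *\<^sub>R u)) (D v u x) < e / 2"
      using d(2)[OF near[OF rq'(1-4)]] by (simp add: insert_commute)
    ultimately show ?thesis unfolding dist_real_def by linarith
  qed
  then have "\<bar>D u v x - D v u x\<bar> \<le> 0" by (rule field_le_epsilon) simp
  then show ?thesis by (simp add: D_def)
qed

section \<open>Matrix products and bounds from compact support\<close>

lemma bounded_bilinear_matrix_vector: "bounded_bilinear ((*v) :: real^'n^'m \<Rightarrow> real^'n \<Rightarrow> real^'m)"
proof -
  have "linear (\<lambda>A :: real^'n^'m. A *v x)" for x
    by (intro linearI) (simp_all add: matrix_vector_mult_def vec_eq_iff sum.distrib algebra_simps sum_distrib_left)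
  then show ?thesis
    unfolding bilinear_conv_bounded_bilinear[symmetric] bilinear_def by simp
qed

lemma bounded_bilinear_matrix_matrix: "bounded_bilinear ((**) :: real^'n^'m \<Rightarrow> real^'k^'n \<Rightarrow> real^'k^'m)"
  unfolding bilinear_conv_bounded_bilinear[symmetric] bilinear_def
  by (intro conjI allI linearI)
    (simp_all add: matrix_matrix_mult_def vec_eq_iff sum.distrib algebra_simps sum_distrib_left)

lemma bounded_bilinear_vector_matrix: "bounded_bilinear ((v*) :: real^'m \<Rightarrow> real^'n^'m \<Rightarrow> real^'n)"
  unfolding bilinear_conv_bounded_bilinear[symmetric] bilinear_def
  by (intro conjI allI linearI)
    (simp_all add: vector_matrix_mult_def vec_eq_iff sum.distrib algebra_simps sum_distrib_left)

lemma C_kt_jacobian: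
  fixes f :: "real \<Rightarrow> real^'n \<Rightarrow> real^'m"
  assumes "C_kt (Suc k) f"
  shows "C_kt k (\<lambda>t x. jacobian (f t) (at x))"
proof (rule C_kt_componentwise, rule C_kt_componentwise)
  fix i j
  show "C_kt k (\<lambda>t x. jacobian (f t) (at x) $ i $ j)"
    using C_kt_bounded_linear[OF bounded_linear_vec_nth C_kt_frechet[OF assms]]
    by (simp add: jacobian_def matrix_def)
qed

lemma C_kt_has_jacobian:
  fixes f :: "real \<Rightarrow> real^'n \<Rightarrow> real^'m"
  assumes "C_kt (Suc k) f"
  shows "(f t has_derivative (\<lambda>v. jacobian (f t) (at x) *v v)) (at x)"
  using assms jacobian_works by auto

text \<open>Supplies the Lipschitz constant, uniform in time and parameter, that the lemmas on
  linear equations demand.\<close>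

lemma bounded_bilinear_bounded_left:
  assumes P: "bounded_bilinear P" and C: "\<And>x. norm (f x) \<le> C"
  shows "\<exists>K\<ge>0. \<forall>x v. norm (P (f x) v) \<le> K * norm v"
proof -
  obtain B where B: "0 < B" "\<And>a v. norm (P a v) \<le> norm a * norm v * B"
    using bounded_bilinear.pos_bounded[OF P] by blast
  have "0 \<le> C" using C norm_ge_zero order_trans by blast
  moreover have "norm (P (f x) v) \<le> C * B * norm v" for x v
  proof -
    have "norm (f x) * norm v * B \<le> C * norm v * B"
      using B(1) C[of x] by (intro mult_right_mono) auto
    with B(2)[of "f x" v] show ?thesis by (simp add: ac_simps)
  qed
  ultimately show ?thesis using B(1) by (intro exI[of _ "C * B"]) auto
qed

lemma continuous_compact_support_bounded:
  fixes f :: "'a::euclidean_space \<Rightarrow> 'b::real_normed_vector"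
  assumes "continuous_on UNIV f" "compact S" "\<And>x. x \<notin> S \<Longrightarrow> f x = 0"
  shows "\<exists>C\<ge>0. \<forall>x. norm (f x) \<le> C"
proof -
  have "compact (f ` S)"
    by (intro compact_continuous_image continuous_on_subset[OF assms(1)] assms(2)) simp
  from compact_imp_bounded[OF this] obtain C where "\<forall>y\<in>f ` S. norm y \<le> C"
    unfolding bounded_iff by blast
  then have "norm (f x) \<le> max C 0" for x
    using assms(3)[of x] by (cases "x \<in> S") (auto simp: le_max_iff_disj)
  then show ?thesis by (intro exI[of _ "max C 0"]) auto
qed

lemma frechet_derivative_outside_support:
  assumes "x \<notin> closure {x. f x \<noteq> 0}"
  shows "frechet_derivative f (at x) = (\<lambda>_. 0)"
proof -
  have "(f has_derivative (\<lambda>_. 0)) (at x)"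
  proof (rule has_derivative_transform_within_open)
    show "((\<lambda>_. 0) has_derivative (\<lambda>_. 0)) (at x)" by (rule has_derivative_const)
    show "open (- closure {x. f x \<noteq> 0})" by (rule open_Compl[OF closed_closure])
    show "x \<in> - closure {x. f x \<noteq> 0}" using assms by simp
    show "0 = f y" if "y \<in> - closure {x. f x \<noteq> 0}" for y
      using that closure_subset[of "{x. f x \<noteq> 0}"] by auto
  qed
  from frechet_derivative_at[OF this, symmetric] show ?thesis .
qed

section \<open>The flow of a test vector field\<close>

locale smooth_flow =
  fixes \<xi> :: "real^'n \<Rightarrow> real^'n" and T :: "real \<Rightarrow> real^'n \<Rightarrow> real^'n"
  assumes xi: "\<xi> \<in> Cc_infinity" and flow: "is_flow \<xi> T"
begin

abbreviation "D\<xi> x \<equiv> jacobian \<xi> (at x)"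

lemma xi_smooth: "C_k k \<xi>" "C_kt k (\<lambda>_. \<xi>)"
  using xi by (simp_all add: Cc_infinity_def C_k_iff_C_kt)

lemma xi_derivative: "(\<xi> has_derivative (\<lambda>v. D\<xi> x *v v)) (at x)"
  by (rule C_kt_has_jacobian[OF xi_smooth(2)])

lemma Dxi_smooth: "C_kt k (\<lambda>_ x. D\<xi> x)"
  by (rule C_kt_jacobian[OF xi_smooth(2)])

lemma divergence_smooth: "C_kt k (\<lambda>_. divergence \<xi>)"
proof -
  have eq: "divergence \<xi> = (\<lambda>x. \<Sum>i\<in>UNIV. D\<xi> x $ i $ i)"
    by (rule ext) (simp add: divergence_def trace_def)
  show ?thesis
    unfolding eq by (intro C_kt_sum C_kt_bounded_linear[OF bounded_linear_vec_nth] Dxi_smooth) simp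
qed

lemma compact_support: "compact (closure {x. \<xi> x \<noteq> 0})"
  using xi by (simp add: Cc_infinity_def compactly_supported_def)

lemma Dxi_outside: "x \<notin> closure {x. \<xi> x \<noteq> 0} \<Longrightarrow> D\<xi> x = 0"
  by (simp add: jacobian_def frechet_derivative_outside_support matrix_def vec_eq_iff)

lemma Dxi_continuous: "continuous_on UNIV (\<lambda>x. D\<xi> x)"
  using C_kt_imp_C_k[OF Dxi_smooth[of 0]] by simp

lemma Dxi_bounded: "\<exists>C\<ge>0. \<forall>x. norm (D\<xi> x) \<le> C"
  by (rule continuous_compact_support_bounded[OF Dxi_continuous compact_support Dxi_outside])

lemma Dxi_operator_bounded: "\<exists>K\<ge>0. \<forall>x v. norm (D\<xi> x *v v) \<le> K * norm v"
proof -
  obtain C where "\<And>x. norm (D\<xi> x) \<le> C" using Dxi_bounded by blast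
  then show ?thesis by (rule bounded_bilinear_bounded_left[OF bounded_bilinear_matrix_vector])
qed

lemma xi_lipschitz: "\<exists>K\<ge>0. \<forall>x y. norm (\<xi> x - \<xi> y) \<le> K * norm (x - y)"
proof -
  obtain K where K: "0 \<le> K" "\<And>x v. norm (D\<xi> x *v v) \<le> K * norm v" using Dxi_operator_bounded by blast
  have "norm (\<xi> x - \<xi> y) \<le> K * norm (x - y)" for x y
    by (rule differentiable_bound[where S=UNIV and f'="\<lambda>x v. D\<xi> x *v v"])
      (auto intro: xi_derivative onorm_le K)
  with K(1) show ?thesis by blast
qed

lemma T_0 [simp]: "T 0 x = x"
  and T_ode: "((\<lambda>s. T s x) has_vector_derivative \<xi> (T t x)) (at t)"
  using flow by (auto simp: is_flow_def)

lemma T_lipschitz: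
  "\<exists>C>0. \<forall>t x y. \<bar>t\<bar> \<le> H \<longrightarrow> norm (T t x - T t y) \<le> C * norm (x - y)"
proof -
  obtain K where K: "0 \<le> K" "\<And>x y. norm (\<xi> x - \<xi> y) \<le> K * norm (x - y)" using xi_lipschitz by blast
  define C where "C = exp ((2 * K + 1) * \<bar>H\<bar>) * (1 + \<bar>H\<bar>)"
  have C: "0 < C" unfolding C_def by (intro mult_pos_pos) auto
  have "norm (T t x - T t y) \<le> exp ((2 * K + 1) * \<bar>H\<bar>) * (1 + \<bar>H\<bar>) * (norm (T 0 x - T 0 y) + 0)"
    if "\<bar>t\<bar> \<le> H" for t x y
    by (rule gronwall[where r="\<lambda>t. T t x - T t y" and r'="\<lambda>t. \<xi> (T t x) - \<xi> (T t y)"])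
      (use K that in \<open>auto intro!: has_vector_derivative_diff T_ode\<close>)
  with C show ?thesis unfolding C_def by (intro exI[of _ "exp ((2 * K + 1) * \<bar>H\<bar>) * (1 + \<bar>H\<bar>)"]) simp
qed

lemma T_time_continuous: "continuous_on UNIV (\<lambda>t. T t x)"
  by (intro continuous_at_imp_continuous_on ballI has_vector_derivative_continuous[OF T_ode])

lemma T_continuous: "continuous_on UNIV (\<lambda>(t, x). T t x)"
proof (rule continuous_on_kt_I[OF T_time_continuous])
  fix x :: "real^'n" and H e :: real assume e: "0 < e"
  obtain C where C: "0 < C" "\<And>t x y. \<bar>t\<bar> \<le> H \<Longrightarrow> norm (T t x - T t y) \<le> C * norm (x - y)"
    using T_lipschitz by blast
  have "\<forall>\<^sub>F y in nhds x. dist y x < e / C"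
    using e C(1) eventually_nhds_metric by (metis divide_pos_pos)
  then show "\<forall>\<^sub>F y in nhds x. \<forall>t. \<bar>t\<bar> \<le> H \<longrightarrow> norm (T t y - T t x) \<le> e"
  proof (rule eventually_mono, intro allI impI)
    fix y t assume y: "dist y x < e / C" and t: "\<bar>t\<bar> \<le> H"
    have "norm (T t y - T t x) \<le> C * norm (y - x)" by (rule C(2)[OF t])
    also have "\<dots> \<le> C * (e / C)" using y C(1) by (intro mult_left_mono) (auto simp: dist_norm)
    finally show "norm (T t y - T t x) \<le> e" using C(1) by simp
  qed
qed

text \<open>The linearised equation has no inhomogeneity, because \<open>\<xi>\<close> depends on
  the initial point only through the solution itself.\<close>

lemma T_derivative_ex:
  "\<exists>D. (\<forall>v. D 0 v = v) \<and>
    (\<forall>t v. ((\<lambda>s. D s v) has_vector_derivative D\<xi> (T t x) *v D t v + 0) (at t)) \<and>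
    (\<forall>t. (T t has_derivative D t) (at x))"
proof -
  obtain K where K: "0 \<le> K" "\<And>x v. norm (D\<xi> x *v v) \<le> K * norm v" using Dxi_operator_bounded by blast
  have Dxi_T: "continuous_on UNIV (\<lambda>t. D\<xi> (T t x))"
    by (rule continuous_on_compose2[OF Dxi_continuous T_time_continuous]) simp
  show ?thesis
  proof (rule parametric_derivative[where L="\<lambda>t v. D\<xi> (T t x) *v v" and c="\<lambda>_ _. 0"
        and w'="\<lambda>t y. \<xi> (T t y)" and K=K])
    show "continuous_on UNIV (\<lambda>(t, y). D\<xi> (T t x) *v y)"
      unfolding split_beta
      by (intro bounded_bilinear.continuous_on[OF bounded_bilinear_matrix_vector] continuous_on_snd continuous_on_id
          continuous_on_compose2[OF Dxi_T continuous_on_fst]) simp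
    show "linear (\<lambda>v::real^'n. 0::real^'n)" by (rule module_hom_zero)
    show "linear (\<lambda>v::real^'n. v)" by (rule module_hom_ident)
    show "((\<lambda>s. T s y) has_vector_derivative \<xi> (T t y)) (at t)" for t y by (rule T_ode)
    fix H e :: real assume e: "0 < e"
    obtain C where C: "0 < C" "\<And>t x y. \<bar>t\<bar> \<le> H \<Longrightarrow> norm (T t x - T t y) \<le> C * norm (x - y)"
      using T_lipschitz by blast
    \<comment> \<open>Translation by \<open>T t x\<close> moves the time-dependent base point to the
      fixed point 0, where the uniform Taylor estimate applies.\<close>
    define f where "f = (\<lambda>t z. \<xi> (T t x + z))"
    have f: "C_kt (Suc 0) f"
      unfolding f_def
      by (rule C_kt_compose[OF xi_smooth(2) C_kt_add[OF C_kt_time[OF T_time_continuous] C_kt_ident]])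
    have f': "frechet_derivative (f t) (at 0) v = D\<xi> (T t x) *v v" for t v
    proof -
      have "((\<lambda>z. T t x + z) has_derivative (\<lambda>v. v)) (at 0)" by (auto intro!: derivative_eq_intros)
      from diff_chain_at[OF this, of \<xi> "\<lambda>v. D\<xi> (T t x) *v v"] xi_derivative[of "T t x"]
      have "(f t has_derivative (\<lambda>v. D\<xi> (T t x) *v v)) (at 0)" by (simp add: f_def o_def)
      from frechet_derivative_at[OF this, symmetric] show ?thesis by simp
    qed
    \<comment> \<open>Increments of the flow are at most \<open>C * norm v\<close>, which costs this
      factor.\<close>
    have "0 < e / C" using e C(1) by simp
    from uniform_taylor[OF f this, where H=H and x=0]
    obtain d where d: "0 < d" "\<And>v t. norm v < d \<Longrightarrow> \<bar>t\<bar> \<le> H \<Longrightarrow>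
        norm (f t (0 + v) - f t 0 - D\<xi> (T t x) *v v) \<le> e / C * norm v"
      unfolding f' by blast
    have "norm (\<xi> (T t (x + v)) - \<xi> (T t x) - D\<xi> (T t x) *v (T t (x + v) - T t x) - 0) \<le> e * norm v"
      if v: "norm v < d / C" and t: "\<bar>t\<bar> \<le> H" for v t
    proof -
      define z where "z = T t (x + v) - T t x"
      have z: "norm z \<le> C * norm v" using C(2)[OF t, of "x + v" x] by (simp add: z_def)
      also have "\<dots> < d" using v C(1) by (simp add: pos_less_divide_eq mult.commute)
      finally have "norm (f t (0 + z) - f t 0 - D\<xi> (T t x) *v z) \<le> e / C * norm z" using d(2) t by blast
      also have "\<dots> \<le> e / C * (C * norm v)" using z e C(1) by (intro mult_left_mono) auto
      finally show ?thesis using C(1) by (simp add: f_def z_def)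
    qed
    then show "\<exists>d>0. \<forall>v t. norm v < d \<longrightarrow> \<bar>t\<bar> \<le> H \<longrightarrow>
      norm (\<xi> (T t (x + v)) - \<xi> (T t x) - D\<xi> (T t x) *v (T t (x + v) - T t x) - 0) \<le> e * norm v"
      using d(1) C(1) by (intro exI[of _ "d / C"]) auto
  qed (use K in auto)
qed

abbreviation "DT t x \<equiv> jacobian (T t) (at x)"

lemma
  shows DT_derivative: "(T t has_derivative (\<lambda>v. DT t x *v v)) (at x)"
    and DT_0: "DT 0 x *v v = v"
    and DT_ode: "((\<lambda>s. DT s x *v v) has_vector_derivative D\<xi> (T t x) *v (DT t x *v v)) (at t)"
proof -
  obtain D where D: "\<And>v. D 0 v = v" "\<And>t v. ((\<lambda>s. D s v) has_vector_derivative D\<xi> (T t x) *v D t v + 0) (at t)"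
    "\<And>t. (T t has_derivative D t) (at x)"
    using T_derivative_ex by blast
  have "T t differentiable (at x)" for t using D(3) differentiable_def by blast
  then have *: "(T t has_derivative (\<lambda>v. DT t x *v v)) (at x)" for t by (simp add: jacobian_works)
  have "D t = (\<lambda>v. DT t x *v v)" for t by (rule has_derivative_unique[OF D(3) *])
  with * D show "(T t has_derivative (\<lambda>v. DT t x *v v)) (at x)" "DT 0 x *v v = v"
    "((\<lambda>s. DT s x *v v) has_vector_derivative D\<xi> (T t x) *v (DT t x *v v)) (at t)"
    by simp_all
qed

text \<open>Bootstrapping: if \<open>T\<close> has order \<open>k\<close>, so has the coefficient
  \<open>D\<xi> (T t x)\<close> of the variational equation. Hence the derivative of
  \<open>T\<close> has order \<open>k\<close>, and \<open>T\<close> has order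
  \<open>k + 1\<close>.\<close>

lemma T_smooth: "C_kt k T"
proof (induction k)
  case 0
  show ?case using T_continuous by simp
next
  case (Suc k)
  obtain K where K: "0 \<le> K" "\<And>x v. norm (D\<xi> x *v v) \<le> K * norm v" using Dxi_operator_bounded by blast
  have "C_kt k (\<lambda>t x. DT t x *v v)" for v
  proof (rule linear_ode_C_kt[OF bounded_bilinear_matrix_vector _ K(1), where a="\<lambda>t x. D\<xi> (T t x)" and b="\<lambda>_ _. 0"])
    show "norm (D\<xi> (T t x) *v y) \<le> K * norm y" for t x y by (rule K(2))
    show "C_kt k (\<lambda>t x. D\<xi> (T t x))" by (rule C_kt_compose[OF Dxi_smooth Suc.IH])
    show "C_kt k (\<lambda>_ _. 0)" by (rule C_kt_const)
    show "((\<lambda>s. DT s x *v v) has_vector_derivative D\<xi> (T t x) *v (DT t x *v v) + 0) (at t)" for t x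
      using DT_ode by (simp only: add_0_right)
    show "DT 0 x *v v = v" for x by (rule DT_0)
  qed
  then show ?case by (rule C_kt_SucI[OF T_continuous DT_derivative])
qed

end

abbreviation partial_deriv :: "'n \<Rightarrow> (real^'n \<Rightarrow> 'b::real_normed_vector) \<Rightarrow> real^'n \<Rightarrow> 'b" where
  "partial_deriv i f x \<equiv> frechet_derivative f (at x) (axis i 1)"

lemma C_kt_exp: "C_kt k (\<lambda>_ x::real. exp x)"
proof (induction k)
  case 0
  show ?case by (auto simp: split_beta intro!: continuous_intros)
next
  case (Suc k)
  show ?case
  proof (rule C_kt_SucI)
    show "continuous_on UNIV (\<lambda>(t::real, x::real). exp x)"
      by (auto simp: split_beta intro!: continuous_intros)
    show "(exp has_derivative (\<lambda>v. exp x * v)) (at x)" for x :: real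
      using DERIV_exp[of x] by (simp add: has_field_derivative_def)
    show "C_kt k (\<lambda>_ x::real. exp x * v)" for v
      by (rule C_kt_bilinear[OF bounded_bilinear_mult Suc.IH C_kt_const])
  qed
qed

lemma C_kt_grad:
  fixes f :: "real \<Rightarrow> real^'n \<Rightarrow> real"
  assumes "C_kt (Suc k) f"
  shows "C_kt k (\<lambda>t. grad (f t))"
proof (rule C_kt_componentwise)
  show "C_kt k (\<lambda>t x. grad (f t) x $ i)" for i
    using C_kt_frechet[OF assms, of "axis i 1"] by (simp add: grad_def)
qed

lemma frechet_derivative_eq_grad:
  fixes f :: "real^'n \<Rightarrow> real"
  assumes "f differentiable (at x)"
  shows "frechet_derivative f (at x) v = grad f x \<bullet> v"
proof -
  have lin: "linear (frechet_derivative f (at x))"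
    using assms frechet_derivative_works has_derivative_linear by blast
  have "v = (\<Sum>i\<in>UNIV. v $ i *\<^sub>R axis i 1)"
    using basis_expansion[of v, symmetric] unfolding scalar_mult_eq_scaleR .
  then have "frechet_derivative f (at x) v = frechet_derivative f (at x) (\<Sum>i\<in>UNIV. v $ i *\<^sub>R axis i 1)"
    by (rule arg_cong)
  also have "\<dots> = (\<Sum>i\<in>UNIV. v $ i * partial_deriv i f x)"
    by (simp add: linear_sum[OF lin] linear_cmul[OF lin])
  finally show ?thesis by (simp add: grad_def inner_vec_def mult.commute)
qed

text \<open>Sign and argument order are arranged so that the equation for the inverse matrix has the
  form \<open>P (a t x) (w t x)\<close> of the general linear equation.\<close>

lemma bounded_bilinear_neg_right_mult:
  "bounded_bilinear (\<lambda>(a :: real^'n^'n) (w :: real^'n^'n). - (w ** a))"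
  unfolding bilinear_conv_bounded_bilinear[symmetric] bilinear_def
  by (intro conjI allI linearI)
    (simp_all add: matrix_matrix_mult_def vec_eq_iff sum.distrib algebra_simps sum_distrib_left)

lemma matrix_mult_row: "(A ** B) $ j = (A $ j) v* B" for A :: "real^'n^'m"
  by (simp add: matrix_matrix_mult_def vector_matrix_mult_def vec_eq_iff mult.commute)

section \<open>Group law, inverse derivative and logarithmic Jacobian\<close>

context smooth_flow
begin

lemma T_add: "T (t + s) x = T t (T s x)"
proof -
  obtain K where K: "0 \<le> K" "\<And>x y. norm (\<xi> x - \<xi> y) \<le> K * norm (x - y)" using xi_lipschitz by blast
  have "T (t + s) x - T t (T s x) = 0"
  proof (rule linear_ode_zero[where r="\<lambda>t. T (t + s) x - T t (T s x)"
        and r'="\<lambda>t. \<xi> (T (t + s) x) - \<xi> (T t (T s x))", OF _ K(2) K(1)])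
    fix t
    have "((\<lambda>t. t + s) has_vector_derivative 1) (at t)"
      by (auto intro!: derivative_eq_intros)
    from vector_diff_chain_at[OF this, of "\<lambda>t. T t x" "\<xi> (T (t + s) x)"] T_ode[of x "t + s"]
    have "((\<lambda>t. T (t + s) x) has_vector_derivative \<xi> (T (t + s) x)) (at t)" by (simp add: o_def)
    then show "((\<lambda>t. T (t + s) x - T t (T s x)) has_vector_derivative \<xi> (T (t + s) x) - \<xi> (T t (T s x))) (at t)"
      by (rule has_vector_derivative_diff[OF _ T_ode])
  qed simp
  then show ?thesis by simp
qed

lemma T_inverse: "T (- t) (T t x) = x" "T t (T (- t) x) = x"
  using T_add[of "- t" t x] T_add[of t "- t" x] by simp_all

text \<open>\<open>A t x\<close> is the inverse of \<open>DT t x\<close>, introduced through its differential equation.\<close>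

definition A :: "real \<Rightarrow> real^'n \<Rightarrow> real^'n^'n" where
  "A = (SOME A. \<forall>x. A 0 x = mat 1 \<and> (\<forall>t. ((\<lambda>s. A s x) has_vector_derivative - (A t x ** D\<xi> (T t x))) (at t)))"

lemma neg_right_mult_bounded:
  "\<exists>K\<ge>0. \<forall>x (w :: real^'n^'n). norm (- (w ** D\<xi> x)) \<le> K * norm w"
proof -
  obtain C where "\<And>x. norm (D\<xi> x) \<le> C" using Dxi_bounded by blast
  then show ?thesis by (rule bounded_bilinear_bounded_left[OF bounded_bilinear_neg_right_mult])
qed

lemma Dxi_T_smooth: "C_kt k (\<lambda>t x. D\<xi> (T t x))"
  by (rule C_kt_compose[OF Dxi_smooth T_smooth])

text \<open>Solutions are selected separately for each \<open>x\<close>, with no regularity in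
  \<open>x\<close> at this stage; that comes afterwards from \<open>linear_ode_C_kt\<close>.\<close>

lemma A_0: "A 0 x = mat 1"
  and A_ode: "((\<lambda>s. A s x) has_vector_derivative - (A t x ** D\<xi> (T t x))) (at t)"
proof -
  obtain K where K: "0 \<le> K" "\<And>x (w :: real^'n^'n). norm (- (w ** D\<xi> x)) \<le> K * norm w"
    using neg_right_mult_bounded by blast
  have *: "\<exists>w :: real \<Rightarrow> real^'n^'n. w 0 = mat 1 \<and> (\<forall>t. (w has_vector_derivative - (w t ** D\<xi> (T t x))) (at t))" for x
  proof (rule picard_lindelof[where K=K])
    show "continuous_on UNIV (\<lambda>(t, w :: real^'n^'n). - (w ** D\<xi> (T t x)))"
      unfolding split_beta
      by (rule bounded_bilinear.continuous_on[OF bounded_bilinear_neg_right_mult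
            continuous_on_compose2[OF continuous_on_slice(2)[OF C_kt_continuous[OF Dxi_T_smooth[of 0]]]
              continuous_on_fst[OF continuous_on_id]] continuous_on_snd[OF continuous_on_id]]) simp
    show "norm (- (y ** D\<xi> (T t x)) - - (z ** D\<xi> (T t x))) \<le> K * norm (y - z)" for t and y z :: "real^'n^'n"
      unfolding bounded_bilinear.diff_right[OF bounded_bilinear_neg_right_mult, symmetric] by (rule K(2))
  qed
  obtain W :: "real^'n \<Rightarrow> real \<Rightarrow> real^'n^'n" where
    "\<And>x. W x 0 = mat 1" "\<And>x t. (W x has_vector_derivative - (W x t ** D\<xi> (T t x))) (at t)"
    using * by metis
  then have "\<exists>A :: real \<Rightarrow> real^'n \<Rightarrow> real^'n^'n. \<forall>x. A 0 x = mat 1 \<and>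
      (\<forall>t. ((\<lambda>s. A s x) has_vector_derivative - (A t x ** D\<xi> (T t x))) (at t))"
    by (intro exI[of _ "\<lambda>t x. W x t"]) simp
  from someI_ex[OF this] show "A 0 x = mat 1"
    "((\<lambda>s. A s x) has_vector_derivative - (A t x ** D\<xi> (T t x))) (at t)"
    unfolding A_def[symmetric] by simp_all
qed

lemma A_ode_0: "((\<lambda>s. A s x) has_vector_derivative - (A t x ** D\<xi> (T t x)) + 0) (at t)"
  using A_ode by simp

lemma A_smooth: "C_kt k A"
proof -
  obtain K where K: "0 \<le> K" "\<And>x (w :: real^'n^'n). norm (- (w ** D\<xi> x)) \<le> K * norm w"
    using neg_right_mult_bounded by blast
  show ?thesis
    by (rule linear_ode_C_kt[OF bounded_bilinear_neg_right_mult K(2) K(1) Dxi_T_smooth C_kt_const A_ode_0 A_0])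
qed

text \<open>The contributions \<open>A D\<xi> DT\<close> and \<open>- A D\<xi> DT\<close> to the
  derivative of the product cancel, so the product keeps its initial value.\<close>

lemma A_DT_vec: "A t x *v (DT t x *v v) = v"
proof -
  have "A t x *v (DT t x *v v) - v = 0"
  proof (rule linear_ode_zero[where r="\<lambda>t. A t x *v (DT t x *v v) - v" and r'="\<lambda>_. 0" and K=0])
    fix s
    have "((\<lambda>t. A t x *v (DT t x *v v) - v) has_vector_derivative
        (A s x *v (D\<xi> (T s x) *v (DT s x *v v)) + - (A s x ** D\<xi> (T s x)) *v (DT s x *v v)) - 0) (at s)"
      by (rule has_vector_derivative_diff[OF bounded_bilinear.has_vector_derivative[OF
              bounded_bilinear_matrix_vector A_ode DT_ode] has_vector_derivative_const])
    then show "((\<lambda>t. A t x *v (DT t x *v v) - v) has_vector_derivative 0) (at s)"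
      by (simp add: bounded_bilinear.minus_left[OF bounded_bilinear_matrix_vector]
          bounded_bilinear.minus_left[OF bounded_bilinear_matrix_matrix] matrix_vector_mul_assoc matrix_mul_assoc)
  qed (simp_all add: A_0 DT_0)
  then show ?thesis by simp
qed

lemma DT_A: "DT t x ** A t x = mat 1"
proof -
  have "A t x ** DT t x = mat 1"
    using A_DT_vec by (simp add: matrix_eq matrix_vector_mul_assoc[symmetric])
  then show ?thesis by (rule matrix_left_right_inverse1)
qed

text \<open>Component \<open>i\<close> is the divergence of column \<open>i\<close> of
  \<open>A t\<close>. By the Piola identity this vector is
  \<open>- (grad (\<Phi> t) x v* A t x)\<close>, with \<open>\<Phi>\<close> the logarithmic Jacobian
  introduced below.\<close>

definition B :: "real \<Rightarrow> real^'n \<Rightarrow> real^'n" where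
  "B t x = (\<Sum>j\<in>UNIV. partial_deriv j (A t) x $ j)"

lemma B_smooth: "C_kt k B"
proof -
  have "C_kt k (\<lambda>t x. \<Sum>j\<in>UNIV. partial_deriv j (A t) x $ j)"
    by (intro C_kt_sum C_kt_bounded_linear[OF bounded_linear_vec_nth] C_kt_frechet[OF A_smooth]) simp
  then show ?thesis by (simp add: B_def[abs_def])
qed

lemma grad_divergence_smooth: "C_kt k (\<lambda>_. grad (divergence \<xi>))"
  by (rule C_kt_grad[OF divergence_smooth])

abbreviation "D2\<xi> y \<equiv> frechet_derivative (\<lambda>x. D\<xi> x) (at y)"

lemma D2xi: "((\<lambda>x. D\<xi> x) has_derivative D2\<xi> y) (at y)"
  by (rule C_kt_has_derivative[OF Dxi_smooth[of "Suc 0"]])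

lemma D2xi_component: "frechet_derivative (\<lambda>x. D\<xi> x $ k $ i) (at y) v = D2\<xi> y v $ k $ i"
  using frechet_derivative_at[OF bounded_linear.has_derivative[OF bounded_linear_vec_nth
        bounded_linear.has_derivative[OF bounded_linear_vec_nth D2xi]], symmetric] by simp

text \<open>Schwarz's theorem for the components of \<open>\<xi>\<close>; it turns a divergence of
  columns of \<open>D\<xi>\<close> into the gradient of its trace.\<close>

lemma D2xi_symmetric: "D2\<xi> y (axis l 1) $ k $ i = D2\<xi> y (axis i 1) $ k $ l"
proof -
  have eq: "partial_deriv j (\<lambda>x. \<xi> x $ k) x = D\<xi> x $ k $ j" for x j
    using frechet_derivative_at[OF bounded_linear.has_derivative[OF bounded_linear_vec_nth xi_derivative], symmetric]
    by (simp add: matrix_vector_mult_basis column_def)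
  have "C_k (Suc (Suc 0)) (\<lambda>x. \<xi> x $ k)"
    unfolding C_k_iff_C_kt by (rule C_kt_bounded_linear[OF bounded_linear_vec_nth xi_smooth(2)])
  from symmetric_second_derivative[OF this, of "axis i 1" y "axis l 1"] show ?thesis
    unfolding eq D2xi_component .
qed

lemma grad_divergence: "grad (divergence \<xi>) y $ i = (\<Sum>k\<in>UNIV. D2\<xi> y (axis i 1) $ k $ k)"
proof -
  have eq: "divergence \<xi> = (\<lambda>x. \<Sum>k\<in>UNIV. D\<xi> x $ k $ k)"
    by (rule ext) (simp add: divergence_def trace_def)
  have "((\<lambda>x. \<Sum>k\<in>UNIV. D\<xi> x $ k $ k) has_derivative (\<lambda>v. \<Sum>k\<in>UNIV. D2\<xi> y v $ k $ k)) (at y)"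
    by (intro has_derivative_sum bounded_linear.has_derivative[OF bounded_linear_vec_nth] D2xi)
  from frechet_derivative_at[OF this, symmetric] show ?thesis
    by (simp add: grad_def eq)
qed

text \<open>Row \<open>j\<close> of the equation for the \<open>j\<close>-th partial derivative of
  \<open>A\<close>, summed over \<open>j\<close>. Differentiating the factor \<open>A\<close> gives
  back \<open>B\<close>; differentiating the coefficient produces \<open>DT\<close>, which cancels
  against \<open>A\<close> and leaves second derivatives of \<open>\<xi>\<close> only.\<close>

lemma B_0: "B 0 x = 0"
  and B_ode: "((\<lambda>s. B s x) has_vector_derivative
    - (B t x v* D\<xi> (T t x)) - grad (divergence \<xi>) (T t x)) (at t)"
proof -
  obtain K where K: "0 \<le> K" "\<And>x (w :: real^'n^'n). norm (- (w ** D\<xi> x)) \<le> K * norm w"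
    using neg_right_mult_bounded by blast
  let ?A' = "\<lambda>t j. partial_deriv j (A t) x"
  let ?a' = "\<lambda>j. partial_deriv j (\<lambda>x. D\<xi> (T t x)) x"
  note D = linear_ode_derivative[OF bounded_bilinear_neg_right_mult K(2) K(1) Dxi_T_smooth C_kt_const A_ode_0 A_0]
  show "B 0 x = 0" by (simp add: B_def D(3))
  have a': "?a' j = D2\<xi> (T t x) (DT t x *v axis j 1)" for j
    using frechet_derivative_at[OF diff_chain_at[OF DT_derivative D2xi], symmetric] by (simp add: o_def)
  have "((\<lambda>s. \<Sum>j\<in>UNIV. ?A' s j $ j) has_vector_derivative
      (\<Sum>j\<in>UNIV. (- (?A' t j ** D\<xi> (T t x)) + (- (A t x ** ?a' j)
        + partial_deriv j (\<lambda>x. 0) x)) $ j)) (at t)"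
    by (intro has_vector_derivative_sum bounded_linear.has_vector_derivative[OF bounded_linear_vec_nth] D(2))
  moreover have "(\<Sum>j\<in>UNIV. (- (?A' t j ** D\<xi> (T t x)) + (- (A t x ** ?a' j)
        + partial_deriv j (\<lambda>x. 0) x)) $ j) =
      - (B t x v* D\<xi> (T t x)) - grad (divergence \<xi>) (T t x)"
  proof -
    have 1: "(\<Sum>j\<in>UNIV. (?A' t j ** D\<xi> (T t x)) $ j) = B t x v* D\<xi> (T t x)"
      by (simp add: matrix_mult_row B_def bounded_bilinear.sum_left[OF bounded_bilinear_vector_matrix])
    have 2: "(\<Sum>j\<in>UNIV. (A t x ** ?a' j) $ j) = grad (divergence \<xi>) (T t x)"
    proof (rule vec_eq_iff[THEN iffD2], rule allI)
      fix i
      have lin: "linear (D2\<xi> (T t x))" by (rule has_derivative_linear[OF D2xi])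
      have a'_i: "?a' j $ k $ i = (\<Sum>l\<in>UNIV. DT t x $ l $ j * D2\<xi> (T t x) (axis l 1) $ k $ i)" for j k
      proof -
        have "DT t x *v axis j 1 = (\<Sum>l\<in>UNIV. DT t x $ l $ j *\<^sub>R axis l 1)"
          using basis_expansion[of "column j (DT t x)", unfolded scalar_mult_eq_scaleR, symmetric]
          by (simp add: matrix_vector_mult_basis column_def)
        then show ?thesis
          unfolding a' by (simp add: linear_sum[OF lin] linear_cmul[OF lin])
      qed
      have "(\<Sum>j\<in>UNIV. (A t x ** ?a' j) $ j) $ i =
          (\<Sum>j\<in>UNIV. \<Sum>k\<in>UNIV. \<Sum>l\<in>UNIV. A t x $ j $ k * (DT t x $ l $ j * D2\<xi> (T t x) (axis l 1) $ k $ i))"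
        by (simp add: matrix_matrix_mult_def a'_i sum_distrib_left)
      \<comment> \<open>The sums are reordered to make \<open>j\<close> innermost, where it forms an
        entry of \<open>DT t x ** A t x\<close>, the identity matrix.\<close>
      also have "\<dots> = (\<Sum>k\<in>UNIV. \<Sum>j\<in>UNIV. \<Sum>l\<in>UNIV. A t x $ j $ k * (DT t x $ l $ j * D2\<xi> (T t x) (axis l 1) $ k $ i))"
        by (rule sum.swap)
      also have "\<dots> = (\<Sum>k\<in>UNIV. \<Sum>l\<in>UNIV. \<Sum>j\<in>UNIV. A t x $ j $ k * (DT t x $ l $ j * D2\<xi> (T t x) (axis l 1) $ k $ i))"
        by (intro sum.cong refl sum.swap)
      also have "\<dots> = (\<Sum>k\<in>UNIV. \<Sum>l\<in>UNIV. (DT t x ** A t x) $ l $ k * D2\<xi> (T t x) (axis l 1) $ k $ i)"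
        by (simp add: matrix_matrix_mult_def sum_distrib_right sum_distrib_left ac_simps)
      also have "\<dots> = (\<Sum>k\<in>UNIV. D2\<xi> (T t x) (axis k 1) $ k $ i)"
        by (simp add: DT_A mat_def if_distrib[of "\<lambda>c. c * _"] cong: if_cong)
      also have "\<dots> = (\<Sum>k\<in>UNIV. D2\<xi> (T t x) (axis i 1) $ k $ k)"
        by (intro sum.cong refl D2xi_symmetric)
      finally show "(\<Sum>j\<in>UNIV. (A t x ** ?a' j) $ j) $ i = grad (divergence \<xi>) (T t x) $ i"
        by (simp add: grad_divergence)
    qed
    have 3: "frechet_derivative (\<lambda>x::real^'n. 0::real^'n^'n) (at x) v = 0" for v
      using frechet_derivative_at[OF has_derivative_const[of "0::real^'n^'n"], symmetric] by simp
    show ?thesis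
      unfolding 1[symmetric] 2[symmetric] 3
      by (simp add: sum_negf[symmetric] sum_subtractf[symmetric])
  qed
  ultimately show "((\<lambda>s. B s x) has_vector_derivative
    - (B t x v* D\<xi> (T t x)) - grad (divergence \<xi>) (T t x)) (at t)"
    by (simp add: B_def[abs_def])
qed

text \<open>The logarithm of the Jacobian determinant of \<open>T t\<close>.\<close>

definition \<Phi> :: "real \<Rightarrow> real^'n \<Rightarrow> real" where
  "\<Phi> = (SOME p. \<forall>x. p 0 x = 0 \<and> (\<forall>t. ((\<lambda>s. p s x) has_vector_derivative divergence \<xi> (T t x)) (at t)))"

lemma divergence_T_smooth: "C_kt k (\<lambda>t x. divergence \<xi> (T t x))"
  by (rule C_kt_compose[OF divergence_smooth T_smooth])

lemma Phi_0: "\<Phi> 0 x = 0"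
  and Phi_ode: "((\<lambda>s. \<Phi> s x) has_vector_derivative divergence \<xi> (T t x)) (at t)"
proof -
  have *: "\<exists>p. p 0 = 0 \<and> (\<forall>t. (p has_vector_derivative divergence \<xi> (T t x)) (at t))" for x
    by (rule antiderivative_UNIV[OF continuous_on_slice(2)[OF C_kt_continuous[OF divergence_T_smooth[of 0]]]])
  obtain p where "\<And>x. p x 0 = 0" "\<And>x t. (p x has_vector_derivative divergence \<xi> (T t x)) (at t)"
    using * by metis
  then have "\<exists>p. \<forall>x. p 0 x = 0 \<and> (\<forall>t. ((\<lambda>s. p s x) has_vector_derivative divergence \<xi> (T t x)) (at t))"
    by (intro exI[of _ "\<lambda>t x. p x t"]) simp
  from someI_ex[OF this] show "\<Phi> 0 x = 0"
    "((\<lambda>s. \<Phi> s x) has_vector_derivative divergence \<xi> (T t x)) (at t)"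
    unfolding \<Phi>_def[symmetric] by simp_all
qed

lemma Phi_smooth: "C_kt k \<Phi>"
\<comment> \<open>An antiderivative in time is the case of zero coefficient, with the integrand as
  inhomogeneity.\<close>
proof (rule linear_ode_C_kt[OF bounded_bilinear_mult, where a="\<lambda>_ _. 0" and K=0])
  show "C_kt k (\<lambda>t x. divergence \<xi> (T t x))" by (rule divergence_T_smooth)
  show "((\<lambda>s. \<Phi> s x) has_vector_derivative 0 * \<Phi> t x + divergence \<xi> (T t x)) (at t)" for t x
    using Phi_ode by simp
qed (simp_all add: C_kt_const Phi_0)

text \<open>The cocycle identity: as functions of \<open>t\<close> both sides have the same
  derivative, by the group law of \<open>T\<close>, and they agree at \<open>t = 0\<close>.\<close>

lemma Phi_add: "\<Phi> (t + s) x = \<Phi> t (T s x) + \<Phi> s x"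
proof -
  have "\<Phi> (t + s) x - \<Phi> t (T s x) - \<Phi> s x = 0"
  proof (rule linear_ode_zero[where r="\<lambda>t. \<Phi> (t + s) x - \<Phi> t (T s x) - \<Phi> s x" and r'="\<lambda>_. 0" and K=0])
    fix t
    have "((\<lambda>t. t + s) has_vector_derivative 1) (at t)"
      by (auto intro!: derivative_eq_intros)
    from vector_diff_chain_at[OF this, of "\<lambda>t. \<Phi> t x" "divergence \<xi> (T (t + s) x)"] Phi_ode[of x "t + s"]
    have "((\<lambda>t. \<Phi> (t + s) x) has_vector_derivative divergence \<xi> (T (t + s) x)) (at t)" by (simp add: o_def)
    from has_vector_derivative_diff[OF has_vector_derivative_diff[OF this Phi_ode[of "T s x" t]]
        has_vector_derivative_const[of "\<Phi> s x"]]
    show "((\<lambda>t. \<Phi> (t + s) x - \<Phi> t (T s x) - \<Phi> s x) has_vector_derivative 0) (at t)"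
      by (simp add: T_add)
  qed (simp_all add: Phi_0)
  then show ?thesis by simp
qed

lemma divergence_bounded: "\<exists>C\<ge>0. \<forall>x. norm (divergence \<xi> x) \<le> C"
proof (rule continuous_compact_support_bounded[OF _ compact_support])
  show "continuous_on UNIV (divergence \<xi>)"
    using C_kt_imp_C_k[OF divergence_smooth[of 0]] by simp
  show "divergence \<xi> x = 0" if "x \<notin> closure {x. \<xi> x \<noteq> 0}" for x
    using Dxi_outside[OF that] by (simp add: divergence_def trace_def)
qed

lemma grad_divergence_bounded: "\<exists>C\<ge>0. \<forall>x. norm (grad (divergence \<xi>) x) \<le> C"
proof (rule continuous_compact_support_bounded[OF _ compact_support])
  show "continuous_on UNIV (grad (divergence \<xi>))"
    using C_kt_imp_C_k[OF grad_divergence_smooth[of 0]] by simp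
  have "divergence \<xi> x = 0" if "x \<notin> closure {x. \<xi> x \<noteq> 0}" for x
    using Dxi_outside[OF that] by (simp add: divergence_def trace_def)
  then have "closure {x. divergence \<xi> x \<noteq> 0} \<subseteq> closure {x. \<xi> x \<noteq> 0}"
    by (intro closure_minimal) auto
  then have "x \<notin> closure {x. divergence \<xi> x \<noteq> 0}" if "x \<notin> closure {x. \<xi> x \<noteq> 0}" for x
    using that by blast
  from frechet_derivative_outside_support[OF this]
  show "grad (divergence \<xi>) x = 0" if "x \<notin> closure {x. \<xi> x \<noteq> 0}" for x
    using that by (simp add: grad_def vec_eq_iff)
qed

lemma vector_Dxi_bounded: "\<exists>K\<ge>0. \<forall>x v. norm (v v* D\<xi> x) \<le> K * norm v"
proof -
  obtain C where "\<And>x. norm (D\<xi> x) \<le> C" using Dxi_bounded by blast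
  then show ?thesis
    by (rule bounded_bilinear_bounded_left[OF bounded_bilinear.flip[OF bounded_bilinear_vector_matrix]])
qed

lemma Phi_bounded: "\<exists>C. \<forall>t x. \<bar>t\<bar> \<le> H \<longrightarrow> \<bar>\<Phi> t x\<bar> \<le> C"
proof -
  obtain G where G: "0 \<le> G" "\<And>x. norm (divergence \<xi> x) \<le> G" using divergence_bounded by blast
  have "norm (\<Phi> t x) \<le> exp ((2 * 0 + 1) * H) * (1 + H) * (norm (\<Phi> 0 x) + G)" if "\<bar>t\<bar> \<le> H" for t x
    by (rule gronwall[where r="\<lambda>t. \<Phi> t x", OF Phi_ode]) (use G that in auto)
  then show ?thesis unfolding Phi_0 real_norm_def by blast
qed

end

section \<open>Separation by test functions\<close>

text \<open>The family is closed under differentiation up to linear combinations, and contains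
  the flat function \<open>exp (- 1 / x)\<close>.\<close>

definition flat :: "nat \<Rightarrow> real \<Rightarrow> real" where
  "flat n x = (if 0 < x then inverse x ^ n * exp (- inverse x) else 0)"

lemma flat_DERIV: "(flat n has_real_derivative flat (n + 2) x - n * flat (n + 1) x) (at x)"
proof -
  consider "0 < x" | "x < 0" | "x = 0" by linarith
  then show ?thesis
  proof cases
    case 1
    have "((\<lambda>x. inverse x ^ n * exp (- inverse x)) has_real_derivative flat (n + 2) x - n * flat (n + 1) x) (at x)"
    proof (cases n)
      case 0
      then show ?thesis
        using 1 by (auto intro!: derivative_eq_intros simp: flat_def power2_eq_square)
    next
      case (Suc j)
      show ?thesis unfolding Suc
        using 1 by (auto intro!: derivative_eq_intros simp: flat_def power2_eq_square algebra_simps)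
          (cases j, auto)
    qed
    then show ?thesis
      by (rule has_field_derivative_transform_within_open[where S="{0<..}"]) (use 1 in \<open>auto simp: flat_def\<close>)
  next
    case 2
    have "((\<lambda>x. 0) has_real_derivative flat (n + 2) x - n * flat (n + 1) x) (at x)"
      using 2 by (simp add: flat_def)
    then show ?thesis
      by (rule has_field_derivative_transform_within_open[where S="{..<0}"]) (use 2 in \<open>auto simp: flat_def\<close>)
  next
    case 3
    have "((\<lambda>h. (flat n (0 + h) - flat n 0) / h) \<longlongrightarrow> 0) (at 0)"
      unfolding filterlim_at_split
    proof
      show "((\<lambda>h. (flat n (0 + h) - flat n 0) / h) \<longlongrightarrow> 0) (at_left 0)"
        by (rule tendsto_eventually) (auto simp: flat_def eventually_at_filter)
      \<comment> \<open>Dividing by \<open>h\<close> raises the power of \<open>inverse h\<close> by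
        one, and the exponential still dominates.\<close>
      have "((\<lambda>h. inverse h ^ Suc n / exp (inverse h)) \<longlongrightarrow> (0::real)) (at_right 0)"
        by (rule filterlim_compose[OF tendsto_power_div_exp_0 filterlim_inverse_at_top_right])
      then show "((\<lambda>h. (flat n (0 + h) - flat n 0) / h) \<longlongrightarrow> 0) (at_right 0)"
        by (rule Lim_transform_eventually)
          (auto simp: flat_def eventually_at_filter exp_minus divide_inverse)
    qed
    then show ?thesis using 3 by (simp add: DERIV_def flat_def)
  qed
qed

lemma C_kt_flat: "C_kt k (\<lambda>_. flat n)"
proof (induction k arbitrary: n)
  case 0
  have "continuous_on UNIV (flat n)"
    by (intro continuous_at_imp_continuous_on ballI DERIV_isCont[OF flat_DERIV])
  then show ?case unfolding C_k_iff_C_kt[symmetric] by simp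
next
  case (Suc k)
  show ?case
  proof (rule C_kt_SucI[OF C_kt_continuous[OF Suc.IH]])
    show "(flat n has_derivative (\<lambda>v. (flat (n + 2) x - n * flat (n + 1) x) * v)) (at x)" for x
      using flat_DERIV[of n x] by (simp add: has_field_derivative_def)
    show "C_kt k (\<lambda>_ x. (flat (n + 2) x - n * flat (n + 1) x) * v)" for v
      by (intro C_kt_bilinear[OF bounded_bilinear_mult] C_kt_diff Suc.IH C_kt_const)
  qed
qed

lemma flat_0: "0 \<le> flat 0 x" "flat 0 x \<le> 1" "flat 0 x = 0 \<longleftrightarrow> x \<le> 0"
  by (auto simp: flat_def)

lemma flat_0_mono: "0 \<le> y \<Longrightarrow> c \<le> d \<Longrightarrow> 0 \<le> c \<Longrightarrow> flat 0 (c * y) \<le> flat 0 (d * y)"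
  using mult_right_mono[of c d y] by (auto simp: flat_def zero_less_mult_iff)

lemma flat_0_tendsto: "(\<lambda>m. flat 0 (real (Suc m) * y)) \<longlonglongrightarrow> (if 0 < y then 1 else 0)"
proof (cases "0 < y")
  case True
  have "(\<lambda>m. exp (- (inverse (real (Suc m)) * inverse y))) \<longlonglongrightarrow> exp (- (0 * inverse y))"
    by (intro tendsto_intros LIMSEQ_inverse_real_of_nat)
  then show ?thesis using True by (simp add: flat_def inverse_mult_distrib)
next
  case False
  then have "flat 0 (real (Suc m) * y) = 0" for m
    by (simp add: flat_0 mult_nonneg_nonpos)
  with False show ?thesis by simp
qed

text \<open>A product of dilated flat profiles instead of a mollification: the functions increase
  with \<open>m\<close> to the indicator of the open box and vanish outside it for every
  \<open>m\<close>, so both monotone and dominated convergence apply.\<close>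

definition box_bump :: "'a::euclidean_space \<Rightarrow> 'a \<Rightarrow> nat \<Rightarrow> 'a \<Rightarrow> real" where
  "box_bump a b m x = (\<Prod>i\<in>Basis. flat 0 (real (Suc m) * (x \<bullet> i - a \<bullet> i)) * flat 0 (real (Suc m) * (b \<bullet> i - x \<bullet> i)))"

lemma C_kt_prod:
  fixes f :: "'i \<Rightarrow> real \<Rightarrow> 'a::euclidean_space \<Rightarrow> real"
  shows "finite S \<Longrightarrow> (\<And>i. i \<in> S \<Longrightarrow> C_kt k (f i)) \<Longrightarrow> C_kt k (\<lambda>t x. \<Prod>i\<in>S. f i t x)"
  by (induction rule: finite_induct) (auto intro!: C_kt_bilinear[OF bounded_bilinear_mult] C_kt_const)

lemma C_kt_box_bump: "C_kt k (\<lambda>_. box_bump a b m)"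
proof -
  have 1: "C_kt k (\<lambda>_ x. real (Suc m) * (x \<bullet> i - a \<bullet> i))"
    and 2: "C_kt k (\<lambda>_ x. real (Suc m) * (b \<bullet> i - x \<bullet> i))" for i
    by (intro C_kt_bilinear[OF bounded_bilinear_mult] C_kt_const C_kt_diff
        C_kt_bounded_linear_arg[OF bounded_linear_inner_left])+
  have "C_kt k (\<lambda>_ x. \<Prod>i\<in>Basis. flat 0 (real (Suc m) * (x \<bullet> i - a \<bullet> i)) * flat 0 (real (Suc m) * (b \<bullet> i - x \<bullet> i)))"
    by (rule C_kt_prod[OF finite_Basis], rule C_kt_bilinear[OF bounded_bilinear_mult C_kt_compose[OF C_kt_flat 1] C_kt_compose[OF C_kt_flat 2]])
  then show ?thesis by (simp add: box_bump_def[abs_def])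
qed

lemma box_bump_bounds: "0 \<le> box_bump a b m x" "box_bump a b m x \<le> 1"
  unfolding box_bump_def by (auto intro!: prod_nonneg prod_le_1 mult_le_one simp: flat_0)

lemma box_bump_outside: "x \<notin> box a b \<Longrightarrow> box_bump a b m x = 0"
  unfolding box_bump_def mem_box prod_zero_iff[OF finite_Basis] mult_eq_0_iff flat_0
  by (force simp: mult_le_0_iff not_less)

lemma box_bump_mono: "m \<le> n \<Longrightarrow> box_bump a b m x \<le> box_bump a b n x"
proof (cases "x \<in> box a b")
  case True
  assume mn: "m \<le> n"
  show ?thesis
    unfolding box_bump_def
  proof (rule prod_mono, intro conjI)
    fix i :: 'a assume "i \<in> Basis"
    with True have "0 \<le> x \<bullet> i - a \<bullet> i" "0 \<le> b \<bullet> i - x \<bullet> i" by (auto simp: mem_box less_imp_le)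
    then show "flat 0 (real (Suc m) * (x \<bullet> i - a \<bullet> i)) * flat 0 (real (Suc m) * (b \<bullet> i - x \<bullet> i))
      \<le> flat 0 (real (Suc n) * (x \<bullet> i - a \<bullet> i)) * flat 0 (real (Suc n) * (b \<bullet> i - x \<bullet> i))"
      using mn by (intro mult_mono flat_0_mono flat_0) auto
  qed (auto simp: flat_0)
qed (simp add: box_bump_outside)

lemma box_bump_tendsto: "(\<lambda>m. box_bump a b m x) \<longlonglongrightarrow> indicator (box a b) x"
proof -
  have "(\<lambda>m. box_bump a b m x) \<longlonglongrightarrow>
      (\<Prod>i\<in>Basis. (if 0 < x \<bullet> i - a \<bullet> i then 1 else 0) * (if 0 < b \<bullet> i - x \<bullet> i then 1 else 0))"
    unfolding box_bump_def by (intro tendsto_prod tendsto_mult flat_0_tendsto)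
  also have "(\<Prod>i\<in>Basis. (if 0 < x \<bullet> i - a \<bullet> i then 1 else 0) * (if 0 < b \<bullet> i - x \<bullet> i then 1 else 0)) = (indicator (box a b) x :: real)"
  proof (cases "x \<in> box a b")
    case True
    then have "(if 0 < x \<bullet> i - a \<bullet> i then 1 else 0) * (if 0 < b \<bullet> i - x \<bullet> i then 1 else 0) = (1::real)"
      if "i \<in> Basis" for i using that by (auto simp: mem_box)
    with True show ?thesis by simp
  next
    case False
    then show ?thesis by (auto simp: mem_box intro!: prod_zero)
  qed
  finally show ?thesis .
qed

lemma box_bump_Cc_infinity: "box_bump a b m \<in> Cc_infinity"
proof -
  have "closure {x. box_bump a b m x \<noteq> 0} \<subseteq> cbox a b"
    using box_bump_outside box_subset_cbox by (intro closure_minimal) blast+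
  then have "compact (closure {x. box_bump a b m x \<noteq> 0})"
    using compact_cbox bounded_subset compact_imp_bounded compact_eq_bounded_closed closed_closure by metis
  then show ?thesis
    using C_kt_box_bump by (auto simp: Cc_infinity_def compactly_supported_def C_k_iff_C_kt)
qed

lemma Cc_infinity_subset_Cc0: "f \<in> Cc_infinity \<Longrightarrow> f \<in> Cc0"
  using C_k.simps(1) by (auto simp: Cc_infinity_def Cc0_def simp del: C_k.simps)

section \<open>The fundamental lemma of the calculus of variations\<close>

lemma borel_measurable_lebesgue_continuous:
  fixes f :: "'a::euclidean_space \<Rightarrow> 'b::topological_space"
  shows "continuous_on UNIV f \<Longrightarrow> f \<in> borel_measurable lebesgue"
  by (intro measurable_completion) (simp add: borel_measurable_continuous_onI)

lemma locally_integrable_scaleR_Cc0: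
  fixes f :: "'a::euclidean_space \<Rightarrow> 'b::euclidean_space"
  assumes f: "locally_integrable f" and \<phi>: "\<phi> \<in> Cc0"
  shows "integrable lebesgue (\<lambda>x. \<phi> x *\<^sub>R f x)"
proof -
  define K where "K = closure {x. \<phi> x \<noteq> 0}"
  have K: "compact K" and cont: "continuous_on UNIV \<phi>"
    using \<phi> by (auto simp: K_def Cc0_def compactly_supported_def)
  have out: "\<phi> x = 0" if "x \<notin> K" for x
    using that closure_subset[of "{x. \<phi> x \<noteq> 0}"] by (auto simp: K_def)
  obtain C where C: "0 \<le> C" "\<And>x. norm (\<phi> x) \<le> C"
    using continuous_compact_support_bounded[OF cont K out] by blast
  have int: "integrable lebesgue (\<lambda>x. indicator K x *\<^sub>R f x)"
    using f K by (simp add: locally_integrable_def set_integrable_def)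
  have meas: "\<phi> \<in> borel_measurable lebesgue"
    by (rule borel_measurable_lebesgue_continuous[OF cont])
  have "integrable lebesgue (\<lambda>x. \<phi> x *\<^sub>R (indicator K x *\<^sub>R f x))"
  proof (rule Bochner_Integration.integrable_bound)
    show "integrable lebesgue (\<lambda>x. C *\<^sub>R norm (indicator K x *\<^sub>R f x))"
      by (intro integrable_scaleR_right integrable_norm int)
    show "(\<lambda>x. \<phi> x *\<^sub>R (indicator K x *\<^sub>R f x)) \<in> borel_measurable lebesgue"
      by (intro borel_measurable_scaleR meas borel_measurable_integrable[OF int])
    show "AE x in lebesgue. norm (\<phi> x *\<^sub>R (indicator K x *\<^sub>R f x)) \<le> norm (C *\<^sub>R norm (indicator K x *\<^sub>R f x))"
      using C by (intro AE_I2) (auto intro!: mult_right_mono simp: abs_mult mult.assoc)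
  qed
  moreover have "\<phi> x *\<^sub>R (indicator K x *\<^sub>R f x) = \<phi> x *\<^sub>R f x" for x
    using out[of x] by (cases "x \<in> K") auto
  ultimately show ?thesis by (simp only:)
qed

text \<open>Open boxes are stable under intersection and generate the Borel sets, so Dynkin's
  argument extends the vanishing to all of them. The whole space is not a box; its integral is a
  separate hypothesis, used for complements.\<close>

lemma integrable_box_integrals_zero:
  fixes g :: "'a::euclidean_space \<Rightarrow> real"
  assumes g: "integrable lborel g" and zero: "\<And>a b. (LINT x:box a b|lborel. g x) = 0"
    and total: "(LINT x|lborel. g x) = 0"
  shows "AE x in lborel. g x = 0"
proof (rule sigma_finite_measure.density_zero[OF sigma_finite_lborel g])
  have si: "set_integrable lborel A g" if "A \<in> sets borel" for A
    using integrable_mult_indicator[OF _ g] that by (simp add: set_integrable_def)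
  fix A :: "'a set" assume "A \<in> sets lborel"
  then have A: "A \<in> sigma_sets UNIV (range (\<lambda>(a, b). box a b))"
    by (simp add: borel_eq_box)
  have sets: "sigma_sets UNIV (range (\<lambda>(a, b). box a b :: 'a set)) = sets borel"
    unfolding borel_eq_box by simp
  have "Int_stable (range (\<lambda>(a, b). box a b :: 'a set))"
    unfolding Int_stable_def by (auto simp: box_Int_box)
  moreover have "range (\<lambda>(a, b). box a b :: 'a set) \<subseteq> Pow UNIV" by simp
  ultimately show "(LINT x:A|lborel. g x) = 0"
    using A
  proof (induction rule: sigma_sets_induct_disjoint)
    case (basic A)
    then show ?case using zero by auto
  next
    case (compl A)
    then have A: "A \<in> sets borel" unfolding sets by simp
    have "(LINT x:UNIV|lborel. g x) = (LINT x:A|lborel. g x) + (LINT x:UNIV - A|lborel. g x)"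
      using set_integral_Un[OF _ si[OF A] si[of "UNIV - A"]] A by simp
    then show ?case using compl total by (simp add: set_lebesgue_integral_def)
  next
    case (union A)
    then have "range A \<subseteq> sets borel" unfolding sets by simp
    then have "(LINT x:(\<Union>i. A i)|lborel. g x) = (\<Sum>i. (LINT x:(A i)|lborel. g x))"
      using union(1) by (intro lebesgue_integral_countable_add si) (auto simp: disjoint_family_on_def)
    then show ?case using union(3) by simp
  qed (auto simp: set_lebesgue_integral_def)
qed

text \<open>Dominated convergence passes from bumps to indicators of boxes. As \<open>f\<close> is
  only locally integrable, the measure-theoretic argument is run on its truncations to growing
  boxes.\<close>

lemma Cc_infinity_separates:
  fixes f :: "'a::euclidean_space \<Rightarrow> real"
  assumes f: "locally_integrable f"
    and zero: "\<And>\<phi> :: 'a \<Rightarrow> real. \<phi> \<in> Cc_infinity \<Longrightarrow> (LINT x|lebesgue. \<phi> x * f x) = 0"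
  shows "AE x in lebesgue. f x = 0"
proof -
  have si: "integrable lebesgue (\<lambda>x. indicator K x * f x)" if "compact K" for K
    using f that by (auto simp: locally_integrable_def set_integrable_def)
  have box: "(LINT x|lebesgue. indicator (box a b) x * f x) = 0" for a b
  proof -
    have "(\<lambda>m. LINT x|lebesgue. box_bump a b m x * f x) \<longlonglongrightarrow> (LINT x|lebesgue. indicator (box a b) x * f x)"
    proof (rule integral_dominated_convergence[where w="\<lambda>x. norm (indicator (cbox a b) x * f x)"])
      have "integrable lebesgue (\<lambda>x. box_bump a b m x *\<^sub>R f x)" for m
        by (rule locally_integrable_scaleR_Cc0[OF f Cc_infinity_subset_Cc0[OF box_bump_Cc_infinity]])
      then show meas: "(\<lambda>x. box_bump a b m x * f x) \<in> borel_measurable lebesgue" for m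
        using borel_measurable_integrable by fastforce
      show lim: "AE x in lebesgue. (\<lambda>m. box_bump a b m x * f x) \<longlonglongrightarrow> indicator (box a b) x * f x"
        by (intro AE_I2 tendsto_mult box_bump_tendsto tendsto_const)
      show "(\<lambda>x. indicator (box a b) x * f x) \<in> borel_measurable lebesgue"
        by (rule borel_measurable_LIMSEQ_real[where u="\<lambda>m x. box_bump a b m x * f x", OF _ meas]) (intro tendsto_mult box_bump_tendsto tendsto_const)
      show "integrable lebesgue (\<lambda>x. norm (indicator (cbox a b) x * f x))"
        by (intro integrable_norm si compact_cbox)
      have "norm (box_bump a b m x * f x) \<le> norm (indicator (cbox a b) x * f x)" for m x
      proof (cases "x \<in> box a b")
        case True
        then have "x \<in> cbox a b" using box_subset_cbox by blast
        then show ?thesis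
          using box_bump_bounds[of a b m x] by (simp add: abs_mult mult_left_le_one_le)
      qed (simp add: box_bump_outside)
      then show "AE x in lebesgue. norm (box_bump a b m x * f x) \<le> norm (indicator (cbox a b) x * f x)" for m
        by (intro AE_I2)
    qed
    moreover have "(LINT x|lebesgue. box_bump a b m x * f x) = 0" for m
      by (rule zero[OF box_bump_Cc_infinity])
    ultimately show ?thesis using LIMSEQ_unique[OF _ tendsto_const[of 0]] by simp
  qed
  have "AE x in lebesgue. indicator (box (- (real n *\<^sub>R One)) (real n *\<^sub>R One)) x * f x = 0" for n
  proof -
    define R where "R = (box (- (real n *\<^sub>R One)) (real n *\<^sub>R One) :: 'a set)"
    have "integrable lebesgue (\<lambda>x. indicator R x *\<^sub>R (indicator (cbox (- (real n *\<^sub>R One)) (real n *\<^sub>R One)) x * f x))"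
      by (rule integrable_mult_indicator[OF _ si[OF compact_cbox]]) (simp add: R_def)
    moreover have "indicator R x *\<^sub>R (indicator (cbox (- (real n *\<^sub>R One)) (real n *\<^sub>R One)) x * f x) = indicator R x * f x" for x
      unfolding R_def using box_subset_cbox[of "- (real n *\<^sub>R One)" "real n *\<^sub>R One :: 'a"] by (auto simp: indicator_def)
    ultimately have int: "integrable lebesgue (\<lambda>x. indicator R x * f x)" by (simp only:)
    \<comment> \<open>Boxes generate only the Borel sets, so the truncation is replaced by a Borel
      function equal to it almost everywhere.\<close>
    obtain g where g[measurable]: "g \<in> borel_measurable lborel" and ae: "AE x in lborel. indicator R x * f x = g x"
      using completion_ex_borel_measurable_real[OF borel_measurable_integrable[OF int]] by blast
    have ae': "AE x in lebesgue. indicator R x * f x = g x"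
      using ae by (rule AE_completion)
    have g_leb: "g \<in> borel_measurable lebesgue" by (rule measurable_completion[OF g])
    have "integrable lebesgue g"
      using integrable_cong_AE[OF borel_measurable_integrable[OF int] g_leb ae'] int by simp
    then have g_int: "integrable lborel g" by (simp add: integrable_completion[OF g])
    have "AE x in lborel. g x = 0"
    proof (rule integrable_box_integrals_zero[OF g_int])
      have "(LINT x|lborel. g x) = (LINT x|lebesgue. g x)" by (rule integral_completion[OF g, symmetric])
      also have "\<dots> = (LINT x|lebesgue. indicator R x * f x)"
        by (rule integral_cong_AE[OF g_leb borel_measurable_integrable[OF int]]) (use ae' in auto)
      also have "\<dots> = 0" unfolding R_def by (rule box)
      finally show "(LINT x|lborel. g x) = 0" .
      fix a b :: 'a
      have m: "(\<lambda>x. indicator (box a b) x * g x) \<in> borel_measurable lborel" by simp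
      \<comment> \<open>The truncation set is itself a box, so integrals of the truncated function
        over boxes are integrals of \<open>f\<close> over boxes.\<close>
      obtain c d where cd: "box a b \<inter> R = box c d" unfolding R_def box_Int_box by blast
      have "(LINT x:box a b|lborel. g x) = (LINT x|lebesgue. indicator (box a b) x * g x)"
        unfolding set_lebesgue_integral_def using integral_completion[OF m] by simp
      also have "\<dots> = (LINT x|lebesgue. indicator (box a b) x * (indicator R x * f x))"
      proof (rule integral_cong_AE)
        show "(\<lambda>x. indicator (box a b) x * (indicator R x * f x)) \<in> borel_measurable lebesgue"
          by (intro borel_measurable_times borel_measurable_indicator borel_measurable_integrable[OF int]) simp
      qed (use ae' measurable_completion[OF m] in auto)
      also have "\<dots> = (LINT x|lebesgue. indicator (box c d) x * f x)"
        unfolding cd[symmetric] by (simp add: indicator_inter_arith mult.assoc)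
      also have "\<dots> = 0" by (rule box)
      finally show "(LINT x:box a b|lborel. g x) = 0" .
    qed
    then have "AE x in lebesgue. g x = 0" by (rule AE_completion)
    with ae' show "AE x in lebesgue. indicator (box (- (real n *\<^sub>R One)) (real n *\<^sub>R One)) x * f x = 0"
      unfolding R_def by eventually_elim simp
  qed
  then have "AE x in lebesgue. \<forall>n. indicator (box (- (real n *\<^sub>R One)) (real n *\<^sub>R One)) x * f x = 0"
    unfolding AE_all_countable by blast
  then show ?thesis
  proof eventually_elim
    case (elim x)
    obtain n where n: "norm x < real n" using reals_Archimedean2 by blast
    have "x \<in> box (- (real n *\<^sub>R One)) (real n *\<^sub>R One)"
      unfolding mem_box
    proof
      fix i :: 'a assume i: "i \<in> Basis"
      show "- (real n *\<^sub>R One) \<bullet> i < x \<bullet> i \<and> x \<bullet> i < real n *\<^sub>R One \<bullet> i"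
        using Basis_le_norm[OF i, of x] n i by (simp add: abs_le_iff)
    qed
    with elim[rule_format, of n] show ?case by simp
  qed
qed

section \<open>Change of variables along the flow\<close>

text \<open>The mean value inequality bounds the difference quotients by \<open>w\<close>, so
  dominated convergence applies along every sequence tending to 0.\<close>

lemma has_real_derivative_integral:
  fixes e :: "real \<Rightarrow> 'a \<Rightarrow> real"
  assumes int: "\<And>t. \<bar>t - t0\<bar> \<le> 1 \<Longrightarrow> integrable M (e t)"
    and der: "\<And>x t. \<bar>t - t0\<bar> \<le> 1 \<Longrightarrow> ((\<lambda>t. e t x) has_real_derivative e' t x) (at t)"
    and bd: "\<And>x t. \<bar>t - t0\<bar> \<le> 1 \<Longrightarrow> \<bar>e' t x\<bar> \<le> w x" and w: "integrable M w"
  shows "((\<lambda>t. LINT x|M. e t x) has_real_derivative (LINT x|M. e' t0 x)) (at t0)"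
  unfolding DERIV_def tendsto_at_iff_sequentially
proof (intro allI impI)
  fix X :: "nat \<Rightarrow> real" assume X: "\<forall>i. X i \<in> UNIV - {0}" "X \<longlonglongrightarrow> 0"
  have "\<forall>\<^sub>F n in sequentially. dist (X n) 0 < 1" using tendstoD[OF X(2), of 1] by simp
  then obtain N where N: "\<And>n. N \<le> n \<Longrightarrow> \<bar>X n\<bar> \<le> 1"
    unfolding eventually_sequentially by (force simp: dist_real_def)
  \<comment> \<open>Dropping finitely many terms keeps \<open>t0 + Y n\<close> in the window where
    the hypotheses hold.\<close>
  define Y where "Y = (\<lambda>n. X (n + N))"
  have Y: "Y n \<noteq> 0" "\<bar>Y n\<bar> \<le> 1" for n using X(1) N[of "n + N"] by (auto simp: Y_def)
  have Y0: "Y \<longlonglongrightarrow> 0" unfolding Y_def by (rule LIMSEQ_ignore_initial_segment[OF X(2)])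
  define q where "q = (\<lambda>n x. (e (t0 + Y n) x - e t0 x) / Y n)"
  have q_int: "integrable M (q n)" for n
    unfolding q_def using Y(2)[of n] by (intro integrable_divide_zero Bochner_Integration.integrable_diff int) auto
  have q_lim: "(\<lambda>n. q n x) \<longlonglongrightarrow> e' t0 x" for x
  proof -
    have "((\<lambda>h. (e (t0 + h) x - e t0 x) / h) \<longlongrightarrow> e' t0 x) (at 0)"
      using der[of t0 x] by (simp add: DERIV_def)
    moreover have "filterlim Y (at 0) sequentially"
      using Y0 Y(1) by (simp add: filterlim_at)
    ultimately show ?thesis unfolding q_def by (rule filterlim_compose)
  qed
  have q_bd: "\<bar>q n x\<bar> \<le> w x" for n x
  proof -
    have "norm (e (t0 + Y n) x - e t0 x) \<le> w x * norm (t0 + Y n - t0)"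
    proof (rule field_differentiable_bound[where S="{t0 - 1..t0 + 1}" and f'="\<lambda>t. e' t x"])
      fix t assume "t \<in> {t0 - 1..t0 + 1}"
      then have t: "\<bar>t - t0\<bar> \<le> 1" by (auto simp: abs_le_iff)
      show "((\<lambda>t. e t x) has_field_derivative e' t x) (at t within {t0 - 1..t0 + 1})"
        by (rule has_field_derivative_at_within[OF der[OF t]])
      show "norm (e' t x) \<le> w x" using bd[OF t] by simp
    qed (use Y(2)[of n] in \<open>auto simp: abs_le_iff\<close>)
    then show ?thesis
      using Y(1)[of n] by (simp add: q_def abs_divide divide_le_eq)
  qed
  have "(\<lambda>n. LINT x|M. q n x) \<longlonglongrightarrow> (LINT x|M. e' t0 x)"
  proof (rule integral_dominated_convergence[where w=w])
    \<comment> \<open>Measurability of the derivative is inherited from the difference quotients, of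
      which it is the limit.\<close>
    show "e' t0 \<in> borel_measurable M"
      by (rule borel_measurable_LIMSEQ_real[where u=q, OF q_lim borel_measurable_integrable[OF q_int]])
  qed (use q_lim q_bd w borel_measurable_integrable[OF q_int] in auto)
  moreover have "(LINT x|M. q n x) = ((LINT x|M. e (t0 + Y n) x) - (LINT x|M. e t0 x)) / Y n" for n
  proof -
    have "integrable M (e (t0 + Y n))" "integrable M (e t0)" using Y(2)[of n] by (auto intro!: int)
    then show ?thesis unfolding q_def by simp
  qed
  ultimately have "(\<lambda>n. ((LINT x|M. e (t0 + X (n + N)) x) - (LINT x|M. e t0 x)) / X (n + N)) \<longlonglongrightarrow> (LINT x|M. e' t0 x)"
    by (simp add: Y_def)
  then show "((\<lambda>h. ((LINT x|M. e (t0 + h) x) - (LINT x|M. e t0 x)) / h) \<circ> X) \<longlonglongrightarrow> (LINT x|M. e' t0 x)"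
    unfolding o_def by (rule LIMSEQ_offset)
qed

lemma integrable_bounded_support:
  fixes f :: "'a::euclidean_space \<Rightarrow> 'b::{banach, second_countable_topology}"
  assumes "continuous_on UNIV f" "\<And>x. r < norm x \<Longrightarrow> f x = 0"
  shows "integrable lborel f"
proof -
  have "integrable lborel (\<lambda>x. indicator (cball 0 r) x *\<^sub>R f x)"
    by (rule borel_integrable_compact[OF compact_cball continuous_on_subset[OF assms(1)]]) simp
  moreover have "indicator (cball 0 r) x *\<^sub>R f x = f x" for x
    using assms(2)[of x] by (cases "norm x \<le> r") (auto simp: indicator_def)
  ultimately show ?thesis by (simp only:)
qed

lemma integrable_cball_const: "integrable lborel (\<lambda>x :: 'a::euclidean_space. (C::real) * indicator (cball 0 r) x)"
  using borel_integrable_compact[of "cball 0 r" "\<lambda>_. C"] by (simp add: mult.commute)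

lemma compactly_supported_bounded:
  fixes f :: "'a::euclidean_space \<Rightarrow> 'b::real_normed_vector"
  assumes "compactly_supported f"
  shows "\<exists>r\<ge>0. \<forall>x. r < norm x \<longrightarrow> x \<notin> closure {x. f x \<noteq> 0}"
proof -
  have "bounded (closure {x. f x \<noteq> 0})"
    using assms compact_imp_bounded by (auto simp: compactly_supported_def)
  then obtain r where "\<forall>x\<in>closure {x. f x \<noteq> 0}. norm x \<le> r" unfolding bounded_iff by blast
  then show ?thesis by (intro exI[of _ "max r 0"]) force
qed

text \<open>The integral of \<open>f (x + t v)\<close> does not depend on \<open>t\<close>.\<close>

lemma integral_derivative_zero:
  fixes f :: "'a::euclidean_space \<Rightarrow> real"
  assumes f: "C_kt (Suc 0) (\<lambda>_. f)" and r: "\<And>x. r < norm x \<Longrightarrow> x \<notin> closure {x. f x \<noteq> 0}"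
  shows "integrable lborel (\<lambda>x. frechet_derivative f (at x) v)"
    and "(LINT x|lborel. frechet_derivative f (at x) v) = 0"
proof -
  define f' where "f' = (\<lambda>x. frechet_derivative f (at x) v)"
  have f_cont: "continuous_on UNIV f" using C_kt_imp_C_k[OF C_kt_Suc_imp[OF f]] by simp
  have f'_cont: "continuous_on UNIV f'"
    unfolding f'_def using C_kt_imp_C_k[OF C_kt_frechet[OF f]] by simp
  have f_out: "f x = 0" if "r < norm x" for x
    using r[OF that] closure_subset[of "{x. f x \<noteq> 0}"] by blast
  have f'_out: "f' x = 0" if "r < norm x" for x
    unfolding f'_def frechet_derivative_outside_support[OF r[OF that]] by simp
  show int': "integrable lborel (\<lambda>x. frechet_derivative f (at x) v)"
    using integrable_bounded_support[OF f'_cont f'_out] by (simp add: f'_def)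
  obtain C where C: "0 \<le> C" "\<And>x. norm (f' x) \<le> C"
    using continuous_compact_support_bounded[OF f'_cont compact_cball[of 0 r]] f'_out by force
  have shift: "continuous_on UNIV (\<lambda>x. x + t *\<^sub>R v)" for t
    by (intro continuous_intros)
  have far: "r < norm (x + t *\<^sub>R v)" if "r + \<bar>t\<bar> * norm v < norm x" for x t
    using norm_triangle_ineq4[of "x + t *\<^sub>R v" "t *\<^sub>R v"] that by simp
  have "((\<lambda>t. LINT x|lborel. f (x + t *\<^sub>R v)) has_real_derivative (LINT x|lborel. f' (x + 0 *\<^sub>R v))) (at 0)"
  proof (rule has_real_derivative_integral[where w="\<lambda>x. C * indicator (cball 0 (r + norm v)) x"])
    show "integrable lborel (\<lambda>x. f (x + t *\<^sub>R v))" for t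
      by (rule integrable_bounded_support[where r="r + \<bar>t\<bar> * norm v", OF continuous_on_compose2[OF f_cont shift]])
        (use f_out[OF far] in auto)
    show "((\<lambda>t. f (x + t *\<^sub>R v)) has_real_derivative f' (x + t *\<^sub>R v)) (at t)" for x t
      unfolding f'_def by (rule DERIV_along_line[OF C_kt_has_derivative[OF f]])
    show "\<bar>f' (x + t *\<^sub>R v)\<bar> \<le> C * indicator (cball 0 (r + norm v)) x" if "\<bar>t - 0\<bar> \<le> 1" for x t
    proof (cases "x \<in> cball 0 (r + norm v)")
      case False
      then have "r + norm v < norm x" by simp
      moreover have "\<bar>t\<bar> * norm v \<le> 1 * norm v" using that by (intro mult_right_mono) auto
      ultimately have "f' (x + t *\<^sub>R v) = 0" by (intro f'_out far) linarith
      then show ?thesis using C(1) by simp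
    qed (use C(2)[of "x + t *\<^sub>R v"] in simp)
    show "integrable lborel (\<lambda>x. C * indicator (cball 0 (r + norm v)) x)"
      by (rule integrable_cball_const)
  qed
  moreover have "(LINT x|lborel. f (x + t *\<^sub>R v)) = (LINT x|lborel. f x)" for t
  proof -
    have "(LINT x|lborel. f x) = (LINT x|distr lborel borel ((+) (t *\<^sub>R v)). f x)"
      by (simp only: lborel_distr_plus)
    also have "\<dots> = (LINT x|lborel. f (t *\<^sub>R v + x))"
      by (rule integral_distr) (use borel_measurable_continuous_onI[OF f_cont] in auto)
    finally show ?thesis by (simp add: add.commute)
  qed
  ultimately have "((\<lambda>t::real. LINT x|lborel. f x) has_real_derivative (LINT x|lborel. f' x)) (at 0)"
    by simp
  then show "(LINT x|lborel. frechet_derivative f (at x) v) = 0"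
    unfolding f'_def[symmetric] using DERIV_unique[OF _ DERIV_const] by blast
qed

section \<open>Transport of Lebesgue measure by the flow\<close>

context smooth_flow
begin

definition J :: "real \<Rightarrow> real^'n \<Rightarrow> real" where "J t x = exp (\<Phi> t x)"

lemma J_pos: "0 < J t x" and J_0: "J 0 x = 1"
  by (simp_all add: J_def Phi_0)

lemma J_smooth: "C_kt k J"
  using C_kt_compose[OF C_kt_exp Phi_smooth] by (simp add: J_def[abs_def])

lemma J_ode: "((\<lambda>s. J s x) has_real_derivative J t x * divergence \<xi> (T t x)) (at t)"
  unfolding J_def
  by (rule DERIV_fun_exp) (simp add: has_real_derivative_iff_has_vector_derivative Phi_ode)

lemma J_add: "J (t + s) x = J t (T s x) * J s x"
  by (simp add: J_def Phi_add exp_add)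

lemma J_bounded: "\<exists>C\<ge>0. \<forall>t x. \<bar>t\<bar> \<le> H \<longrightarrow> J t x \<le> C \<and> inverse (J t x) \<le> C"
proof -
  obtain C where C: "\<And>t x. \<bar>t\<bar> \<le> H \<Longrightarrow> \<bar>\<Phi> t x\<bar> \<le> C" using Phi_bounded by blast
  have "J t x \<le> exp C \<and> inverse (J t x) \<le> exp C" if "\<bar>t\<bar> \<le> H" for t x
    using C[OF that, of x] by (simp add: J_def exp_minus[symmetric] abs_le_iff)
  then show ?thesis by (intro exI[of _ "exp C"]) auto
qed

text \<open>Speed is bounded by the supremum of the norm of \<open>\<xi>\<close>; this is Gronwall's
  inequality with \<open>K = 0\<close>.\<close>

lemma T_displacement: "\<exists>C\<ge>0. \<forall>t x. \<bar>t\<bar> \<le> H \<longrightarrow> norm (T t x - x) \<le> C"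
proof -
  have "continuous_on UNIV \<xi>" using xi_smooth(1)[of 0] by simp
  moreover have "\<xi> x = 0" if "x \<notin> closure {x. \<xi> x \<noteq> 0}" for x
    using that closure_subset[of "{x. \<xi> x \<noteq> 0}"] by blast
  ultimately obtain G where G: "0 \<le> G" "\<And>x. norm (\<xi> x) \<le> G"
    using continuous_compact_support_bounded[OF _ compact_support] by blast
  have "norm (T t x - x) \<le> exp ((2 * 0 + 1) * \<bar>H\<bar>) * (1 + \<bar>H\<bar>) * (norm (T 0 x - x) + G)" if "\<bar>t\<bar> \<le> H" for t x
  proof (rule gronwall[where r="\<lambda>t. T t x - x" and r'="\<lambda>t. \<xi> (T t x)"])
    show "((\<lambda>t. T t x - x) has_vector_derivative \<xi> (T s x)) (at s)" for s
      using has_vector_derivative_diff[OF T_ode has_vector_derivative_const[of x]] by simp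
  qed (use G that in auto)
  then show ?thesis
    using G(1) by (intro exI[of _ "exp ((2 * 0 + 1) * \<bar>H\<bar>) * (1 + \<bar>H\<bar>) * G"]) auto
qed

text \<open>One radius for a whole time interval is what domination under the integral sign
  requires.\<close>

lemma transported_support:
  assumes "compactly_supported f"
  shows "\<exists>r\<ge>0. \<forall>t x. \<bar>t\<bar> \<le> H \<longrightarrow> r < norm x \<longrightarrow> T t x \<notin> closure {x. f x \<noteq> 0}"
proof -
  obtain r where r: "0 \<le> r" "\<And>x. r < norm x \<Longrightarrow> x \<notin> closure {x. f x \<noteq> 0}"
    using compactly_supported_bounded[OF assms] by blast
  obtain C where C: "0 \<le> C" "\<And>t x. \<bar>t\<bar> \<le> H \<Longrightarrow> norm (T t x - x) \<le> C" using T_displacement by blast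
  have "T t x \<notin> closure {x. f x \<noteq> 0}" if "\<bar>t\<bar> \<le> H" "r + C < norm x" for t x
    using norm_triangle_ineq2[of x "x - T t x"] C(2)[OF that(1), of x] that(2)
    by (intro r(2)) (simp add: norm_minus_commute)
  then show ?thesis using r(1) C(1) by (intro exI[of _ "r + C"]) auto
qed

lemma compactly_supported_compose_T:
  assumes "compactly_supported f"
  shows "compactly_supported (\<lambda>x. g x *\<^sub>R f (T t x))"
proof -
  obtain r where r: "\<And>x. r < norm x \<Longrightarrow> T t x \<notin> closure {x. f x \<noteq> 0}"
    using transported_support[OF assms, of "\<bar>t\<bar>"] by blast
  have *: "f (T t x) = 0" if "r < norm x" for x
    using r[OF that] closure_subset[of "{x. f x \<noteq> 0}"] by blast
  have "{x. g x *\<^sub>R f (T t x) \<noteq> 0} \<subseteq> cball 0 r"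
    using * by (auto simp: not_less[symmetric])
  then have "bounded {x. g x *\<^sub>R f (T t x) \<noteq> 0}" using bounded_cball bounded_subset by blast
  then show ?thesis unfolding compactly_supported_def compact_eq_bounded_closed by (simp add: bounded_closure)
qed

text \<open>\<open>q\<close> is the divergence of \<open>f \<xi>\<close>. Only one order of
  smoothness is asked of \<open>f\<close>, and no compact support, so that the rule applies both to
  a test function and to its transported density.\<close>

lemma transport_density_derivative:
  assumes f: "C_kt (Suc 0) (\<lambda>_. f)"
  defines "q \<equiv> \<lambda>y. grad f y \<bullet> \<xi> y + f y * divergence \<xi> y"
  shows "((\<lambda>t. f (T t x) * J t x) has_real_derivative q (T t x) * J t x) (at t)"
proof -
  have diff: "f differentiable (at y)" for y using f by simp
  have "((\<lambda>t. f (T t x)) has_vector_derivative frechet_derivative f (at (T t x)) (\<xi> (T t x))) (at t)"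
    using vector_derivative_diff_chain_within[OF T_ode[of x t]
        has_derivative_at_withinI[OF diff[unfolded frechet_derivative_works]]]
    by (simp add: o_def)
  then have "((\<lambda>t. f (T t x)) has_real_derivative grad f (T t x) \<bullet> \<xi> (T t x)) (at t)"
    by (simp add: has_real_derivative_iff_has_vector_derivative frechet_derivative_eq_grad[OF diff])
  from DERIV_mult[OF this J_ode] show ?thesis by (simp add: q_def algebra_simps)
qed

lemma transported_integral_invariant:
  fixes f :: "real^'n \<Rightarrow> real"
  assumes f: "f \<in> Cc_infinity"
  shows "integrable lborel (\<lambda>x. f (T t x) * J t x)"
    and "(LINT x|lborel. f (T t x) * J t x) = (LINT x|lborel. f x)"
proof -
  have fs: "C_kt k (\<lambda>_. f)" for k
    using f by (simp add: Cc_infinity_def C_k_iff_C_kt)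
  have cs: "compactly_supported f"
    using f by (simp add: Cc_infinity_def)
  have supp: "compact (closure {x. f x \<noteq> 0})" using cs by (simp add: compactly_supported_def)
  define q where "q = (\<lambda>y. grad f y \<bullet> \<xi> y + f y * divergence \<xi> y)"
  have q_smooth: "C_kt 0 (\<lambda>_. q)"
    unfolding q_def
    by (intro C_kt_add C_kt_bilinear[OF bounded_bilinear_inner] C_kt_bilinear[OF bounded_bilinear_mult]
        C_kt_grad fs xi_smooth divergence_smooth)
  have q_cont: "continuous_on UNIV q" using C_kt_imp_C_k[OF q_smooth] by simp
  have f_out: "f x = 0" if "x \<notin> closure {x. f x \<noteq> 0}" for x
    using that closure_subset[of "{x. f x \<noteq> 0}"] by blast
  have q_out: "q x = 0" if "x \<notin> closure {x. f x \<noteq> 0}" for x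
    using frechet_derivative_outside_support[OF that] f_out[OF that] by (simp add: q_def grad_def inner_vec_def)
  obtain Q where Q: "0 \<le> Q" "\<And>x. norm (q x) \<le> Q"
    using continuous_compact_support_bounded[OF q_cont supp q_out] by blast
  define \<rho> where "\<rho> = (\<lambda>t x. f (T t x) * J t x)"
  have \<rho>: "C_kt k \<rho>" for k
    unfolding \<rho>_def by (rule C_kt_bilinear[OF bounded_bilinear_mult C_kt_compose[OF fs T_smooth] J_smooth])
  have \<rho>_der: "((\<lambda>t. \<rho> t x) has_real_derivative q (T t x) * J t x) (at t)" for t x
    unfolding \<rho>_def q_def by (rule transport_density_derivative[OF fs])
  have int: "integrable lborel (\<rho> t)" for t
  proof -
    obtain r where r: "\<And>x. r < norm x \<Longrightarrow> T t x \<notin> closure {x. f x \<noteq> 0}"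
      using transported_support[OF cs, of "\<bar>t\<bar>"] by blast
    show ?thesis
    proof (rule integrable_bounded_support)
      show "continuous_on UNIV (\<rho> t)" using C_kt_imp_C_k[OF \<rho>[of 0], of t] by simp
      show "\<rho> t x = 0" if "r < norm x" for x unfolding \<rho>_def by (simp only: f_out[OF r[OF that]] mult_zero_left)
    qed
  qed
  then show "integrable lborel (\<lambda>x. f (T t x) * J t x)" by (simp add: \<rho>_def)
  have "((\<lambda>t. LINT x|lborel. \<rho> t x) has_real_derivative (LINT x|lborel. q (T t0 x) * J t0 x)) (at t0)" for t0
  proof -
    obtain r where r: "\<And>t x. \<bar>t\<bar> \<le> \<bar>t0\<bar> + 1 \<Longrightarrow> r < norm x \<Longrightarrow> T t x \<notin> closure {x. f x \<noteq> 0}"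
      using transported_support[OF cs, of "\<bar>t0\<bar> + 1"] by blast
    obtain C where C: "0 \<le> C" "\<And>t x. \<bar>t\<bar> \<le> \<bar>t0\<bar> + 1 \<Longrightarrow> J t x \<le> C" using J_bounded by blast
    show ?thesis
    proof (rule has_real_derivative_integral[where w="\<lambda>x. (Q * C) * indicator (cball 0 r) x"])
      fix x t assume "\<bar>t - t0\<bar> \<le> 1"
      then have t: "\<bar>t\<bar> \<le> \<bar>t0\<bar> + 1" by linarith
      show "\<bar>q (T t x) * J t x\<bar> \<le> (Q * C) * indicator (cball 0 r) x"
      proof (cases "x \<in> cball 0 r")
        case True
        have "\<bar>q (T t x)\<bar> * J t x \<le> Q * C"
          using Q C(2)[OF t] J_pos[of t x] by (intro mult_mono) (auto simp: less_imp_le)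
        then show ?thesis using True J_pos[of t x] by (simp add: abs_mult)
      next
        case False
        then have "q (T t x) = 0" using r[OF t, of x] q_out by simp
        then show ?thesis using Q C by simp
      qed
    next
      show "integrable lborel (\<lambda>x. (Q * C) * indicator (cball 0 r) x)"
        by (rule integrable_cball_const)
    qed (use int \<rho>_der in auto)
  qed
  moreover have "(LINT x|lborel. q (T t x) * J t x) = 0" for t
  proof -
    have \<rho>_diff: "\<rho> t differentiable (at x)" for x using \<rho>[of "Suc 0"] by simp
    \<comment> \<open>The time derivative is computed a second time, now from
      \<open>\<rho> (t + s) x = \<rho> t (T s x) * J s x\<close> at \<open>s = 0\<close>. This
      replaces a derivative of \<open>f\<close> at \<open>T t x\<close> by spatial derivatives of
      \<open>\<rho> t\<close> at \<open>x\<close>.\<close>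
    have der_eq: "q (T t x) * J t x = frechet_derivative (\<rho> t) (at x) (\<xi> x) + \<rho> t x * divergence \<xi> x" for x
    proof -
      have add: "\<rho> (t + s) x = \<rho> t (T s x) * J s x" for s
        by (simp add: \<rho>_def T_add J_add)
      have "((\<lambda>s. \<rho> t (T s x) * J s x) has_real_derivative
          (grad (\<rho> t) (T 0 x) \<bullet> \<xi> (T 0 x) + \<rho> t (T 0 x) * divergence \<xi> (T 0 x)) * J 0 x) (at 0)"
        by (rule transport_density_derivative) (use \<rho>[of "Suc 0"] C_kt_imp_C_k C_k_iff_C_kt in blast)
      moreover have "((\<lambda>s. \<rho> (t + s) x) has_real_derivative q (T t x) * J t x) (at 0)"
        using DERIV_shift[of "\<lambda>s. \<rho> s x" "q (T t x) * J t x" 0 t] \<rho>_der[of x t] by (simp add: add.commute)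
      ultimately show ?thesis
        unfolding add using DERIV_unique by (fastforce simp: J_0 frechet_derivative_eq_grad[OF \<rho>_diff])
    qed
    \<comment> \<open>Components of \<open>\<rho> t\<close> times \<open>\<xi>\<close>: the
      derivative is the divergence of this field, and each partial derivative integrates to
      0.\<close>
    define g where "g = (\<lambda>i x. \<rho> t x * \<xi> x $ i)"
    have g: "C_kt (Suc 0) (\<lambda>_. g i)" for i
      unfolding g_def
      by (rule C_kt_bilinear[OF bounded_bilinear_mult _ C_kt_bounded_linear[OF bounded_linear_vec_nth xi_smooth(2)]])
        (use \<rho>[of "Suc 0"] C_kt_imp_C_k C_k_iff_C_kt in blast)
    obtain r where r: "\<And>x. r < norm x \<Longrightarrow> x \<notin> closure {x. \<rho> t x \<noteq> 0}"
      using compactly_supported_bounded[OF compactly_supported_compose_T[OF cs, of "J t" t]]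
      by (auto simp: \<rho>_def mult.commute)
    have "closure {x. g i x \<noteq> 0} \<subseteq> closure {x. \<rho> t x \<noteq> 0}" for i
      by (intro closure_mono) (auto simp: g_def)
    then have r': "x \<notin> closure {x. g i x \<noteq> 0}" if "r < norm x" for x i
      using r[OF that] by blast
    note g_int = integral_derivative_zero[OF g r']
    have g': "partial_deriv i (g i) x
        = \<rho> t x * D\<xi> x $ i $ i + partial_deriv i (\<rho> t) x * \<xi> x $ i" for i x
    proof -
      have "(g i has_derivative (\<lambda>v. \<rho> t x * (D\<xi> x *v v) $ i + frechet_derivative (\<rho> t) (at x) v * \<xi> x $ i)) (at x)"
        unfolding g_def
        by (intro has_derivative_mult bounded_linear.has_derivative[OF bounded_linear_vec_nth] xi_derivative
            \<rho>_diff[unfolded frechet_derivative_works])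
      from frechet_derivative_at[OF this, symmetric] show ?thesis
        by (simp add: matrix_vector_mult_basis column_def)
    qed
    have "q (T t x) * J t x = (\<Sum>i\<in>UNIV. partial_deriv i (g i) x)" for x
    proof -
      have "frechet_derivative (\<rho> t) (at x) (\<xi> x) = (\<Sum>i\<in>UNIV. partial_deriv i (\<rho> t) x * \<xi> x $ i)"
        unfolding frechet_derivative_eq_grad[OF \<rho>_diff, of x "\<xi> x"] by (simp add: inner_vec_def grad_def)
      then show ?thesis
        unfolding der_eq g' by (simp add: divergence_def trace_def sum.distrib sum_distrib_left)
    qed
    then have "(LINT x|lborel. q (T t x) * J t x) = (LINT x|lborel. (\<Sum>i\<in>UNIV. partial_deriv i (g i) x))"
      by simp
    also have "\<dots> = (\<Sum>i\<in>UNIV. LINT x|lborel. partial_deriv i (g i) x)"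
      by (rule Bochner_Integration.integral_sum) (rule g_int(1))
    also have "\<dots> = 0" by (simp add: g_int(2))
    finally show ?thesis .
  qed
  ultimately have "\<forall>t. ((\<lambda>t. LINT x|lborel. \<rho> t x) has_real_derivative 0) (at t)"
    by simp
  then have "(LINT x|lborel. \<rho> t x) = (LINT x|lborel. \<rho> 0 x)"
    by (rule DERIV_isconst_all)
  then show "(LINT x|lborel. f (T t x) * J t x) = (LINT x|lborel. f x)"
    by (simp add: \<rho>_def J_0)
qed

lemma T_t_continuous: "continuous_on UNIV (T t)"
  by (rule continuous_on_slice(1)[OF T_continuous])

lemma J_t_continuous: "continuous_on UNIV (J t)"
  by (rule continuous_on_slice(1)[OF C_kt_continuous[OF J_smooth[of 0]]])

text \<open>Lebesgue measure is determined by its values on boxes, and a box is reached by monotone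
  convergence from the bumps, whose transported integrals are already known to be invariant.\<close>

lemma distr_T_lborel: "distr (density lborel (\<lambda>x. ennreal (J t x))) lborel (T t) = lborel"
proof (rule lborel_eqI[symmetric])
  have [measurable]: "T t \<in> borel_measurable borel" "J t \<in> borel_measurable borel"
    using T_t_continuous J_t_continuous by (auto intro: borel_measurable_continuous_onI)
  have [measurable]: "box_bump l u m \<in> borel_measurable borel" for l u :: "real^'n" and m
    using C_kt_imp_C_k[OF C_kt_box_bump[of 0 l u m]] by (intro borel_measurable_continuous_onI) simp
  fix l u :: "real^'n" assume lu: "\<And>b. b \<in> Basis \<Longrightarrow> l \<bullet> b \<le> u \<bullet> b"
  \<comment> \<open>Stated for a general map and weight, to be used once with \<open>T t\<close> and
    \<open>J t\<close> and once with the identity and 1.\<close>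
  have lim: "(\<lambda>m. \<integral>\<^sup>+x. ennreal (box_bump l u m (f x) * c x) \<partial>lborel) \<longlonglongrightarrow>
      (\<integral>\<^sup>+x. indicator (box l u) (f x) * ennreal (c x) \<partial>lborel)"
    if [measurable]: "f \<in> borel_measurable borel" "c \<in> borel_measurable borel" and c: "\<And>x. 0 \<le> c x"
    for f :: "real^'n \<Rightarrow> real^'n" and c :: "real^'n \<Rightarrow> real"
  proof (rule nn_integral_LIMSEQ)
    show "incseq (\<lambda>m x. ennreal (box_bump l u m (f x) * c x))"
      unfolding incseq_def le_fun_def using c by (auto intro!: ennreal_leI mult_right_mono box_bump_mono)
    have "(\<lambda>m. ennreal (box_bump l u m (f x) * c x)) \<longlonglongrightarrow> ennreal (indicator (box l u) (f x) * c x)" for x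
      by (intro tendsto_ennrealI tendsto_mult box_bump_tendsto tendsto_const)
    then show "(\<lambda>m. ennreal (box_bump l u m (f x) * c x)) \<longlonglongrightarrow> indicator (box l u) (f x) * ennreal (c x)" for x
      using c by (simp add: ennreal_mult ennreal_indicator)
  qed measurable
  have 1: "(\<lambda>m. \<integral>\<^sup>+x. ennreal (box_bump l u m (T t x) * J t x) \<partial>lborel) \<longlonglongrightarrow>
      (\<integral>\<^sup>+x. indicator (box l u) (T t x) * ennreal (J t x) \<partial>lborel)"
    by (rule lim) (simp_all add: J_pos less_imp_le)
  have 2: "(\<lambda>m. \<integral>\<^sup>+x. ennreal (box_bump l u m x * 1) \<partial>lborel) \<longlonglongrightarrow>
      (\<integral>\<^sup>+x. indicator (box l u) x * ennreal 1 \<partial>lborel)"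
    by (rule lim) simp_all
  have eq: "(\<integral>\<^sup>+x. ennreal (box_bump l u m (T t x) * J t x) \<partial>lborel) = (\<integral>\<^sup>+x. ennreal (box_bump l u m x * 1) \<partial>lborel)" for m
  proof -
    note inv = transported_integral_invariant[OF box_bump_Cc_infinity[of l u m]]
    have "(\<integral>\<^sup>+x. ennreal (box_bump l u m (T t x) * J t x) \<partial>lborel) = ennreal (LINT x|lborel. box_bump l u m (T t x) * J t x)"
      by (intro nn_integral_eq_integral inv(1) AE_I2 mult_nonneg_nonneg box_bump_bounds(1) less_imp_le[OF J_pos])
    also have "\<dots> = ennreal (LINT x|lborel. box_bump l u m x)" by (simp add: inv(2))
    also have "\<dots> = (\<integral>\<^sup>+x. ennreal (box_bump l u m x * 1) \<partial>lborel)"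
      using inv(1)[of 0] box_bump_bounds(1) by (subst nn_integral_eq_integral) (auto simp: J_0 intro!: AE_I2)
    finally show ?thesis .
  qed
  have "(\<integral>\<^sup>+x. indicator (box l u) (T t x) * ennreal (J t x) \<partial>lborel) = (\<integral>\<^sup>+x. indicator (box l u) x * ennreal 1 \<partial>lborel)"
    by (rule LIMSEQ_unique[OF 1[unfolded eq] 2])
  moreover have "emeasure (distr (density lborel (\<lambda>x. ennreal (J t x))) lborel (T t)) (box l u)
      = (\<integral>\<^sup>+x. indicator (box l u) (T t x) * ennreal (J t x) \<partial>lborel)"
  proof -
    have "T t -` box l u \<in> sets borel" using measurable_sets_borel[of "T t" borel "box l u"] by simp
    then show ?thesis
      by (subst emeasure_distr) (auto simp: emeasure_density intro!: nn_integral_cong split: split_indicator)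
  qed
  ultimately have "emeasure (distr (density lborel (\<lambda>x. ennreal (J t x))) lborel (T t)) (box l u) = emeasure lborel (box l u)"
    by simp
  then show "emeasure (distr (density lborel (\<lambda>x. ennreal (J t x))) lborel (T t)) (box l u) = (\<Prod>b\<in>Basis. (u - l) \<bullet> b)"
    using lu by simp
qed simp

text \<open>Passing to the completion requires preimages of null sets to be null. This holds because
  the strictly positive density \<open>J t\<close> does not change the null sets.\<close>

lemma T_lebesgue_measurable: "T t \<in> lebesgue \<rightarrow>\<^sub>M lebesgue"
  and distr_T_lebesgue: "distr (density lebesgue (\<lambda>x. ennreal (J t x))) lebesgue (T t) = lebesgue"
proof -
  have [measurable]: "T t \<in> borel_measurable borel" "J t \<in> borel_measurable borel"
    using T_t_continuous J_t_continuous by (auto intro: borel_measurable_continuous_onI)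
  define M where "M = density lborel (\<lambda>x. ennreal (J t x))"
  have T_M: "T t \<in> M \<rightarrow>\<^sub>M lborel" by (simp add: M_def)
  have cM: "completion M = density lebesgue (\<lambda>x. ennreal (J t x))"
    unfolding M_def using J_pos by (intro completion_density_eq) auto
  have distr_cM: "distr (completion M) lborel (T t) = lborel"
    unfolding distr_completion[OF T_M] using distr_T_lborel by (simp add: M_def)
  have "null_sets lborel \<subseteq> null_sets (distr lebesgue lborel (T t))"
  proof
    fix N assume N: "N \<in> null_sets (lborel :: (real^'n) measure)"
    then have "N \<in> null_sets (distr M lborel (T t))" using distr_T_lborel by (simp add: M_def)
    then have "T t -` N \<in> null_sets M" and N': "N \<in> sets lborel"
      using null_sets_distr_iff[OF T_M, of N] by (simp_all add: M_def)
    then have "AE x in lborel. x \<notin> T t -` N" "T t -` N \<in> sets lborel"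
      using J_pos by (auto simp: M_def null_sets_density_iff ennreal_eq_0_iff not_le[symmetric])
    then have "T t -` N \<in> null_sets lborel" by (simp add: AE_iff_null_sets)
    then show "N \<in> null_sets (distr lebesgue lborel (T t))"
      unfolding distr_completion[of "T t" lborel lborel, simplified]
      using N' by (simp add: null_sets_distr_iff)
  qed
  then show "T t \<in> lebesgue \<rightarrow>\<^sub>M lebesgue"
    by (intro completion.measurable_completion2 measurable_completion) simp_all
  have "completion (distr (completion M) lborel (T t)) = distr (completion M) (completion lborel) (T t)"
    by (rule completion.completion_distr_eq) (use distr_cM T_M in \<open>auto intro: measurable_completion\<close>)
  then show "distr (density lebesgue (\<lambda>x. ennreal (J t x))) lebesgue (T t) = lebesgue"
    unfolding distr_cM unfolding cM by (rule sym)
qed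

lemma
  fixes g :: "real^'n \<Rightarrow> 'b::{banach, second_countable_topology}"
  assumes g: "g \<in> borel_measurable lebesgue"
  shows integrable_T_iff: "integrable lebesgue (\<lambda>x. J t x *\<^sub>R g (T t x)) \<longleftrightarrow> integrable lebesgue g"
    and integral_T: "(LINT x|lebesgue. J t x *\<^sub>R g (T t x)) = (LINT x|lebesgue. g x)"
proof -
  have J: "J t \<in> borel_measurable lebesgue" by (rule borel_measurable_lebesgue_continuous[OF J_t_continuous])
  have Jn: "AE x in lebesgue. 0 \<le> J t x" using J_pos by (auto simp: less_imp_le)
  have gT: "(\<lambda>x. g (T t x)) \<in> borel_measurable lebesgue"
    by (rule measurable_compose[OF T_lebesgue_measurable g])
  have T: "T t \<in> density lebesgue (\<lambda>x. ennreal (J t x)) \<rightarrow>\<^sub>M lebesgue"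
    using T_lebesgue_measurable by simp
  show "integrable lebesgue (\<lambda>x. J t x *\<^sub>R g (T t x)) \<longleftrightarrow> integrable lebesgue g"
    using integrable_distr_eq[OF T g] integrable_density[OF gT J Jn] by (simp add: distr_T_lebesgue)
  show "(LINT x|lebesgue. J t x *\<^sub>R g (T t x)) = (LINT x|lebesgue. g x)"
    using integral_distr[OF T g] integral_density[OF gT J Jn] by (simp add: distr_T_lebesgue)
qed

end

section \<open>Weak gradients of push-forwards\<close>

text \<open>The definition yields measurability only of truncations to compact sets; the function is
  their pointwise limit.\<close>

lemma locally_integrable_measurable:
  fixes f :: "'a::euclidean_space \<Rightarrow> 'b::euclidean_space"
  assumes "locally_integrable f"
  shows "f \<in> borel_measurable lebesgue"
proof (rule borel_measurable_LIMSEQ_metric[where f="\<lambda>n x. indicator (cball 0 (real n)) x *\<^sub>R f x"])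
  show "(\<lambda>x. indicator (cball 0 (real n)) x *\<^sub>R f x) \<in> borel_measurable lebesgue" for n
    using assms unfolding locally_integrable_def set_integrable_def
    by (intro borel_measurable_integrable) simp
  fix x :: 'a
  obtain N where N: "norm x \<le> real N" using real_arch_simple by blast
  have "indicator (cball 0 (real n)) x *\<^sub>R f x = f x" if "N \<le> n" for n
  proof -
    have "norm x \<le> real n" using N that by linarith
    then show ?thesis by simp
  qed
  then show "(\<lambda>n. indicator (cball 0 (real n)) x *\<^sub>R f x) \<longlonglongrightarrow> f x"
    by (intro tendsto_eventually) (auto simp: eventually_sequentially)
qed

lemma L2_locally_integrable:
  fixes f :: "'a::euclidean_space \<Rightarrow> 'b::euclidean_space"
  assumes "f \<in> L2"
  shows "locally_integrable f"
  unfolding locally_integrable_def set_integrable_def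
proof (intro allI impI)
  fix K :: "'a set" assume K: "compact K"
  have f: "f \<in> borel_measurable lebesgue" and f2: "integrable lebesgue (\<lambda>x. (norm (f x))\<^sup>2)"
    using assms by (auto simp: L2_def)
  have "integrable lborel (\<lambda>x. indicator K x *\<^sub>R (1::real))"
    by (rule borel_integrable_compact[OF K continuous_on_const])
  then have K1: "integrable lebesgue (\<lambda>x. indicator K x :: real)"
    using borel_compact[OF K] by (subst integrable_completion) auto
  show "integrable lebesgue (\<lambda>x. indicator K x *\<^sub>R f x)"
  proof (rule Bochner_Integration.integrable_bound)
    show "integrable lebesgue (\<lambda>x. indicator K x + (norm (f x))\<^sup>2)"
      by (rule Bochner_Integration.integrable_add[OF K1 f2])
    show "(\<lambda>x. indicator K x *\<^sub>R f x) \<in> borel_measurable lebesgue"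
      by (intro borel_measurable_scaleR borel_measurable_indicator f) (simp add: borel_compact[OF K])
    \<comment> \<open>Replaces the Cauchy-Schwarz inequality: on \<open>K\<close> the norm is
      dominated by 1 plus its square.\<close>
    have "y \<le> 1 + y\<^sup>2" for y :: real
      using zero_le_power2[of "y - 1 / 2"] by (simp add: power2_eq_square algebra_simps)
    then have "norm (indicator K x *\<^sub>R f x) \<le> norm (indicator K x + (norm (f x))\<^sup>2)" for x
      by (cases "x \<in> K") auto
    then show "AE x in lebesgue. norm (indicator K x *\<^sub>R f x) \<le> norm (indicator K x + (norm (f x))\<^sup>2)"
      by (rule AE_I2)
  qed
qed

lemma Cc_infinity_derivative_Cc0:
  fixes \<phi> :: "'a::euclidean_space \<Rightarrow> real"
  assumes "\<phi> \<in> Cc_infinity"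
  shows "(\<lambda>x. frechet_derivative \<phi> (at x) v) \<in> Cc0"
proof -
  have "C_k (Suc 0) \<phi>" and cs: "compact (closure {x. \<phi> x \<noteq> 0})"
    using assms by (auto simp: Cc_infinity_def compactly_supported_def simp del: C_k.simps)
  then have cont: "continuous_on UNIV (\<lambda>x. frechet_derivative \<phi> (at x) v)" by simp
  have "{x. frechet_derivative \<phi> (at x) v \<noteq> 0} \<subseteq> closure {x. \<phi> x \<noteq> 0}"
    using frechet_derivative_outside_support by fastforce
  then have "closure {x. frechet_derivative \<phi> (at x) v \<noteq> 0} \<subseteq> closure {x. \<phi> x \<noteq> 0}"
    by (rule closure_minimal) simp
  then have "compact (closure {x. frechet_derivative \<phi> (at x) v \<noteq> 0})"
    using compact_Int_closed[OF cs closed_closure, of "{x. frechet_derivative \<phi> (at x) v \<noteq> 0}"]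
    by (simp add: Int_absorb1)
  with cont show ?thesis by (simp add: Cc0_def compactly_supported_def)
qed

lemma locally_integrable_component:
  fixes f :: "'a::euclidean_space \<Rightarrow> real^'n"
  assumes "locally_integrable f"
  shows "locally_integrable (\<lambda>x. f x $ i)"
  unfolding locally_integrable_def set_integrable_def
proof (intro allI impI)
  fix K :: "'a set" assume "compact K"
  then have "integrable lebesgue (\<lambda>x. indicator K x *\<^sub>R f x)"
    using assms by (simp add: locally_integrable_def set_integrable_def)
  from integrable_bounded_linear[OF bounded_linear_vec_nth this, of i]
  show "integrable lebesgue (\<lambda>x. indicator K x *\<^sub>R f x $ i)" by simp
qed

lemma locally_integrable_diff:
  fixes f g :: "'a::euclidean_space \<Rightarrow> real"
  assumes "locally_integrable f" "locally_integrable g"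
  shows "locally_integrable (\<lambda>x. f x - g x)"
  using assms unfolding locally_integrable_def set_integrable_def
  by (simp add: right_diff_distrib)

lemma grad_pairing_integrable:
  fixes u :: "real^'n \<Rightarrow> real"
  assumes u: "locally_integrable u" and \<phi>: "\<phi> \<in> Cc_infinity"
  shows "integrable lebesgue (\<lambda>x. u x *\<^sub>R grad \<phi> x)"
proof -
  have "integrable lebesgue (\<lambda>x. \<Sum>i\<in>UNIV. (partial_deriv i \<phi> x *\<^sub>R u x) *\<^sub>R (axis i 1 :: real^'n))"
    by (intro Bochner_Integration.integrable_sum integrable_scaleR_left
        locally_integrable_scaleR_Cc0[OF u Cc_infinity_derivative_Cc0[OF \<phi>]])
  moreover have "(\<Sum>i\<in>UNIV. (partial_deriv i \<phi> x *\<^sub>R u x) *\<^sub>R (axis i 1 :: real^'n)) = u x *\<^sub>R grad \<phi> x" for x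
    by (simp add: vec_eq_iff grad_def axis_def if_distrib cong: if_cong)
  ultimately show ?thesis by (simp only:)
qed

text \<open>Projections commute with the Bochner integral of an integrable function, and local
  integrability against a test function supplies the integrability.\<close>

lemma has_weak_grad_iff_components:
  fixes u :: "real^'n \<Rightarrow> real"
  assumes u: "locally_integrable u" and g: "locally_integrable g"
  shows "has_weak_grad u g \<longleftrightarrow> (\<forall>\<phi>\<in>Cc_infinity. \<forall>i.
    (LINT x|lebesgue. u x * partial_deriv i \<phi> x) = - (LINT x|lebesgue. \<phi> x * g x $ i))"
proof -
  have "((LINT x|lebesgue. u x *\<^sub>R grad \<phi> x) = - (LINT x|lebesgue. \<phi> x *\<^sub>R g x)) \<longleftrightarrow>
    (\<forall>i. (LINT x|lebesgue. u x * partial_deriv i \<phi> x) = - (LINT x|lebesgue. \<phi> x * g x $ i))"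
    if \<phi>: "\<phi> \<in> Cc_infinity" for \<phi>
  proof -
    have 1: "(LINT x|lebesgue. u x *\<^sub>R grad \<phi> x) $ i = (LINT x|lebesgue. u x * partial_deriv i \<phi> x)" for i
      using integral_bounded_linear[OF bounded_linear_vec_nth grad_pairing_integrable[OF u \<phi>], of i]
      by (simp add: grad_def)
    have 2: "(LINT x|lebesgue. \<phi> x *\<^sub>R g x) $ i = (LINT x|lebesgue. \<phi> x * g x $ i)" for i
      using integral_bounded_linear[OF bounded_linear_vec_nth
          locally_integrable_scaleR_Cc0[OF g Cc_infinity_subset_Cc0[OF \<phi>]], of i] by simp
    show ?thesis unfolding vec_eq_iff vector_uminus_component 1 2 ..
  qed
  then show ?thesis using u g by (simp add: has_weak_grad_def)
qed

lemma has_weak_grad_unique: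
  fixes u :: "real^'n \<Rightarrow> real"
  assumes g: "has_weak_grad u g" and g': "has_weak_grad u g'"
  shows "AE x in lebesgue. g x = g' x"
proof -
  have u: "locally_integrable u" and lg: "locally_integrable g" and lg': "locally_integrable g'"
    using g g' by (auto simp: has_weak_grad_def)
  have "AE x in lebesgue. g x $ i - g' x $ i = 0" for i
  proof (rule Cc_infinity_separates)
    show "locally_integrable (\<lambda>x. g x $ i - g' x $ i)"
      by (intro locally_integrable_diff locally_integrable_component lg lg')
    fix \<phi> :: "real^'n \<Rightarrow> real" assume \<phi>: "\<phi> \<in> Cc_infinity"
    have "integrable lebesgue (\<lambda>x. \<phi> x * g x $ i)" "integrable lebesgue (\<lambda>x. \<phi> x * g' x $ i)"
      using locally_integrable_scaleR_Cc0[OF locally_integrable_component[OF lg] Cc_infinity_subset_Cc0[OF \<phi>]]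
        locally_integrable_scaleR_Cc0[OF locally_integrable_component[OF lg'] Cc_infinity_subset_Cc0[OF \<phi>]] by simp_all
    then show "(LINT x|lebesgue. \<phi> x * (g x $ i - g' x $ i)) = 0"
      using g[unfolded has_weak_grad_iff_components[OF u lg], rule_format, OF \<phi>, of i]
        g'[unfolded has_weak_grad_iff_components[OF u lg'], rule_format, OF \<phi>, of i]
      by (simp add: right_diff_distrib)
  qed
  then have "AE x in lebesgue. \<forall>i\<in>UNIV. g x $ i - g' x $ i = 0"
    unfolding AE_finite_all[OF finite] by blast
  then show ?thesis by eventually_elim (simp add: vec_eq_iff)
qed

lemma has_weak_grad_weak_grad: "has_weak_grad u g \<Longrightarrow> has_weak_grad u (weak_grad u)"
  unfolding weak_grad_def by (rule someI[where P="has_weak_grad u"])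

lemma L2_cong_AE:
  fixes f g :: "'a::euclidean_space \<Rightarrow> 'b::euclidean_space"
  assumes "f \<in> L2" "g \<in> borel_measurable lebesgue" "AE x in lebesgue. f x = g x"
  shows "g \<in> L2"
proof -
  have [measurable]: "f \<in> borel_measurable lebesgue" "g \<in> borel_measurable lebesgue"
    using assms by (auto simp: L2_def)
  have "integrable lebesgue (\<lambda>x. (norm (g x))\<^sup>2) \<longleftrightarrow> integrable lebesgue (\<lambda>x. (norm (f x))\<^sup>2)"
    by (rule integrable_cong_AE) (use assms(3) in auto)
  then show ?thesis using assms by (simp add: L2_def)
qed

text \<open>The gradient picked by \<open>weak_grad\<close> need not be the one that witnesses
  membership in \<open>H1\<close>; uniqueness almost everywhere carries square integrability
  over.\<close>

lemma H1_weak_grad: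
  assumes "u \<in> H1"
  shows "has_weak_grad u (weak_grad u)" "weak_grad u \<in> L2"
proof -
  obtain g where g: "g \<in> L2" "has_weak_grad u g" using assms by (auto simp: H1_def)
  show 1: "has_weak_grad u (weak_grad u)" by (rule has_weak_grad_weak_grad[OF g(2)])
  then have "weak_grad u \<in> borel_measurable lebesgue"
    by (intro locally_integrable_measurable) (simp add: has_weak_grad_def)
  then show "weak_grad u \<in> L2"
    by (rule L2_cong_AE[OF g(1)]) (rule has_weak_grad_unique[OF g(2) 1])
qed

section \<open>Push-forwards along the flow\<close>

context smooth_flow
begin

text \<open>An everywhere defined representative of the push-forward. The codomain is general
  because both \<open>u0\<close> and a vector field are pushed as densities, the latter without
  rotating its values by the derivative of the flow.\<close>

definition push :: "real \<Rightarrow> (real^'n \<Rightarrow> 'b::real_vector) \<Rightarrow> real^'n \<Rightarrow> 'b" where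
  "push t f y = inverse (J t (T (- t) y)) *\<^sub>R f (T (- t) y)"

lemma J_push: "J t x *\<^sub>R push t f (T t x) = f x"
  using J_pos[of t x] by (simp add: push_def T_inverse)

lemma J_inverse_measurable: "(\<lambda>x. inverse (J t x)) \<in> borel_measurable lebesgue"
  using borel_measurable_lebesgue_continuous[OF J_t_continuous] by (rule borel_measurable_inverse)

lemma push_measurable:
  fixes f :: "real^'n \<Rightarrow> 'b::euclidean_space"
  assumes "f \<in> borel_measurable lebesgue"
  shows "push t f \<in> borel_measurable lebesgue"
  unfolding push_def
  by (intro borel_measurable_scaleR measurable_compose[OF T_lebesgue_measurable J_inverse_measurable]
      measurable_compose[OF T_lebesgue_measurable assms])

lemma push_test:
  fixes f :: "real^'n \<Rightarrow> real"
  assumes f: "f \<in> borel_measurable lebesgue" and \<zeta>: "\<zeta> \<in> Cc0"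
  shows "(LINT y|lebesgue. \<zeta> y * push t f y) = (LINT x|lebesgue. \<zeta> (T t x) * f x)"
proof -
  have m: "(\<lambda>y. \<zeta> y * push t f y) \<in> borel_measurable lebesgue"
    using \<zeta> by (intro borel_measurable_times borel_measurable_lebesgue_continuous push_measurable f) (simp add: Cc0_def)
  have eq: "J t x *\<^sub>R (\<zeta> (T t x) * push t f (T t x)) = \<zeta> (T t x) * f x" for x
    using J_push[of t x f] by (simp add: mult.left_commute)
  from integral_T[OF m, of t] show ?thesis unfolding eq by (rule sym)
qed

lemma L2_weighted_integrable:
  fixes f :: "real^'n \<Rightarrow> 'b::euclidean_space"
  assumes "f \<in> L2"
  shows "integrable lebesgue (\<lambda>x. (norm (f x))\<^sup>2 * inverse (J t x))"
proof -
  have f: "f \<in> borel_measurable lebesgue" "integrable lebesgue (\<lambda>x. (norm (f x))\<^sup>2)"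
    using assms by (auto simp: L2_def)
  obtain D where D: "0 \<le> D" "\<And>s x. \<bar>s\<bar> \<le> \<bar>t\<bar> \<Longrightarrow> inverse (J s x) \<le> D" using J_bounded by blast
  show ?thesis
  proof (rule Bochner_Integration.integrable_bound[OF integrable_mult_left[OF f(2), of D]])
    show "(\<lambda>x. (norm (f x))\<^sup>2 * inverse (J t x)) \<in> borel_measurable lebesgue"
      by (intro borel_measurable_times borel_measurable_power
          measurable_compose[OF f(1) borel_measurable_norm] J_inverse_measurable)
    show "AE x in lebesgue. norm ((norm (f x))\<^sup>2 * inverse (J t x)) \<le> norm ((norm (f x))\<^sup>2 * D)"
      using D J_pos[of t] by (intro AE_I2) (auto simp: abs_mult less_imp_le intro!: mult_left_mono)
  qed
qed

lemma
  fixes f :: "real^'n \<Rightarrow> 'b::euclidean_space"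
  assumes f: "f \<in> L2"
  shows push_L2: "push t f \<in> L2"
    and push_norm2: "(LINT y|lebesgue. (norm (push t f y))\<^sup>2) = (LINT x|lebesgue. (norm (f x))\<^sup>2 * inverse (J t x))"
proof -
  have pm: "push t f \<in> borel_measurable lebesgue"
    using f by (intro push_measurable) (simp add: L2_def)
  then have m: "(\<lambda>y. (norm (push t f y))\<^sup>2) \<in> borel_measurable lebesgue"
    by (intro borel_measurable_power measurable_compose[OF _ borel_measurable_norm])
  have eq: "J t x *\<^sub>R (norm (push t f (T t x)))\<^sup>2 = (norm (f x))\<^sup>2 * inverse (J t x)" for x
    using J_pos[of t x] by (simp add: push_def T_inverse power_mult_distrib power2_eq_square)
  show "push t f \<in> L2"
    using integrable_T_iff[OF m, of t] L2_weighted_integrable[OF f] pm unfolding eq by (simp add: L2_def)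
  show "(LINT y|lebesgue. (norm (push t f y))\<^sup>2) = (LINT x|lebesgue. (norm (f x))\<^sup>2 * inverse (J t x))"
    using integral_T[OF m, of t] unfolding eq by (rule sym)
qed

text \<open>Both functions have the same integrals against \<open>Cc0\<close>, hence against
  \<open>Cc_infinity\<close>, which separates locally integrable functions.\<close>

lemma push_forward_eq_push:
  assumes f: "f \<in> L2" and v: "is_push_forward (T t) f v"
  shows "AE x in lebesgue. push t f x = v x"
proof -
  have fm: "f \<in> borel_measurable lebesgue" using f by (simp add: L2_def)
  have lv: "locally_integrable v" using v by (simp add: is_push_forward_def)
  have lp: "locally_integrable (push t f)" by (rule L2_locally_integrable[OF push_L2[OF f]])
  have "AE x in lebesgue. push t f x - v x = 0"
  proof (rule Cc_infinity_separates[OF locally_integrable_diff[OF lp lv]])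
    fix \<phi> :: "real^'n \<Rightarrow> real" assume "\<phi> \<in> Cc_infinity"
    then have \<phi>: "\<phi> \<in> Cc0" by (rule Cc_infinity_subset_Cc0)
    have "integrable lebesgue (\<lambda>x. \<phi> x * push t f x)" "integrable lebesgue (\<lambda>x. \<phi> x * v x)"
      using locally_integrable_scaleR_Cc0[OF lp \<phi>] locally_integrable_scaleR_Cc0[OF lv \<phi>] by simp_all
    then show "(LINT x|lebesgue. \<phi> x * (push t f x - v x)) = 0"
      using v \<phi> push_test[OF fm \<phi>, of t] by (simp add: is_push_forward_def right_diff_distrib mult.commute)
  qed
  then show ?thesis by eventually_elim simp
qed

lemma push_forward_L2:
  assumes f: "f \<in> L2" and v: "is_push_forward (T t) f v"
  shows "v \<in> L2"
proof (rule L2_cong_AE[OF push_L2[OF f] _ push_forward_eq_push[OF f v]])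
  show "v \<in> borel_measurable lebesgue"
    using v by (intro locally_integrable_measurable) (simp add: is_push_forward_def)
qed

lemma Cc0_compose_T:
  fixes c :: "real^'n \<Rightarrow> real"
  assumes "\<zeta> \<in> Cc0" "continuous_on UNIV c"
  shows "(\<lambda>x. c x * \<zeta> (T t x)) \<in> Cc0"
proof -
  have "continuous_on UNIV (\<lambda>x. c x * \<zeta> (T t x))"
    using assms by (intro continuous_on_mult continuous_on_compose2[OF _ T_t_continuous]) (auto simp: Cc0_def)
  then show ?thesis
    using compactly_supported_compose_T[of \<zeta> c t] assms(1) by (simp add: Cc0_def)
qed

text \<open>The derivative of \<open>\<phi> \<circ> T t\<close> along column \<open>i\<close> of
  \<open>A t\<close> is the derivative of \<open>\<phi>\<close> in direction
  \<open>DT t x ** A t x\<close> applied to the \<open>i\<close>-th unit vector, that is, in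
  direction \<open>i\<close>. The columns thus convert a derivative at \<open>T t x\<close> into a
  divergence at \<open>x\<close>.\<close>

lemma divergence_identity:
  fixes \<phi> :: "real^'n \<Rightarrow> real" and t :: real
  assumes \<phi>: "\<phi> \<in> Cc_infinity"
  defines "\<psi> \<equiv> \<lambda>i j x. A t x $ j $ i * \<phi> (T t x)"
  shows "\<psi> i j \<in> Cc_infinity"
    and "(\<Sum>j\<in>UNIV. partial_deriv j (\<psi> i j) x) =
      B t x $ i * \<phi> (T t x) + partial_deriv i \<phi> (T t x)"
proof -
  have \<phi>s: "C_kt k (\<lambda>_. \<phi>)" for k
    using \<phi> by (simp add: Cc_infinity_def C_k_iff_C_kt)
  have "C_kt k (\<lambda>t x. A t x $ j $ i * \<phi> (T t x))" for k
    by (rule C_kt_bilinear[OF bounded_bilinear_mult C_kt_bounded_linear[OF bounded_linear_vec_nth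
            C_kt_bounded_linear[OF bounded_linear_vec_nth A_smooth]] C_kt_compose[OF \<phi>s T_smooth]])
  from C_kt_imp_C_k[OF this] have "C_k k (\<psi> i j)" for k by (simp add: \<psi>_def)
  then show "\<psi> i j \<in> Cc_infinity"
    using compactly_supported_compose_T[of \<phi> "\<lambda>x. A t x $ j $ i" t] \<phi>
    by (simp add: Cc_infinity_def \<psi>_def)
  let ?d = "frechet_derivative \<phi> (at (T t x))"
  have \<phi>': "(\<phi> has_derivative ?d) (at (T t x))" by (rule C_kt_has_derivative[OF \<phi>s])
  have "(\<psi> i j has_derivative (\<lambda>v. A t x $ j $ i * ?d (DT t x *v v)
      + frechet_derivative (A t) (at x) v $ j $ i * \<phi> (T t x))) (at x)" for j
    unfolding \<psi>_def
    by (intro has_derivative_mult bounded_linear.has_derivative[OF bounded_linear_vec_nth]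
        C_kt_has_derivative[OF A_smooth] diff_chain_at[OF DT_derivative \<phi>', unfolded o_def])
  from frechet_derivative_at[OF this, symmetric]
  have \<psi>': "partial_deriv j (\<psi> i j) x = A t x $ j $ i * ?d (DT t x *v axis j 1)
      + partial_deriv j (A t) x $ j $ i * \<phi> (T t x)" for j
    by simp
  have lin: "linear ?d" by (rule has_derivative_linear[OF \<phi>'])
  have "(\<Sum>j\<in>UNIV. A t x $ j $ i * ?d (DT t x *v axis j 1)) = ?d (\<Sum>j\<in>UNIV. A t x $ j $ i *\<^sub>R (DT t x *v axis j 1))"
    by (simp add: linear_sum[OF lin] linear_cmul[OF lin])
  also have "(\<Sum>j\<in>UNIV. A t x $ j $ i *\<^sub>R (DT t x *v axis j 1)) = column i (DT t x ** A t x)"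
    by (simp add: vec_eq_iff column_def matrix_vector_mult_basis matrix_matrix_mult_def mult.commute)
  also have "\<dots> = axis i 1"
    unfolding DT_A by (auto simp: vec_eq_iff column_def mat_def axis_def)
  finally show "(\<Sum>j\<in>UNIV. partial_deriv j (\<psi> i j) x) =
      B t x $ i * \<phi> (T t x) + ?d (axis i 1)"
    unfolding \<psi>' sum.distrib by (simp add: B_def sum_distrib_right)
qed

end

section \<open>Energy of the transported function\<close>

locale transported_H1 = smooth_flow \<xi> T
  for \<xi> :: "real^'n \<Rightarrow> real^'n" and T :: "real \<Rightarrow> real^'n \<Rightarrow> real^'n" +
  fixes u0 :: "real^'n \<Rightarrow> real"
  assumes u0_H1: "u0 \<in> H1"
begin

abbreviation "g0 \<equiv> weak_grad u0"

text \<open>\<open>h t x\<close> equals \<open>J t x\<close> times the weak gradient of \<open>u\<^sub>t\<close> at \<open>T t x\<close>.\<close>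

definition h :: "real \<Rightarrow> real^'n \<Rightarrow> real^'n" where
  "h t x = g0 x v* A t x + u0 x *\<^sub>R B t x"

lemma u0_L2: "u0 \<in> L2" and g0_L2: "g0 \<in> L2" and has_weak_grad_g0: "has_weak_grad u0 g0"
  using u0_H1 H1_weak_grad[OF u0_H1] by (auto simp: H1_def)

lemma u0_locally: "locally_integrable u0" and g0_locally: "locally_integrable g0"
  by (rule L2_locally_integrable[OF u0_L2] L2_locally_integrable[OF g0_L2])+

lemma A_t_continuous: "continuous_on UNIV (A t)" and B_t_continuous: "continuous_on UNIV (B t)"
  by (rule continuous_on_slice(1)[OF C_kt_continuous[OF A_smooth[of 0]]]
      continuous_on_slice(1)[OF C_kt_continuous[OF B_smooth[of 0]]])+

lemma h_measurable: "h t \<in> borel_measurable lebesgue"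
proof -
  have m: "u0 \<in> borel_measurable lebesgue" "g0 \<in> borel_measurable lebesgue"
    using u0_L2 g0_L2 by (auto simp: L2_def)
  have "(\<lambda>x. g0 x v* A t x) \<in> borel_measurable lebesgue"
    by (rule borel_measurable_continuous_Pair[OF m(2) borel_measurable_lebesgue_continuous[OF A_t_continuous]])
      (intro bounded_bilinear.continuous_on[OF bounded_bilinear_vector_matrix] continuous_intros)
  then show ?thesis
    unfolding h_def
    by (intro borel_measurable_add borel_measurable_scaleR m(1)
        borel_measurable_lebesgue_continuous[OF B_t_continuous])
qed

text \<open>Up to constants, the integrable majorant for the pulled-back energy density and for its
  time derivative on bounded time intervals.\<close>

definition size2 :: "real^'n \<Rightarrow> real" where
  "size2 x = (norm (g0 x))\<^sup>2 + (u0 x)\<^sup>2"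

lemma size2_integrable: "integrable lebesgue size2"
  using u0_L2 g0_L2 unfolding size2_def L2_def by simp

lemma h_0: "h 0 x = g0 x"
  by (simp add: h_def A_0 B_0)

definition h' :: "real \<Rightarrow> real^'n \<Rightarrow> real^'n" where
  "h' t x = - (h t x v* D\<xi> (T t x)) - u0 x *\<^sub>R grad (divergence \<xi>) (T t x)"

text \<open>\<open>A\<close> and \<open>B\<close> both evolve by right multiplication with
  \<open>- D\<xi> (T t x)\<close>, hence so does their combination; the inhomogeneity of
  \<open>B\<close> leaves the term with \<open>u0 x\<close>.\<close>

lemma h_ode: "((\<lambda>s. h s x) has_vector_derivative h' t x) (at t)"
proof -
  have "((\<lambda>s. g0 x v* A s x + u0 x *\<^sub>R B s x) has_vector_derivative
      g0 x v* (- (A t x ** D\<xi> (T t x))) + u0 x *\<^sub>R (- (B t x v* D\<xi> (T t x)) - grad (divergence \<xi>) (T t x))) (at t)"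
    by (intro has_vector_derivative_add
        bounded_linear.has_vector_derivative[OF bounded_bilinear.bounded_linear_right[OF bounded_bilinear_vector_matrix] A_ode]
        bounded_linear.has_vector_derivative[OF bounded_linear_scaleR_right B_ode])
  moreover have "g0 x v* (- (A t x ** D\<xi> (T t x))) + u0 x *\<^sub>R (- (B t x v* D\<xi> (T t x)) - grad (divergence \<xi>) (T t x)) = h' t x"
    by (simp add: h'_def h_def bounded_bilinear.minus_right[OF bounded_bilinear_vector_matrix]
        bounded_bilinear.add_left[OF bounded_bilinear_vector_matrix]
        bounded_bilinear.scaleR_left[OF bounded_bilinear_vector_matrix]
        vector_matrix_mul_assoc[symmetric] scaleR_diff_right)
  ultimately show ?thesis by (simp add: h_def)
qed

lemma h'_bound: "\<exists>K\<ge>0. \<exists>M\<ge>0. \<forall>t x. norm (h' t x) \<le> K * norm (h t x) + M * \<bar>u0 x\<bar>"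
proof -
  obtain K where K: "0 \<le> K" "\<And>x v. norm (v v* D\<xi> x) \<le> K * norm v" using vector_Dxi_bounded by blast
  obtain M where M: "0 \<le> M" "\<And>x. norm (grad (divergence \<xi>) x) \<le> M" using grad_divergence_bounded by blast
  have "norm (h' t x) \<le> K * norm (h t x) + M * \<bar>u0 x\<bar>" for t x
  proof -
    have "norm (h' t x) \<le> norm (h t x v* D\<xi> (T t x)) + \<bar>u0 x\<bar> * norm (grad (divergence \<xi>) (T t x))"
      unfolding h'_def
      using norm_triangle_ineq4[of "- (h t x v* D\<xi> (T t x))" "u0 x *\<^sub>R grad (divergence \<xi>) (T t x)"]
      by (simp only: norm_minus_cancel norm_scaleR)
    also have "\<dots> \<le> K * norm (h t x) + \<bar>u0 x\<bar> * M"
      using K M by (intro add_mono mult_left_mono) auto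
    finally show ?thesis by (simp add: mult.commute)
  qed
  with K(1) M(1) show ?thesis by blast
qed

text \<open>Gronwall's inequality for each \<open>x\<close> separately, with \<open>u0 x\<close> as
  a constant forcing in time.\<close>

lemma h_bound: "\<exists>C\<ge>0. \<forall>t x. \<bar>t\<bar> \<le> H \<longrightarrow> norm (h t x) \<le> C * (norm (g0 x) + \<bar>u0 x\<bar>)"
proof -
  obtain K M where K: "0 \<le> K" and M: "0 \<le> M" and bd: "\<And>t x. norm (h' t x) \<le> K * norm (h t x) + M * \<bar>u0 x\<bar>"
    using h'_bound by blast
  define E where "E = exp ((2 * K + 1) * \<bar>H\<bar>) * (1 + \<bar>H\<bar>)"
  have E: "0 \<le> E" by (simp add: E_def)
  have "norm (h t x) \<le> E * (1 + M) * (norm (g0 x) + \<bar>u0 x\<bar>)" if t: "\<bar>t\<bar> \<le> H" for t x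
  proof -
    have "norm (h t x) \<le> E * (norm (h 0 x) + M * \<bar>u0 x\<bar>)"
      unfolding E_def by (rule gronwall[where r="\<lambda>t. h t x", OF h_ode bd]) (use K M t in auto)
    also have "\<dots> \<le> E * ((1 + M) * (norm (g0 x) + \<bar>u0 x\<bar>))"
      using E M by (intro mult_left_mono) (simp_all add: h_0 algebra_simps)
    finally show ?thesis by (simp add: mult.assoc)
  qed
  with E M show ?thesis by (intro exI[of _ "E * (1 + M)"]) auto
qed

lemma sum_power2_bound: "(norm (g0 x) + \<bar>u0 x\<bar>)\<^sup>2 \<le> 2 * size2 x"
proof -
  have "0 \<le> (norm (g0 x) - \<bar>u0 x\<bar>)\<^sup>2" by simp
  then show ?thesis unfolding size2_def power2_sum power2_diff by simp
qed

lemma h_L2: "h t \<in> L2"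
proof -
  obtain C where C: "0 \<le> C" "\<And>s x. \<bar>s\<bar> \<le> \<bar>t\<bar> \<Longrightarrow> norm (h s x) \<le> C * (norm (g0 x) + \<bar>u0 x\<bar>)"
    using h_bound by blast
  have "integrable lebesgue (\<lambda>x. (norm (h t x))\<^sup>2)"
  proof (rule Bochner_Integration.integrable_bound[OF integrable_mult_right[OF size2_integrable, of "C\<^sup>2 * 2"]])
    show "(\<lambda>x. (norm (h t x))\<^sup>2) \<in> borel_measurable lebesgue"
      by (intro borel_measurable_power measurable_compose[OF h_measurable borel_measurable_norm])
    have "(norm (h t x))\<^sup>2 \<le> C\<^sup>2 * 2 * size2 x" for x
    proof -
      have "(norm (h t x))\<^sup>2 \<le> (C * (norm (g0 x) + \<bar>u0 x\<bar>))\<^sup>2"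
        using C by (intro power_mono) auto
      also have "\<dots> \<le> C\<^sup>2 * (2 * size2 x)"
        unfolding power_mult_distrib by (intro mult_left_mono sum_power2_bound) simp
      finally show ?thesis by simp
    qed
    then show "AE x in lebesgue. norm ((norm (h t x))\<^sup>2) \<le> norm (C\<^sup>2 * 2 * size2 x)"
      by (intro AE_I2) (simp add: size2_def)
  qed
  then show ?thesis by (simp add: L2_def h_measurable)
qed

text \<open>The energy density pulled back by the flow: the change of variables contributes one
  factor \<open>J t x\<close>, and the squared push-forward two factors of its inverse.\<close>

definition e :: "real \<Rightarrow> real^'n \<Rightarrow> real" where
  "e t x = 1 / 2 * ((norm (h t x))\<^sup>2 * inverse (J t x))"

lemma e_integrable: "integrable lebesgue (e t)"
  unfolding e_def by (rule integrable_mult_right[OF L2_weighted_integrable[OF h_L2]])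

text \<open>Component \<open>j\<close> of the weak gradient is tested with \<open>\<psi> j\<close>,
  and the results are summed over \<open>j\<close>. One side collects the divergence of this field,
  the other the \<open>i\<close>-th component of \<open>g0 x v* A t x\<close>.\<close>

lemma transported_test_identity:
  fixes \<phi> :: "real^'n \<Rightarrow> real"
  assumes \<phi>: "\<phi> \<in> Cc_infinity"
  shows "(LINT x|lebesgue. u0 x * partial_deriv i \<phi> (T t x)) = - (LINT x|lebesgue. \<phi> (T t x) * h t x $ i)"
proof -
  define \<psi> where "\<psi> = (\<lambda>j x. A t x $ j $ i * \<phi> (T t x))"
  have \<psi>: "\<psi> j \<in> Cc_infinity" for j
    unfolding \<psi>_def by (rule divergence_identity(1)[OF \<phi>])
  have div: "(\<Sum>j\<in>UNIV. partial_deriv j (\<psi> j) x) =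
      B t x $ i * \<phi> (T t x) + partial_deriv i \<phi> (T t x)" for x
    unfolding \<psi>_def by (rule divergence_identity(2)[OF \<phi>])
  note wk = has_weak_grad_g0[unfolded has_weak_grad_iff_components[OF u0_locally g0_locally], rule_format, OF \<psi>]
  have int1: "integrable lebesgue (\<lambda>x. u0 x * partial_deriv j (\<psi> j) x)" for j
    using locally_integrable_scaleR_Cc0[OF u0_locally Cc_infinity_derivative_Cc0[OF \<psi>]] by (simp add: mult.commute)
  have int2: "integrable lebesgue (\<lambda>x. \<psi> j x * g0 x $ j)" for j
    using locally_integrable_scaleR_Cc0[OF locally_integrable_component[OF g0_locally] Cc_infinity_subset_Cc0[OF \<psi>]] by simp
  have int3: "integrable lebesgue (\<lambda>x. u0 x * (B t x $ i * \<phi> (T t x)))"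
    using locally_integrable_scaleR_Cc0[OF u0_locally Cc0_compose_T[OF Cc_infinity_subset_Cc0[OF \<phi>]
          bounded_linear.continuous_on[OF bounded_linear_vec_nth[of i] B_t_continuous]], of t]
    by (simp add: ac_simps)
  have int4: "integrable lebesgue (\<lambda>x. u0 x * partial_deriv i \<phi> (T t x))"
    using locally_integrable_scaleR_Cc0[OF u0_locally Cc0_compose_T[OF Cc_infinity_derivative_Cc0[OF \<phi>]
          continuous_on_const[of _ 1]], of t]
    by (simp add: ac_simps)
  have int5: "integrable lebesgue (\<lambda>x. \<Sum>j\<in>UNIV. \<psi> j x * g0 x $ j)"
    by (rule Bochner_Integration.integrable_sum[OF int2])
  have "(LINT x|lebesgue. u0 x * (B t x $ i * \<phi> (T t x))) + (LINT x|lebesgue. u0 x * partial_deriv i \<phi> (T t x))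
      = (LINT x|lebesgue. (\<Sum>j\<in>UNIV. u0 x * partial_deriv j (\<psi> j) x))"
    unfolding sum_distrib_left[symmetric] div using int3 int4 by (simp add: distrib_left)
  also have "\<dots> = (\<Sum>j\<in>UNIV. LINT x|lebesgue. u0 x * partial_deriv j (\<psi> j) x)"
    by (rule Bochner_Integration.integral_sum[OF int1])
  also have "\<dots> = - (\<Sum>j\<in>UNIV. LINT x|lebesgue. \<psi> j x * g0 x $ j)"
    unfolding wk by (simp add: sum_negf)
  also have "(\<Sum>j\<in>UNIV. LINT x|lebesgue. \<psi> j x * g0 x $ j) = (LINT x|lebesgue. (\<Sum>j\<in>UNIV. \<psi> j x * g0 x $ j))"
    by (rule Bochner_Integration.integral_sum[OF int2, symmetric])
  finally have "(LINT x|lebesgue. u0 x * partial_deriv i \<phi> (T t x)) =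
      - ((LINT x|lebesgue. (\<Sum>j\<in>UNIV. \<psi> j x * g0 x $ j)) + (LINT x|lebesgue. u0 x * (B t x $ i * \<phi> (T t x))))"
    by simp
  also have "(LINT x|lebesgue. (\<Sum>j\<in>UNIV. \<psi> j x * g0 x $ j)) + (LINT x|lebesgue. u0 x * (B t x $ i * \<phi> (T t x)))
      = (LINT x|lebesgue. (\<Sum>j\<in>UNIV. \<psi> j x * g0 x $ j) + u0 x * (B t x $ i * \<phi> (T t x)))"
    by (rule Bochner_Integration.integral_add[OF int5 int3, symmetric])
  also have "\<dots> = (LINT x|lebesgue. \<phi> (T t x) * h t x $ i)"
    by (intro Bochner_Integration.integral_cong refl)
      (simp add: \<psi>_def h_def vector_matrix_mult_def sum_distrib_left algebra_simps)
  finally show ?thesis .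
qed

text \<open>The push-forward property is used with the partial derivative of \<open>\<phi>\<close>
  as test function to move to time 0; after the integration by parts there, the change of variables
  in \<open>push_test\<close> moves back.\<close>

lemma push_forward_has_weak_grad:
  assumes v: "is_push_forward (T t) u0 v"
  shows "has_weak_grad v (push t (h t))"
proof -
  have lv: "locally_integrable v" using v by (simp add: is_push_forward_def)
  show ?thesis
    unfolding has_weak_grad_iff_components[OF lv L2_locally_integrable[OF push_L2[OF h_L2]]]
  proof (intro ballI allI)
    fix \<phi> :: "real^'n \<Rightarrow> real" and i assume \<phi>: "\<phi> \<in> Cc_infinity"
    have "(\<lambda>v :: real^'n. v $ i) \<in> borel_measurable borel"
      by (intro borel_measurable_continuous_onI linear_continuous_on bounded_linear_vec_nth)
    then have hi: "(\<lambda>x. h t x $ i) \<in> borel_measurable lebesgue"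
      by (rule measurable_compose[OF h_measurable])
    have "(LINT x|lebesgue. v x * partial_deriv i \<phi> x) =
        (LINT x|lebesgue. u0 x * partial_deriv i \<phi> (T t x))"
      using v Cc_infinity_derivative_Cc0[OF \<phi>, of "axis i 1"] by (simp add: is_push_forward_def)
    also have "\<dots> = - (LINT x|lebesgue. \<phi> (T t x) * h t x $ i)" by (rule transported_test_identity[OF \<phi>])
    also have "\<dots> = - (LINT x|lebesgue. \<phi> x * push t (\<lambda>x. h t x $ i) x)"
      by (simp only: push_test[OF hi Cc_infinity_subset_Cc0[OF \<phi>]])
    finally show "(LINT x|lebesgue. v x * partial_deriv i \<phi> x) =
        - (LINT x|lebesgue. \<phi> x * push t (h t) x $ i)"
      by (simp add: push_def)
  qed
qed

lemma push_forward_H1: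
  assumes "is_push_forward (T t) u0 v"
  shows "v \<in> H1"
  using push_forward_L2[OF u0_L2 assms] push_forward_has_weak_grad[OF assms] push_L2[OF h_L2]
  by (auto simp: H1_def)

text \<open>The right-hand side does not mention \<open>v\<close>, so the energy is a function of
  time alone, whichever representatives of the push-forwards and of their weak gradients are
  chosen.\<close>

lemma push_forward_energy:
  assumes v: "is_push_forward (T t) u0 v"
  shows "(LINT x|lebesgue. 1 / 2 * (norm (weak_grad v x))\<^sup>2) = (LINT x|lebesgue. e t x)"
proof -
  note wg = H1_weak_grad[OF push_forward_H1[OF v]]
  have "AE x in lebesgue. weak_grad v x = push t (h t) x"
    by (rule has_weak_grad_unique[OF wg(1) push_forward_has_weak_grad[OF v]])
  moreover have "weak_grad v \<in> borel_measurable lebesgue" using wg(2) by (simp add: L2_def)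
  ultimately have "(LINT x|lebesgue. (norm (weak_grad v x))\<^sup>2) = (LINT x|lebesgue. (norm (push t (h t) x))\<^sup>2)"
    using push_measurable[OF h_measurable] by (intro integral_cong_AE) auto
  then show ?thesis unfolding e_def by (simp only: integral_mult_right_zero push_norm2[OF h_L2])
qed

definition e' :: "real \<Rightarrow> real^'n \<Rightarrow> real" where
  "e' t x = (h t x \<bullet> h' t x - 1 / 2 * (norm (h t x))\<^sup>2 * divergence \<xi> (T t x)) * inverse (J t x)"

lemma e_derivative: "((\<lambda>s. e s x) has_real_derivative e' t x) (at t)"
proof -
  have "((\<lambda>s. h s x \<bullet> h s x) has_vector_derivative h t x \<bullet> h' t x + h' t x \<bullet> h t x) (at t)"
    by (rule bounded_bilinear.has_vector_derivative[OF bounded_bilinear_inner h_ode h_ode])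
  then have 1: "((\<lambda>s. h s x \<bullet> h s x) has_real_derivative 2 * (h t x \<bullet> h' t x)) (at t)"
    by (simp add: has_real_derivative_iff_has_vector_derivative inner_commute)
  have 2: "((\<lambda>s. inverse (J s x)) has_real_derivative - (inverse (J t x) * (J t x * divergence \<xi> (T t x)) * inverse (J t x))) (at t)"
    by (rule DERIV_inverse'[OF J_ode]) (use J_pos[of t x] in simp)
  have "((\<lambda>s. 1 / 2 * (h s x \<bullet> h s x) * inverse (J s x)) has_real_derivative
      1 / 2 * (2 * (h t x \<bullet> h' t x)) * inverse (J t x)
      + - (inverse (J t x) * (J t x * divergence \<xi> (T t x)) * inverse (J t x)) * (1 / 2 * (h t x \<bullet> h t x))) (at t)"
    by (rule DERIV_mult[OF DERIV_cmult[OF 1] 2])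
  then show ?thesis
    using J_pos[of t x] by (simp add: e_def e'_def power2_norm_eq_inner algebra_simps)
qed

text \<open>Every term of \<open>e'\<close> is quadratic in
  \<open>norm (g0 x) + \<bar>u0 x\<bar>\<close>, with coefficients bounded uniformly in
  \<open>x\<close> on bounded time intervals.\<close>

lemma e'_bound: "\<exists>C. \<forall>t x. \<bar>t\<bar> \<le> H \<longrightarrow> \<bar>e' t x\<bar> \<le> C * size2 x"
proof -
  obtain C where C: "0 \<le> C" "\<And>t x. \<bar>t\<bar> \<le> H \<Longrightarrow> norm (h t x) \<le> C * (norm (g0 x) + \<bar>u0 x\<bar>)"
    using h_bound by blast
  obtain D where D: "0 \<le> D" "\<And>t x. \<bar>t\<bar> \<le> H \<Longrightarrow> inverse (J t x) \<le> D" using J_bounded by blast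
  obtain L where L: "0 \<le> L" "\<And>x. norm (divergence \<xi> x) \<le> L" using divergence_bounded by blast
  obtain K M where K: "0 \<le> K" and M: "0 \<le> M" and bd: "\<And>t x. norm (h' t x) \<le> K * norm (h t x) + M * \<bar>u0 x\<bar>"
    using h'_bound by blast
  \<comment> \<open>The first summand bounds the inner product of \<open>h\<close> and
    \<open>h'\<close>, the second the term with the divergence; \<open>D\<close> later accounts for
    \<open>inverse (J t x)\<close>.\<close>
  define Q where "Q = C * (K * C + M) + 1 / 2 * C\<^sup>2 * L"
  have "\<bar>e' t x\<bar> \<le> (2 * (Q * D)) * size2 x" if t: "\<bar>t\<bar> \<le> H" for t x
  proof -
    define S where "S = norm (g0 x) + \<bar>u0 x\<bar>"
    have S: "0 \<le> S" "\<bar>u0 x\<bar> \<le> S" by (simp_all add: S_def)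
    have hS: "norm (h t x) \<le> C * S" using C(2)[OF t] by (simp add: S_def)
    have "norm (h' t x) \<le> K * (C * S) + M * S"
      using bd[of t x] mult_left_mono[OF hS K] mult_left_mono[OF S(2) M] by linarith
    then have "norm (h t x) * norm (h' t x) \<le> (C * S) * ((K * C + M) * S)"
      using hS C S by (intro mult_mono) (auto simp: algebra_simps)
    then have 1: "\<bar>h t x \<bullet> h' t x\<bar> \<le> (C * (K * C + M)) * S\<^sup>2"
      using Cauchy_Schwarz_ineq2[of "h t x" "h' t x"] by (simp add: power2_eq_square ac_simps)
    have "1 / 2 * (norm (h t x))\<^sup>2 * \<bar>divergence \<xi> (T t x)\<bar> \<le> 1 / 2 * (C * S)\<^sup>2 * L"
      using hS L(2)[of "T t x"] by (intro mult_mono power_mono) auto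
    then have 2: "\<bar>1 / 2 * (norm (h t x))\<^sup>2 * divergence \<xi> (T t x)\<bar> \<le> (1 / 2 * C\<^sup>2 * L) * S\<^sup>2"
      by (simp add: abs_mult power_mult_distrib ac_simps)
    have "\<bar>h t x \<bullet> h' t x - 1 / 2 * (norm (h t x))\<^sup>2 * divergence \<xi> (T t x)\<bar> \<le> Q * S\<^sup>2"
      using abs_triangle_ineq4[of "h t x \<bullet> h' t x" "1 / 2 * (norm (h t x))\<^sup>2 * divergence \<xi> (T t x)"] 1 2
      by (simp add: Q_def distrib_right)
    then have "\<bar>e' t x\<bar> \<le> (Q * S\<^sup>2) * D"
      unfolding e'_def abs_mult using D(2)[OF t, of x] J_pos[of t x] C K M L
      by (intro mult_mono) (auto simp: Q_def)
    also have "\<dots> = (Q * D) * S\<^sup>2" by simp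
    also have "\<dots> \<le> (Q * D) * (2 * size2 x)"
      unfolding S_def Q_def using C K M L D by (intro mult_left_mono sum_power2_bound) simp
    finally show ?thesis by simp
  qed
  then show ?thesis by blast
qed

lemma e'_0: "e' 0 x = - (g0 x \<bullet> (D\<xi> x *v g0 x)) - 1/2 * (norm (g0 x))\<^sup>2 * divergence \<xi> x
    - u0 x * (g0 x \<bullet> grad (divergence \<xi>) x)"
proof -
  \<comment> \<open>The evolution of \<open>h\<close> brings in the transpose of
    \<open>D\<xi>\<close>; in a quadratic form the transposition disappears.\<close>
  have "g0 x \<bullet> (g0 x v* D\<xi> x) = g0 x \<bullet> (D\<xi> x *v g0 x)"
    by (metis dot_lmul_matrix inner_commute)
  then show ?thesis by (simp add: e'_def h'_def h_0 J_0 inner_diff_right)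
qed

lemma energy_derivative:
  "((\<lambda>t. LINT x|lebesgue. e t x) has_real_derivative
    (LINT x|lebesgue. - (g0 x \<bullet> (D\<xi> x *v g0 x)) - 1/2 * (norm (g0 x))\<^sup>2 * divergence \<xi> x
      - u0 x * (g0 x \<bullet> grad (divergence \<xi>) x))) (at 0)"
proof -
  obtain C where C: "\<And>t x. \<bar>t\<bar> \<le> 1 \<Longrightarrow> \<bar>e' t x\<bar> \<le> C * size2 x" using e'_bound by blast
  have "((\<lambda>t. LINT x|lebesgue. e t x) has_real_derivative (LINT x|lebesgue. e' 0 x)) (at 0)"
  proof (rule has_real_derivative_integral[where w="\<lambda>x. C * size2 x"])
    show "\<bar>e' t x\<bar> \<le> C * size2 x" if "\<bar>t - 0\<bar> \<le> 1" for t x using C that by simp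
    show "integrable lebesgue (\<lambda>x. C * size2 x)" by (rule integrable_mult_right[OF size2_integrable])
  qed (rule e_integrable e_derivative)+
  then show ?thesis unfolding e'_0 .
qed

end

text \<open>Membership of every \<open>u t\<close> in \<open>H1\<close> belongs to the conclusion
  because \<open>weak_grad\<close>, being a choice, is meaningful only for functions that have a
  weak gradient.\<close>

theorem lemma3p7:
  fixes u\<^sub>0 :: "real^'n \<Rightarrow> real"
    and \<xi> :: "real^'n \<Rightarrow> real^'n"
    and T :: "real \<Rightarrow> real^'n \<Rightarrow> real^'n"
    and u :: "real \<Rightarrow> real^'n \<Rightarrow> real"
  assumes "u\<^sub>0 \<in> H1"
    and "\<xi> \<in> Cc_infinity"
    and "is_flow \<xi> T"
    and "\<And>t. is_push_forward (T t) u\<^sub>0 (u t)"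
  shows "(\<forall>t. u t \<in> H1) \<and>
    ((\<lambda>t. LINT x|lebesgue. 1/2 * (norm (weak_grad (u t) x))\<^sup>2) has_real_derivative
      (LINT x|lebesgue.
          - (weak_grad u\<^sub>0 x \<bullet> (jacobian \<xi> (at x) *v weak_grad u\<^sub>0 x))
          - 1/2 * (norm (weak_grad u\<^sub>0 x))\<^sup>2 * divergence \<xi> x
          - u\<^sub>0 x * (weak_grad u\<^sub>0 x \<bullet> grad (divergence \<xi>) x))) (at 0)"
proof -
  interpret transported_H1 \<xi> T u\<^sub>0
    by unfold_locales (use assms in auto)
  have energy: "(LINT x|lebesgue. 1/2 * (norm (weak_grad (u t) x))\<^sup>2) = (LINT x|lebesgue. e t x)" for t
    by (rule push_forward_energy[OF assms(4)])
  show ?thesis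
    unfolding energy using push_forward_H1[OF assms(4)] energy_derivative by blast
qed

end
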